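(* Let $\mathcal{P}=\mathcal{T}(V)/(R)$ be a binary quadratic operad (with finite-dimensional space of generators $V$). Then there is an isomorphism of operads $$\mathrm{BSu}(\mathcal{P})\;\cong\;\mathit{PreLie}\bullet\mathcal{P},$$ where $\mathrm{BSu}(\mathcal P)$ is the bisuccessor of $\mathcal P$ and $\bullet$ is the Manin black product.
   Context: Fix a field $\mathbf{k}$. Operads are symmetric operads in $\mathbf{k}$-vector spaces (right actions of the symmetric groups $\mathbb{S}_n$). **Free operad.** For an $\mathbb{S}_2$-module $V$ (seen as an $\mathbb S$-module concentrated in arity 2), $\mathcal{T}(V)$ is the free operad on $V$. $\mathcal{T}(V)(n)$ is spanned by planar binary rooted trees with $n$ leaves labeled bijectively by $\{1,\dots,n\}$ and each vertex labeled by an element of $V$; such trees are multilinear in the vertex labels, and exchanging the left and right subtrees of a vertex labeled $\omega$ gives the same element after replacing $\omega$ by $\omega^{(12)}$. A binary operad is an operad $\mathcal{P}=\mathcal{T}(V)/(R)$ with $R$ spanned, as an $\mathbb S$-module, by homogeneous elements (each lying in some $\mathcal{T}(V)(n)$). It is quadratic if $R\subseteq\mathcal{T}(V)(3)$ ($R$ an $\mathbb S_3$-submodule). **Bisuccessor.** Let $\widetilde V=V\otimes(\mathbf{k}\prec\oplus\,\mathbf{k}\succ)$, write $\omega_\prec=\omega\otimes\prec$, $\omega_\succ=\omega\otimes\succ$, $\omega_\star=\omega_\prec+\omega_\succ$, with $\mathbb{S}_2$-action $(\omega_\prec)^{(12)}=(\omega^{(12)})_\succ$, $(\omega_\succ)^{(12)}=(\omega^{(12)})_\prec$.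 For a labeled tree $\tau$ and a leaf $x$ of $\tau$, $\mathrm{BSu}_x(\tau)$ is obtained by relabeling vertices: a vertex labeled $\omega$ on the path from the root to $x$ gets the label $\omega_\prec$ if the path turns left there and $\omega_\succ$ if it turns right there; a vertex labeled $\omega$ not on this path gets the label $\omega_\star$. This extends linearly to $\mathrm{BSu}_x:\mathcal{T}(V)(n)\to\mathcal{T}(\widetilde V)(n)$. The bisuccessor of $\mathcal{P}$ is $\mathrm{BSu}(\mathcal{P})=\mathcal{T}(\widetilde V)/(\mathrm{BSu}(R))$, where $\mathrm{BSu}(R)$ consists of all $\mathrm{BSu}_x(r)$, $r\in R$ homogeneous of arity $n$, $x\in\{1,\dots,n\}$. **PreLie.** $\mathit{PreLie}$ is the operad of right pre-Lie algebras: one bilinear operation with $(x\cdot y)\cdot z-x\cdot(y\cdot z)=(x\cdot z)\cdot y-x\cdot(z\cdot y)$; its generators form the regular representation $\mathbf k[\mathbb S_2]$. **Manin black product.** For $\omega,\nu\in V$ let $\omega\circ_{\rm I}\nu$, $\omega\circ_{\rm II}\nu$, $\omega\circ_{\rm III}\nu$ be the elements of $\mathcal{T}(V)(3)$ given by $\omega(\nu(x,y),z)$, $\omega(\nu(y,z),x)$, $\omega(\nu(z,x),y)$ respectively (inputs $x,y,z$ = leaves $1,2,3$). Then $\mathcal{T}(V)(3)=\bigoplus_{u\in\{\rm I,II,III\}}V\circ_uV$, each summand being a copy of $V\otimes V$. For binary quadratic operads $\mathcal{P}=\mathcal{T}(V)/(R)$, $\mathcal{Q}=\mathcal{T}(W)/(S)$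 with finite-dimensional generating spaces, put $$\mathcal{P}\bullet\mathcal{Q}=\mathcal{T}(V\otimes W\otimes \mathrm{sgn}_{\mathbb{S}_2})/(\Psi(R\otimes S)),$$ where $\Psi:\mathcal T(V)(3)\otimes\mathcal T(W)(3)\to\mathcal T(V\otimes W\otimes\mathrm{sgn}_{\mathbb S_2})(3)$ sends $(\omega\circ_u\nu)\otimes(\omega'\circ_v\nu')$ to $(\omega\otimes\omega'\otimes1)\circ_u(\nu\otimes\nu'\otimes1)$ if $u=v$ and to $0$ if $u\ne v$. *)

theory Defs
  imports
    "Jordan_Normal_Form.VS_Connect"
    "HOL-Algebra.AbelCoset"
    "HOL-Library.Poly_Mapping"
    "HOL-Combinatorics.Permutations"
begin

text \<open>
  The ground field is a type \<open>'k :: field\<close>, viewed as the ring record \<open>class_ring\<close>, so that vector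
  spaces with explicit carriers are the \<open>vectorspace class_ring V\<close> of the library. The fields
  \<open>mult\<close> and \<open>one\<close> of a module record play no role.
\<close>

section \<open>Free vector spaces, quotients, tensor products\<close>

definition free_space :: "'x set \<Rightarrow> ('k::field, 'x \<Rightarrow>\<^sub>0 'k) module" where
  "free_space X =
    \<lparr>carrier = {f. Poly_Mapping.keys f \<subseteq> X}, mult = (\<lambda>_ _. 0), one = 0,
     zero = 0, add = (+), smult = (\<lambda>c. Poly_Mapping.map ((*) c))\<rparr>"

definition pushforward :: "('x \<Rightarrow> 'y) \<Rightarrow> ('x \<Rightarrow>\<^sub>0 'k::field) \<Rightarrow> ('y \<Rightarrow>\<^sub>0 'k)" where
  "pushforward g p =
    (\<Sum>x\<in>Poly_Mapping.keys p. Poly_Mapping.single (g x) (Poly_Mapping.lookup p x))"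

definition lin_span :: "('k::field, 'a, 'm) module_scheme \<Rightarrow> 'a set \<Rightarrow> 'a set" where
  "lin_span M S = LinearCombinations.module.span class_ring M S"

definition coset_map :: "('k, 'b, 'm) module_scheme \<Rightarrow> 'b set \<Rightarrow> ('a \<Rightarrow> 'b) \<Rightarrow> 'a set \<Rightarrow> 'b set" where
  \<comment> \<open>The map induced by \<open>f\<close> from a quotient into \<open>M / N\<close>: when \<open>f\<close> is compatible with the
      two subspaces, all the cosets in this union coincide.\<close>
  "coset_map M N f A = (\<Union>a\<in>A. N +>\<^bsub>M\<^esub> f a)"

definition quotient_space :: "('k::field, 'a, 'm) module_scheme \<Rightarrow> 'a set \<Rightarrow> ('k, 'a set) module" where
  "quotient_space M N =
    \<lparr>carrier = a_rcosets\<^bsub>M\<^esub> N, mult = (\<lambda>_ _. N), one = N,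
     zero = N, add = set_add M, smult = (\<lambda>c. coset_map M N (smult M c))\<rparr>"

definition tensor_relations ::
  "('k::field, 'v, 'm) module_scheme \<Rightarrow> ('k, 'w, 'n) module_scheme \<Rightarrow> (('v \<times> 'w) \<Rightarrow>\<^sub>0 'k) set" where
  "tensor_relations V W = lin_span (free_space (carrier V \<times> carrier W))
    ({Poly_Mapping.single (x \<oplus>\<^bsub>V\<^esub> y, w) 1 - Poly_Mapping.single (x, w) 1 - Poly_Mapping.single (y, w) 1
        | x y w. x \<in> carrier V \<and> y \<in> carrier V \<and> w \<in> carrier W}
     \<union> {Poly_Mapping.single (v, x \<oplus>\<^bsub>W\<^esub> y) 1 - Poly_Mapping.single (v, x) 1 - Poly_Mapping.single (v, y) 1
        | v x y. v \<in> carrier V \<and> x \<in> carrier W \<and> y \<in> carrier W}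
     \<union> {Poly_Mapping.single (c \<odot>\<^bsub>V\<^esub> v, w) 1 - Poly_Mapping.single (v, w) c
        | c v w. v \<in> carrier V \<and> w \<in> carrier W}
     \<union> {Poly_Mapping.single (v, c \<odot>\<^bsub>W\<^esub> w) 1 - Poly_Mapping.single (v, w) c
        | c v w. v \<in> carrier V \<and> w \<in> carrier W})"

definition tensor_space ::
  "('k::field, 'v, 'm) module_scheme \<Rightarrow> ('k, 'w, 'n) module_scheme
    \<Rightarrow> ('k, (('v \<times> 'w) \<Rightarrow>\<^sub>0 'k) set) module" where
  "tensor_space V W =
    quotient_space (free_space (carrier V \<times> carrier W)) (tensor_relations V W)"

definition pure_tensor ::
  "('k::field, 'v, 'm) module_scheme \<Rightarrow> ('k, 'w, 'n) module_scheme
    \<Rightarrow> 'v \<Rightarrow> 'w \<Rightarrow> (('v \<times> 'w) \<Rightarrow>\<^sub>0 'k) set" where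
  "pure_tensor V W v w =
    tensor_relations V W +>\<^bsub>free_space (carrier V \<times> carrier W)\<^esub> Poly_Mapping.single (v, w) 1"

definition tensor_subspace ::
  "('k::field, 'v, 'm) module_scheme \<Rightarrow> ('k, 'w, 'n) module_scheme
    \<Rightarrow> 'v set \<Rightarrow> 'w set \<Rightarrow> (('v \<times> 'w) \<Rightarrow>\<^sub>0 'k) set set" where
  \<comment> \<open>For subspaces \<open>A\<close> of \<open>V\<close> and \<open>B\<close> of \<open>W\<close>, the tensor product of \<open>A\<close> and \<open>B\<close> as a subspace
      of that of \<open>V\<close> and \<open>W\<close>.\<close>
  "tensor_subspace V W A B =
    lin_span (tensor_space V W) {pure_tensor V W a b | a b. a \<in> A \<and> b \<in> B}"


section \<open>Representations of the symmetric group on two letters\<close>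

text \<open>An \<open>\<S>\<^sub>2\<close>-module is a vector space with the action \<open>swap\<close> of the transposition \<open>(12)\<close>.\<close>

record ('k, 'v) s2module = "('k, 'v) module" +
  swap :: "'v \<Rightarrow> 'v"

definition s2_module :: "('k::field, 'v) s2module \<Rightarrow> bool" where
  "s2_module V \<longleftrightarrow>
    linear_map class_ring V V (swap V) \<and> (\<forall>v\<in>carrier V. swap V (swap V v) = v)"

definition with_swap :: "('k, 'v) module \<Rightarrow> ('v \<Rightarrow> 'v) \<Rightarrow> ('k, 'v) s2module" where
  "with_swap M f = module.extend M (s2module.fields f)"

definition s2_tensor ::
  "('k::field, 'v) s2module \<Rightarrow> ('k, 'w) s2module \<Rightarrow> ('k, (('v \<times> 'w) \<Rightarrow>\<^sub>0 'k) set) s2module" where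
  "s2_tensor V W = with_swap (tensor_space V W)
    (coset_map (free_space (carrier V \<times> carrier W)) (tensor_relations V W)
      (pushforward (map_prod (swap V) (swap W))))"

definition sgn_rep :: "('k::field, 'k) s2module" where
  "sgn_rep = \<lparr>carrier = UNIV, mult = (*), one = 1, zero = 0, add = (+), smult = (*), swap = uminus\<rparr>"

definition regular_rep :: "('k::field, (nat \<Rightarrow> nat) \<Rightarrow>\<^sub>0 'k) s2module" where
  "regular_rep = with_swap (free_space {\<pi>. \<pi> permutes {1, 2}})
    (pushforward (\<lambda>\<pi>. \<pi> \<circ> Transposition.transpose 1 2))"

datatype side = Prec | Succ

definition side_rep :: "('k::field, side \<Rightarrow>\<^sub>0 'k) s2module" where
  "side_rep = with_swap (free_space UNIV) (pushforward (case_side Succ Prec))"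


section \<open>Symmetric operads\<close>

text \<open>
  Symmetric operads are given by their partial compositions: \<open>pcomp P m n i p q\<close> is
  \<open>p \<circ>\<^sub>i q\<close> for \<open>p\<close> of arity \<open>m\<close> and \<open>q\<close> of arity \<open>n\<close>, and \<open>act P n \<sigma> p\<close> is the right action
  \<open>p \<cdot> \<sigma>\<close>. The arities are arguments because the same element may lie in several arities.
\<close>

record ('k, 'a) operad_data =
  arity :: "nat \<Rightarrow> ('k, 'a) module"
  act :: "nat \<Rightarrow> (nat \<Rightarrow> nat) \<Rightarrow> 'a \<Rightarrow> 'a"
  pcomp :: "nat \<Rightarrow> nat \<Rightarrow> nat \<Rightarrow> 'a \<Rightarrow> 'a \<Rightarrow> 'a"
  unit :: 'a

text \<open>
  Inserting a block of \<open>n\<close> inputs in place of the \<open>i\<close>-th one, the input \<open>j \<noteq> i\<close> becomes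
  \<open>shift i n j\<close> and the \<open>k\<close>-th input of the block becomes \<open>i - 1 + k\<close>. The permutation
  \<open>block_perm m n i \<sigma> \<tau>\<close> sends \<open>shift i n j\<close> to \<open>shift (\<sigma> i) n (\<sigma> j)\<close> and
  \<open>i - 1 + k\<close> to \<open>\<sigma> i - 1 + \<tau> k\<close>.
\<close>

definition shift :: "nat \<Rightarrow> nat \<Rightarrow> nat \<Rightarrow> nat" where
  "shift i n j = (if j < i then j else j + n - 1)"

definition block_perm ::
  "nat \<Rightarrow> nat \<Rightarrow> nat \<Rightarrow> (nat \<Rightarrow> nat) \<Rightarrow> (nat \<Rightarrow> nat) \<Rightarrow> nat \<Rightarrow> nat" where
  "block_perm m n i \<sigma> \<tau> l =
    (if l \<notin> {1..m + n - 1} then l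
     else if l < i then shift (\<sigma> i) n (\<sigma> l)
     else if l < i + n then \<sigma> i - 1 + \<tau> (l - i + 1)
     else shift (\<sigma> i) n (\<sigma> (l - n + 1)))"

locale operad =
  fixes P :: "('k::field, 'a) operad_data"
  assumes act_linear: "\<sigma> permutes {1..n} \<Longrightarrow>
      linear_map class_ring (arity P n) (arity P n) (act P n \<sigma>)"
    and act_id: "p \<in> carrier (arity P n) \<Longrightarrow> act P n id p = p"
    and act_comp: "\<sigma> permutes {1..n} \<Longrightarrow> \<tau> permutes {1..n} \<Longrightarrow> p \<in> carrier (arity P n) \<Longrightarrow>
      act P n \<tau> (act P n \<sigma> p) = act P n (\<sigma> \<circ> \<tau>) p"
    and pcomp_linear_left: "i \<in> {1..m} \<Longrightarrow> q \<in> carrier (arity P n) \<Longrightarrow>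
      linear_map class_ring (arity P m) (arity P (m + n - 1)) (\<lambda>p. pcomp P m n i p q)"
    and pcomp_linear_right: "i \<in> {1..m} \<Longrightarrow> p \<in> carrier (arity P m) \<Longrightarrow>
      linear_map class_ring (arity P n) (arity P (m + n - 1)) (\<lambda>q. pcomp P m n i p q)"
    and unit_closed: "unit P \<in> carrier (arity P 1)"
    and unit_left: "q \<in> carrier (arity P n) \<Longrightarrow> pcomp P 1 n 1 (unit P) q = q"
    and unit_right: "i \<in> {1..m} \<Longrightarrow> p \<in> carrier (arity P m) \<Longrightarrow> pcomp P m 1 i p (unit P) = p"
    and sequential: "i \<in> {1..l} \<Longrightarrow> j \<in> {1..m} \<Longrightarrow>
      p \<in> carrier (arity P l) \<Longrightarrow> q \<in> carrier (arity P m) \<Longrightarrow> r \<in> carrier (arity P n) \<Longrightarrow>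
      pcomp P (l + m - 1) n (i - 1 + j) (pcomp P l m i p q) r =
      pcomp P l (m + n - 1) i p (pcomp P m n j q r)"
    and parallel: "1 \<le> i \<Longrightarrow> i < k \<Longrightarrow> k \<le> l \<Longrightarrow>
      p \<in> carrier (arity P l) \<Longrightarrow> q \<in> carrier (arity P m) \<Longrightarrow> r \<in> carrier (arity P n) \<Longrightarrow>
      pcomp P (l + m - 1) n (k - 1 + m) (pcomp P l m i p q) r =
      pcomp P (l + n - 1) m i (pcomp P l n k p r) q"
    and equivariant: "i \<in> {1..m} \<Longrightarrow> \<sigma> permutes {1..m} \<Longrightarrow> \<tau> permutes {1..n} \<Longrightarrow>
      p \<in> carrier (arity P m) \<Longrightarrow> q \<in> carrier (arity P n) \<Longrightarrow>
      pcomp P m n i (act P m \<sigma> p) (act P n \<tau> q) =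
      act P (m + n - 1) (block_perm m n i \<sigma> \<tau>) (pcomp P m n (\<sigma> i) p q)"

definition operad_iso ::
  "('k::field, 'a) operad_data \<Rightarrow> ('k, 'b) operad_data \<Rightarrow> (nat \<Rightarrow> 'a \<Rightarrow> 'b) \<Rightarrow> bool" where
  "operad_iso P Q f \<longleftrightarrow>
    (\<forall>n. linear_map class_ring (arity P n) (arity Q n) (f n)
       \<and> bij_betw (f n) (carrier (arity P n)) (carrier (arity Q n)))
    \<and> (\<forall>n \<sigma>. \<sigma> permutes {1..n} \<longrightarrow>
        (\<forall>p\<in>carrier (arity P n). f n (act P n \<sigma> p) = act Q n \<sigma> (f n p)))
    \<and> (\<forall>m n. \<forall>i\<in>{1..m}. \<forall>p\<in>carrier (arity P m). \<forall>q\<in>carrier (arity P n).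
        f (m + n - 1) (pcomp P m n i p q) = pcomp Q m n i (f m p) (f n q))
    \<and> f 1 (unit P) = unit Q"

definition operad_isomorphic :: "('k::field, 'a) operad_data \<Rightarrow> ('k, 'b) operad_data \<Rightarrow> bool" where
  "operad_isomorphic P Q \<longleftrightarrow> operad P \<and> operad Q \<and> (\<exists>f. operad_iso P Q f)"

definition operad_ideal :: "('k::field, 'a) operad_data \<Rightarrow> (nat \<Rightarrow> 'a set) \<Rightarrow> bool" where
  "operad_ideal P I \<longleftrightarrow>
    (\<forall>n. submodule class_ring (I n) (arity P n))
    \<and> (\<forall>n \<sigma>. \<sigma> permutes {1..n} \<longrightarrow> (\<forall>p\<in>I n. act P n \<sigma> p \<in> I n))
    \<and> (\<forall>m n. \<forall>i\<in>{1..m}. \<forall>p\<in>I m. \<forall>q\<in>carrier (arity P n). pcomp P m n i p q \<in> I (m + n - 1))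
    \<and> (\<forall>m n. \<forall>i\<in>{1..m}. \<forall>p\<in>carrier (arity P m). \<forall>q\<in>I n. pcomp P m n i p q \<in> I (m + n - 1))"

definition generated_ideal :: "('k::field, 'a) operad_data \<Rightarrow> (nat \<Rightarrow> 'a set) \<Rightarrow> nat \<Rightarrow> 'a set" where
  "generated_ideal P R n = \<Inter>{I n | I. operad_ideal P I \<and> (\<forall>m. R m \<subseteq> I m)}"

definition quotient_operad ::
  "('k::field, 'a) operad_data \<Rightarrow> (nat \<Rightarrow> 'a set) \<Rightarrow> ('k, 'a set) operad_data" where
  "quotient_operad P I =
    \<lparr>arity = (\<lambda>n. quotient_space (arity P n) (I n)),
     act = (\<lambda>n \<sigma>. coset_map (arity P n) (I n) (act P n \<sigma>)),
     pcomp = (\<lambda>m n i A B. \<Union>a\<in>A. coset_map (arity P (m + n - 1)) (I (m + n - 1)) (pcomp P m n i a) B),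
     unit = I 1 +>\<^bsub>arity P 1\<^esub> unit P\<rparr>"

definition sym_submodule :: "('k::field, 'a) operad_data \<Rightarrow> nat \<Rightarrow> 'a set \<Rightarrow> bool" where
  "sym_submodule P n S \<longleftrightarrow>
    submodule class_ring S (arity P n)
    \<and> (\<forall>\<sigma>. \<sigma> permutes {1..n} \<longrightarrow> (\<forall>p\<in>S. act P n \<sigma> p \<in> S))"


section \<open>The free operad on binary generators\<close>

datatype (labels: 'v) btree = Leaf nat | Node 'v "'v btree" "'v btree"

primrec leaves :: "'v btree \<Rightarrow> nat list" where
  "leaves (Leaf j) = [j]"
| "leaves (Node v s t) = leaves s @ leaves t"

primrec subst_leaves :: "(nat \<Rightarrow> 'v btree) \<Rightarrow> 'v btree \<Rightarrow> 'v btree" where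
  "subst_leaves f (Leaf j) = f j"
| "subst_leaves f (Node v s t) = Node v (subst_leaves f s) (subst_leaves f t)"

definition relabel :: "(nat \<Rightarrow> nat) \<Rightarrow> 'v btree \<Rightarrow> 'v btree" where
  "relabel g = subst_leaves (\<lambda>j. Leaf (g j))"

definition graft :: "nat \<Rightarrow> nat \<Rightarrow> 'v btree \<Rightarrow> 'v btree \<Rightarrow> 'v btree" where
  "graft n i s t =
    subst_leaves (\<lambda>j. if j = i then relabel (\<lambda>k. i - 1 + k) t else Leaf (shift i n j)) s"

definition btrees :: "'v set \<Rightarrow> nat \<Rightarrow> 'v btree set" where
  "btrees X n = {t. labels t \<subseteq> X \<and> distinct (leaves t) \<and> set (leaves t) = {1..n}}"

definition tree_operad :: "'v set \<Rightarrow> ('k::field, 'v btree \<Rightarrow>\<^sub>0 'k) operad_data" where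
  "tree_operad X =
    \<lparr>arity = (\<lambda>n. free_space (btrees X n)),
     act = (\<lambda>n \<sigma>. pushforward (relabel (inv_into UNIV \<sigma>))),
     pcomp = (\<lambda>m n i p q. \<Sum>s\<in>Poly_Mapping.keys p. \<Sum>t\<in>Poly_Mapping.keys q.
       Poly_Mapping.single (graft n i s t) (Poly_Mapping.lookup p s * Poly_Mapping.lookup q t)),
     unit = Poly_Mapping.single (Leaf 1) 1\<rparr>"

text \<open>
  The last two rules allow the multilinearity and symmetry relations at any vertex of a tree.
\<close>

inductive_set vertex_relations :: "('k::field, 'v) s2module \<Rightarrow> ('v btree \<Rightarrow>\<^sub>0 'k) set"
  for V :: "('k::field, 'v) s2module" where
  add: "x \<in> carrier V \<Longrightarrow> y \<in> carrier V \<Longrightarrow>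
    Poly_Mapping.single (Node (x \<oplus>\<^bsub>V\<^esub> y) s t) 1
      - Poly_Mapping.single (Node x s t) 1 - Poly_Mapping.single (Node y s t) 1
      \<in> vertex_relations V"
| smult: "x \<in> carrier V \<Longrightarrow>
    Poly_Mapping.single (Node (c \<odot>\<^bsub>V\<^esub> x) s t) 1 - Poly_Mapping.single (Node x s t) c
      \<in> vertex_relations V"
| swap: "x \<in> carrier V \<Longrightarrow>
    Poly_Mapping.single (Node x s t) 1 - Poly_Mapping.single (Node (swap V x) t s) 1
      \<in> vertex_relations V"
| left: "r \<in> vertex_relations V \<Longrightarrow> pushforward (\<lambda>s. Node x s t) r \<in> vertex_relations V"
| right: "r \<in> vertex_relations V \<Longrightarrow> pushforward (\<lambda>t. Node x s t) r \<in> vertex_relations V"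

definition tree_relations :: "('k::field, 'v) s2module \<Rightarrow> nat \<Rightarrow> ('v btree \<Rightarrow>\<^sub>0 'k) set" where
  "tree_relations V n = lin_span (free_space (btrees (carrier V) n))
    (vertex_relations V \<inter> carrier (free_space (btrees (carrier V) n)))"

definition free_operad :: "('k::field, 'v) s2module \<Rightarrow> ('k, ('v btree \<Rightarrow>\<^sub>0 'k) set) operad_data" where
  "free_operad V = quotient_operad (tree_operad (carrier V)) (tree_relations V)"

definition tree_class ::
  "('k::field, 'v) s2module \<Rightarrow> nat \<Rightarrow> ('v btree \<Rightarrow>\<^sub>0 'k) \<Rightarrow> ('v btree \<Rightarrow>\<^sub>0 'k) set" where
  "tree_class V n p = tree_relations V n +>\<^bsub>free_space (btrees (carrier V) n)\<^esub> p"


section \<open>Binary operads given by generators and relations\<close>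

record (overloaded) ('k::field, 'v) presentation =
  gens :: "('k, 'v) s2module"
  rels :: "nat \<Rightarrow> ('v btree \<Rightarrow>\<^sub>0 'k) set set"

definition operad_of :: "('k::field, 'v) presentation \<Rightarrow> ('k, ('v btree \<Rightarrow>\<^sub>0 'k) set set) operad_data" where
  "operad_of P = quotient_operad (free_operad (gens P)) (generated_ideal (free_operad (gens P)) (rels P))"

definition binary_quadratic :: "('k::field, 'v) presentation \<Rightarrow> bool" where
  "binary_quadratic P \<longleftrightarrow>
    s2_module (gens P)
    \<and> sym_submodule (free_operad (gens P)) 3 (rels P 3)
    \<and> (\<forall>n. n \<noteq> 3 \<longrightarrow> rels P n \<subseteq> {\<zero>\<^bsub>arity (free_operad (gens P)) n\<^esub>})"


section \<open>The bisuccessor\<close>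

definition bsu_gens :: "('k::field, 'v) s2module \<Rightarrow> ('k, (('v \<times> (side \<Rightarrow>\<^sub>0 'k)) \<Rightarrow>\<^sub>0 'k) set) s2module" where
  "bsu_gens V = s2_tensor V side_rep"

definition at_side ::
  "('k::field, 'v) s2module \<Rightarrow> side \<Rightarrow> 'v \<Rightarrow> (('v \<times> (side \<Rightarrow>\<^sub>0 'k)) \<Rightarrow>\<^sub>0 'k) set" where
  "at_side V e \<omega> = pure_tensor V side_rep \<omega> (Poly_Mapping.single e 1)"

definition at_star ::
  "('k::field, 'v) s2module \<Rightarrow> 'v \<Rightarrow> (('v \<times> (side \<Rightarrow>\<^sub>0 'k)) \<Rightarrow>\<^sub>0 'k) set" where
  "at_star V \<omega> = at_side V Prec \<omega> \<oplus>\<^bsub>bsu_gens V\<^esub> at_side V Succ \<omega>"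

text \<open>A vertex lies on the path from the root to the leaf \<open>x\<close> iff \<open>x\<close> is a leaf above it.\<close>

primrec bsu_tree ::
  "('k::field, 'v) s2module \<Rightarrow> nat \<Rightarrow> 'v btree \<Rightarrow> (('v \<times> (side \<Rightarrow>\<^sub>0 'k)) \<Rightarrow>\<^sub>0 'k) set btree" where
  "bsu_tree V x (Leaf j) = Leaf j"
| "bsu_tree V x (Node \<omega> s t) =
    Node (if x \<in> set (leaves s) then at_side V Prec \<omega>
          else if x \<in> set (leaves t) then at_side V Succ \<omega>
          else at_star V \<omega>)
      (bsu_tree V x s) (bsu_tree V x t)"

definition bsu ::
  "('k::field, 'v) s2module \<Rightarrow> nat \<Rightarrow> nat \<Rightarrow> ('v btree \<Rightarrow>\<^sub>0 'k) set
    \<Rightarrow> ((('v \<times> (side \<Rightarrow>\<^sub>0 'k)) \<Rightarrow>\<^sub>0 'k) set btree \<Rightarrow>\<^sub>0 'k) set" where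
  "bsu V n x = coset_map (free_space (btrees (carrier (bsu_gens V)) n)) (tree_relations (bsu_gens V) n)
    (pushforward (bsu_tree V x))"

definition bisuccessor ::
  "('k::field, 'v) presentation \<Rightarrow> ('k, (('v \<times> (side \<Rightarrow>\<^sub>0 'k)) \<Rightarrow>\<^sub>0 'k) set) presentation" where
  "bisuccessor P =
    \<lparr>gens = bsu_gens (gens P),
     rels = (\<lambda>n. {bsu (gens P) n x r | x r. x \<in> {1..n} \<and> r \<in> rels P n})\<rparr>"


section \<open>The operad of right pre-Lie algebras\<close>

text \<open>
  The generator \<open>x \<cdot> y\<close> is the identity permutation in the regular representation.
\<close>

definition prelie_relator :: "((nat \<Rightarrow> nat) \<Rightarrow>\<^sub>0 'k::field) btree \<Rightarrow>\<^sub>0 'k" where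
  "prelie_relator =
    (let \<mu> = Poly_Mapping.single id 1; x = Leaf 1; y = Leaf 2; z = Leaf 3 in
      Poly_Mapping.single (Node \<mu> (Node \<mu> x y) z) 1
      - Poly_Mapping.single (Node \<mu> x (Node \<mu> y z)) 1
      - (Poly_Mapping.single (Node \<mu> (Node \<mu> x z) y) 1
         - Poly_Mapping.single (Node \<mu> x (Node \<mu> z y)) 1))"

definition PreLie :: "('k::field, (nat \<Rightarrow> nat) \<Rightarrow>\<^sub>0 'k) presentation" where
  "PreLie =
    \<lparr>gens = regular_rep,
     rels = (\<lambda>n. if n = 3
       then \<Inter>{S. sym_submodule (free_operad regular_rep) 3 S \<and> tree_class regular_rep 3 prelie_relator \<in> S}
       else {})\<rparr>"


section \<open>The Manin black product\<close>

datatype manin_type = Type_I | Type_II | Type_III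

primrec manin_tree :: "manin_type \<Rightarrow> 'v \<Rightarrow> 'v \<Rightarrow> 'v btree" where
  "manin_tree Type_I \<omega> \<nu> = Node \<omega> (Node \<nu> (Leaf 1) (Leaf 2)) (Leaf 3)"
| "manin_tree Type_II \<omega> \<nu> = Node \<omega> (Node \<nu> (Leaf 2) (Leaf 3)) (Leaf 1)"
| "manin_tree Type_III \<omega> \<nu> = Node \<omega> (Node \<nu> (Leaf 3) (Leaf 1)) (Leaf 2)"

definition manin_circ ::
  "('k::field, 'v) s2module \<Rightarrow> manin_type \<Rightarrow> 'v \<Rightarrow> 'v \<Rightarrow> ('v btree \<Rightarrow>\<^sub>0 'k) set" where
  "manin_circ V u \<omega> \<nu> = tree_class V 3 (Poly_Mapping.single (manin_tree u \<omega> \<nu>) 1)"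

type_synonym ('k, 'v, 'w) black = "(((('v \<times> 'w) \<Rightarrow>\<^sub>0 'k) set \<times> 'k) \<Rightarrow>\<^sub>0 'k) set"

definition black_gens ::
  "('k::field, 'v) s2module \<Rightarrow> ('k, 'w) s2module \<Rightarrow> ('k, ('k, 'v, 'w) black) s2module" where
  "black_gens V W = s2_tensor (s2_tensor V W) sgn_rep"

definition black_tensor ::
  "('k::field, 'v) s2module \<Rightarrow> ('k, 'w) s2module \<Rightarrow> 'v \<Rightarrow> 'w \<Rightarrow> ('k, 'v, 'w) black" where
  "black_tensor V W v w = pure_tensor (s2_tensor V W) sgn_rep (pure_tensor V W v w) 1"

definition is_manin_psi ::
  "('k::field, 'v) s2module \<Rightarrow> ('k, 'w) s2module
    \<Rightarrow> (((('v btree \<Rightarrow>\<^sub>0 'k) set \<times> ('w btree \<Rightarrow>\<^sub>0 'k) set) \<Rightarrow>\<^sub>0 'k) set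
         \<Rightarrow> (('k, 'v, 'w) black btree \<Rightarrow>\<^sub>0 'k) set) \<Rightarrow> bool" where
  "is_manin_psi V W \<Psi> \<longleftrightarrow>
    linear_map class_ring
      (tensor_space (arity (free_operad V) 3) (arity (free_operad W) 3))
      (arity (free_operad (black_gens V W)) 3) \<Psi>
    \<and> (\<forall>u v. \<forall>\<omega>\<in>carrier V. \<forall>\<nu>\<in>carrier V. \<forall>\<omega>'\<in>carrier W. \<forall>\<nu>'\<in>carrier W.
        \<Psi> (pure_tensor (arity (free_operad V) 3) (arity (free_operad W) 3)
             (manin_circ V u \<omega> \<nu>) (manin_circ W v \<omega>' \<nu>')) =
        (if u = v
         then manin_circ (black_gens V W) u (black_tensor V W \<omega> \<omega>') (black_tensor V W \<nu> \<nu>')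
         else \<zero>\<^bsub>arity (free_operad (black_gens V W)) 3\<^esub>))"

text \<open>
  The map \<open>\<Psi>\<close> exists and is unique on its domain, since \<open>\<T>(V)(3)\<close> is the direct sum of the
  \<open>V \<circ>\<^sub>u V\<close>, each being a copy of \<open>V \<otimes> V\<close>.
\<close>

definition manin_psi ::
  "('k::field, 'v) s2module \<Rightarrow> ('k, 'w) s2module
    \<Rightarrow> ((('v btree \<Rightarrow>\<^sub>0 'k) set \<times> ('w btree \<Rightarrow>\<^sub>0 'k) set) \<Rightarrow>\<^sub>0 'k) set
    \<Rightarrow> (('k, 'v, 'w) black btree \<Rightarrow>\<^sub>0 'k) set" where
  "manin_psi V W = (SOME \<Psi>. is_manin_psi V W \<Psi>)"

definition black_product ::
  "('k::field, 'v) presentation \<Rightarrow> ('k, 'w) presentation \<Rightarrow> ('k, ('k, 'v, 'w) black) presentation"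
  (infixl \<open>\<bullet>\<^sub>M\<close> 70) where
  "P \<bullet>\<^sub>M Q =
    \<lparr>gens = black_gens (gens P) (gens Q),
     rels = (\<lambda>n. if n = 3
       then manin_psi (gens P) (gens Q) `
         tensor_subspace (arity (free_operad (gens P)) 3) (arity (free_operad (gens Q)) 3)
           (rels P 3) (rels Q 3)
       else {})\<rparr>"

end

(*
The space V (x) k{<,>} and the space k[S_2] (x) V (x) sgn are isomorphic S_2-modules: v_< corresponds to
mu (x) v (x) 1 and v_> to -(mu^(12) (x) v (x) 1), the sign of sgn turning the swap of < and > into the
transposition of k[S_2]. The induced isomorphism of free operads matches the relations, because the pre-Lie
relator with distinguished input x, written in the decomposition of T(V)(3) by tree types, has exactly one tree
with labels mu, mu (x is the left inner leaf), one with mu, mu^(12) (x is the right inner leaf), and two with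
outer label mu^(12) (x is the outer leaf). Hence Psi(relator_x (x) r) is BSu_x(r) for every r. Since the relations
of PreLie are spanned by the relators for x = 1, 2, 3, both ideals of relations correspond to each other.
*)
theory Submission
  imports Defs
begin

text \<open>\<open>\<Psi>\<close> is specified only by its values, so it must first be shown to
  exist. This takes the decomposition of arity three as a universal property: three bilinear maps,
  one for each tree type, extend to a linear map. To prove it, a function is written down on all
  trees, because vertex relations are generated without regard to well-formedness. The other
  obstacle is that BSu_x labels a vertex by inspecting the leaves beyond it. It respects the
  symmetry relation at a vertex only if x is not on both sides, so distinctness of leaves has to
  accompany the induction on relations. The signs agree as follows. Each > contributes -mu^(12), and
  the star label contributes mu - mu^(12). With x as outer leaf this gives -mu^(12) outside and mu -
  mu^(12) inside, hence two trees of opposite sign; with x as right inner leaf one sign remains.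
  These are the coefficients of the relator. Only generated ideals are compared, since BSu(R) need
  not be a subspace whereas Psi(R (x) S) is one.\<close>

abbreviation "keys \<equiv> Poly_Mapping.keys"
abbreviation "lookup \<equiv> Poly_Mapping.lookup"
abbreviation "single \<equiv> Poly_Mapping.single"

section \<open>Linear algebra with explicit carriers\<close>

abbreviation is_space :: "('k::field, 'v, 'm) module_scheme \<Rightarrow> bool" where
  "is_space V \<equiv> vectorspace class_ring V"

abbreviation is_linear ::
  "('k::field, 'v, 'm) module_scheme \<Rightarrow> ('k, 'w, 'n) module_scheme \<Rightarrow> ('v \<Rightarrow> 'w) \<Rightarrow> bool" where
  "is_linear V W f \<equiv> linear_map class_ring V W f"

abbreviation is_subspace :: "'v set \<Rightarrow> ('k::field, 'v, 'm) module_scheme \<Rightarrow> bool" where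
  "is_subspace N V \<equiv> LinearCombinations.submodule class_ring N V"

lemma class_field_field: "field (class_ring :: 'k::field ring)"
  by (rule class_field.field_axioms)

text \<open>The additive inverse is demanded as the multiple by \<open>- 1\<close>, so that every
  axiom is an equation or a closure statement and can be simplified in a concrete space.\<close>

lemma vectorspaceI:
  fixes V :: "('k::field, 'v, 'm) module_scheme"
  assumes "\<zero>\<^bsub>V\<^esub> \<in> carrier V"
    and "\<And>v w. v \<in> carrier V \<Longrightarrow> w \<in> carrier V \<Longrightarrow> v \<oplus>\<^bsub>V\<^esub> w \<in> carrier V"
    and "\<And>c v. v \<in> carrier V \<Longrightarrow> c \<odot>\<^bsub>V\<^esub> v \<in> carrier V"
    and "\<And>v. v \<in> carrier V \<Longrightarrow> v \<oplus>\<^bsub>V\<^esub> (- 1 \<odot>\<^bsub>V\<^esub> v) = \<zero>\<^bsub>V\<^esub>"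
    and "\<And>v w. v \<in> carrier V \<Longrightarrow> w \<in> carrier V \<Longrightarrow> v \<oplus>\<^bsub>V\<^esub> w = w \<oplus>\<^bsub>V\<^esub> v"
    and "\<And>u v w. u \<in> carrier V \<Longrightarrow> v \<in> carrier V \<Longrightarrow> w \<in> carrier V \<Longrightarrow>
      (u \<oplus>\<^bsub>V\<^esub> v) \<oplus>\<^bsub>V\<^esub> w = u \<oplus>\<^bsub>V\<^esub> (v \<oplus>\<^bsub>V\<^esub> w)"
    and "\<And>v. v \<in> carrier V \<Longrightarrow> v \<oplus>\<^bsub>V\<^esub> \<zero>\<^bsub>V\<^esub> = v"
    and "\<And>a b v. v \<in> carrier V \<Longrightarrow> (a * b) \<odot>\<^bsub>V\<^esub> v = a \<odot>\<^bsub>V\<^esub> (b \<odot>\<^bsub>V\<^esub> v)"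
    and "\<And>v. v \<in> carrier V \<Longrightarrow> 1 \<odot>\<^bsub>V\<^esub> v = v"
    and "\<And>a b v. v \<in> carrier V \<Longrightarrow> (a + b) \<odot>\<^bsub>V\<^esub> v = a \<odot>\<^bsub>V\<^esub> v \<oplus>\<^bsub>V\<^esub> b \<odot>\<^bsub>V\<^esub> v"
    and "\<And>a v w. v \<in> carrier V \<Longrightarrow> w \<in> carrier V \<Longrightarrow>
      a \<odot>\<^bsub>V\<^esub> (v \<oplus>\<^bsub>V\<^esub> w) = a \<odot>\<^bsub>V\<^esub> v \<oplus>\<^bsub>V\<^esub> a \<odot>\<^bsub>V\<^esub> w"
  shows "is_space V"
proof (rule vs_criteria[OF class_field_field])
  show "\<forall>v\<in>carrier V. \<exists>w\<in>carrier V. v \<oplus>\<^bsub>V\<^esub> w = \<zero>\<^bsub>V\<^esub>"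
    using assms(3,4) by blast
qed (use assms in simp_all)

lemma vectorspaceD:
  fixes V :: "('k::field, 'v, 'm) module_scheme"
  assumes "is_space V"
  shows "\<zero>\<^bsub>V\<^esub> \<in> carrier V"
    and "v \<in> carrier V \<Longrightarrow> w \<in> carrier V \<Longrightarrow> v \<oplus>\<^bsub>V\<^esub> w \<in> carrier V"
    and "v \<in> carrier V \<Longrightarrow> w \<in> carrier V \<Longrightarrow> v \<ominus>\<^bsub>V\<^esub> w \<in> carrier V"
    and "v \<in> carrier V \<Longrightarrow> c \<odot>\<^bsub>V\<^esub> v \<in> carrier V"
    and "v \<in> carrier V \<Longrightarrow> v \<oplus>\<^bsub>V\<^esub> (- 1 \<odot>\<^bsub>V\<^esub> v) = \<zero>\<^bsub>V\<^esub>"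
    and "v \<in> carrier V \<Longrightarrow> w \<in> carrier V \<Longrightarrow> v \<oplus>\<^bsub>V\<^esub> w = w \<oplus>\<^bsub>V\<^esub> v"
    and "u \<in> carrier V \<Longrightarrow> v \<in> carrier V \<Longrightarrow> w \<in> carrier V \<Longrightarrow>
      (u \<oplus>\<^bsub>V\<^esub> v) \<oplus>\<^bsub>V\<^esub> w = u \<oplus>\<^bsub>V\<^esub> (v \<oplus>\<^bsub>V\<^esub> w)"
    and "v \<in> carrier V \<Longrightarrow> v \<oplus>\<^bsub>V\<^esub> \<zero>\<^bsub>V\<^esub> = v"
    and "v \<in> carrier V \<Longrightarrow> \<zero>\<^bsub>V\<^esub> \<oplus>\<^bsub>V\<^esub> v = v"
    and "v \<in> carrier V \<Longrightarrow> (a * b) \<odot>\<^bsub>V\<^esub> v = a \<odot>\<^bsub>V\<^esub> (b \<odot>\<^bsub>V\<^esub> v)"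
    and "v \<in> carrier V \<Longrightarrow> 1 \<odot>\<^bsub>V\<^esub> v = v"
    and "v \<in> carrier V \<Longrightarrow> 0 \<odot>\<^bsub>V\<^esub> v = \<zero>\<^bsub>V\<^esub>"
    and "c \<odot>\<^bsub>V\<^esub> \<zero>\<^bsub>V\<^esub> = \<zero>\<^bsub>V\<^esub>"
    and "v \<in> carrier V \<Longrightarrow> (a + b) \<odot>\<^bsub>V\<^esub> v = a \<odot>\<^bsub>V\<^esub> v \<oplus>\<^bsub>V\<^esub> b \<odot>\<^bsub>V\<^esub> v"
    and "v \<in> carrier V \<Longrightarrow> w \<in> carrier V \<Longrightarrow> a \<odot>\<^bsub>V\<^esub> (v \<oplus>\<^bsub>V\<^esub> w) = a \<odot>\<^bsub>V\<^esub> v \<oplus>\<^bsub>V\<^esub> a \<odot>\<^bsub>V\<^esub> w"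
    and "v \<in> carrier V \<Longrightarrow> w \<in> carrier V \<Longrightarrow> v \<ominus>\<^bsub>V\<^esub> w = v \<oplus>\<^bsub>V\<^esub> (- 1 \<odot>\<^bsub>V\<^esub> w)"
    and "v \<in> carrier V \<Longrightarrow> w \<in> carrier V \<Longrightarrow> v \<ominus>\<^bsub>V\<^esub> w = \<zero>\<^bsub>V\<^esub> \<longleftrightarrow> v = w"
proof -
  interpret V: vectorspace class_ring V by fact
  show "\<zero>\<^bsub>V\<^esub> \<in> carrier V" by simp
  show "v \<oplus>\<^bsub>V\<^esub> w \<in> carrier V" "v \<ominus>\<^bsub>V\<^esub> w \<in> carrier V" "v \<oplus>\<^bsub>V\<^esub> w = w \<oplus>\<^bsub>V\<^esub> v"
    "a \<odot>\<^bsub>V\<^esub> (v \<oplus>\<^bsub>V\<^esub> w) = a \<odot>\<^bsub>V\<^esub> v \<oplus>\<^bsub>V\<^esub> a \<odot>\<^bsub>V\<^esub> w"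
    if "v \<in> carrier V" "w \<in> carrier V" for v w a
    using that V.smult_r_distr[of a v w] by (simp_all add: V.M.add.m_comm)
  show "(u \<oplus>\<^bsub>V\<^esub> v) \<oplus>\<^bsub>V\<^esub> w = u \<oplus>\<^bsub>V\<^esub> (v \<oplus>\<^bsub>V\<^esub> w)"
    if "u \<in> carrier V" "v \<in> carrier V" "w \<in> carrier V" for u v w
    using that by (rule V.M.add.m_assoc)
  have neg: "- 1 \<odot>\<^bsub>V\<^esub> v = \<ominus>\<^bsub>V\<^esub> v" if "v \<in> carrier V" for v
  proof -
    have "v \<oplus>\<^bsub>V\<^esub> (- 1 \<odot>\<^bsub>V\<^esub> v) = (1 + - 1) \<odot>\<^bsub>V\<^esub> v"
      using V.smult_l_distr[of 1 "- 1" v] V.smult_one[of v] that by simp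
    also have "\<dots> = \<zero>\<^bsub>V\<^esub>" using V.smult_l_null[of v] that by simp
    finally show ?thesis
      using V.smult_closed[of "- 1" v] that
      by (metis UNIV_I V.M.minus_equality V.M.add.m_comm partial_object.select_convs(1))
  qed
  show "v \<oplus>\<^bsub>V\<^esub> (- 1 \<odot>\<^bsub>V\<^esub> v) = \<zero>\<^bsub>V\<^esub>" "c \<odot>\<^bsub>V\<^esub> v \<in> carrier V" "v \<oplus>\<^bsub>V\<^esub> \<zero>\<^bsub>V\<^esub> = v" "\<zero>\<^bsub>V\<^esub> \<oplus>\<^bsub>V\<^esub> v = v"
    "(a * b) \<odot>\<^bsub>V\<^esub> v = a \<odot>\<^bsub>V\<^esub> (b \<odot>\<^bsub>V\<^esub> v)" "1 \<odot>\<^bsub>V\<^esub> v = v" "0 \<odot>\<^bsub>V\<^esub> v = \<zero>\<^bsub>V\<^esub>"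
    "(a + b) \<odot>\<^bsub>V\<^esub> v = a \<odot>\<^bsub>V\<^esub> v \<oplus>\<^bsub>V\<^esub> b \<odot>\<^bsub>V\<^esub> v"
    if "v \<in> carrier V" for v a b c
    using that V.smult_assoc1[of a b v] V.smult_one[of v] V.smult_l_null[of v] neg[of v]
      V.smult_l_distr[of a b v] V.smult_closed[of c v] by (simp_all add: V.M.r_neg)
  show "c \<odot>\<^bsub>V\<^esub> \<zero>\<^bsub>V\<^esub> = \<zero>\<^bsub>V\<^esub>" using V.smult_r_null[of c] by simp
  show "v \<ominus>\<^bsub>V\<^esub> w = v \<oplus>\<^bsub>V\<^esub> (- 1 \<odot>\<^bsub>V\<^esub> w)" if "v \<in> carrier V" "w \<in> carrier V" for v w
    using that neg[of w] by (simp add: a_minus_def)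
  show "v \<ominus>\<^bsub>V\<^esub> w = \<zero>\<^bsub>V\<^esub> \<longleftrightarrow> v = w" if "v \<in> carrier V" "w \<in> carrier V" for v w
    using that V.M.minus_equality[of v "\<ominus>\<^bsub>V\<^esub> w"] V.M.r_neg[of w]
    by (auto simp: a_minus_def)
qed

lemmas vectorspace_closed = vectorspaceD(1-4)
lemmas vectorspace_simps = vectorspaceD(1-5,7-15,17)

text \<open>Carries the axioms between records with different extra fields; this is how adding a
  \<open>swap\<close> leaves the vector space unchanged.\<close>

lemma vectorspace_cong:
  assumes "is_space (V :: ('k::field, 'v, 'm) module_scheme)"
    and "carrier V' = carrier V" "add V' = add V" "zero V' = zero V" "smult V' = smult V"
  shows "is_space (V' :: ('k, 'v, 'n) module_scheme)"
  by (rule vectorspaceI; simp only: assms(2-5)) (use vectorspaceD[OF assms(1)] in simp_all)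

section \<open>Linear maps\<close>

lemma linear_map_iff:
  fixes V :: "('k::field, 'v, 'm) module_scheme" and W :: "('k, 'w, 'n) module_scheme"
  shows "is_linear V W f \<longleftrightarrow>
    is_space V \<and> is_space W \<and>
    (\<forall>x\<in>carrier V. f x \<in> carrier W) \<and>
    (\<forall>x\<in>carrier V. \<forall>y\<in>carrier V. f (x \<oplus>\<^bsub>V\<^esub> y) = f x \<oplus>\<^bsub>W\<^esub> f y) \<and>
    (\<forall>c. \<forall>x\<in>carrier V. f (c \<odot>\<^bsub>V\<^esub> x) = c \<odot>\<^bsub>W\<^esub> f x)"
  unfolding linear_map_def mod_hom_def mod_hom_axioms_def LinearCombinations.module_hom_def vectorspace_def
  by auto

lemma linear_mapI:
  fixes V :: "('k::field, 'v, 'm) module_scheme" and W :: "('k, 'w, 'n) module_scheme"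
  assumes "is_space V" "is_space W"
    and "\<And>x. x \<in> carrier V \<Longrightarrow> f x \<in> carrier W"
    and "\<And>x y. x \<in> carrier V \<Longrightarrow> y \<in> carrier V \<Longrightarrow> f (x \<oplus>\<^bsub>V\<^esub> y) = f x \<oplus>\<^bsub>W\<^esub> f y"
    and "\<And>c x. x \<in> carrier V \<Longrightarrow> f (c \<odot>\<^bsub>V\<^esub> x) = c \<odot>\<^bsub>W\<^esub> f x"
  shows "is_linear V W f"
  using assms by (auto simp: linear_map_iff)

lemma linear_mapD:
  fixes V :: "('k::field, 'v, 'm) module_scheme" and W :: "('k, 'w, 'n) module_scheme"
  assumes f: "is_linear V W f"
  shows "is_space V" "is_space W"
    and "x \<in> carrier V \<Longrightarrow> f x \<in> carrier W"
    and "x \<in> carrier V \<Longrightarrow> y \<in> carrier V \<Longrightarrow> f (x \<oplus>\<^bsub>V\<^esub> y) = f x \<oplus>\<^bsub>W\<^esub> f y"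
    and "x \<in> carrier V \<Longrightarrow> f (c \<odot>\<^bsub>V\<^esub> x) = c \<odot>\<^bsub>W\<^esub> f x"
    and "x \<in> carrier V \<Longrightarrow> y \<in> carrier V \<Longrightarrow> f (x \<ominus>\<^bsub>V\<^esub> y) = f x \<ominus>\<^bsub>W\<^esub> f y"
    and "f \<zero>\<^bsub>V\<^esub> = \<zero>\<^bsub>W\<^esub>"
proof -
  show V: "is_space V" and W: "is_space W"
    using f by (auto simp: linear_map_iff)
  show *: "f x \<in> carrier W" "f (c \<odot>\<^bsub>V\<^esub> x) = c \<odot>\<^bsub>W\<^esub> f x" if "x \<in> carrier V" for x c
    using f that by (auto simp: linear_map_iff)
  show **: "f (x \<oplus>\<^bsub>V\<^esub> y) = f x \<oplus>\<^bsub>W\<^esub> f y" if "x \<in> carrier V" "y \<in> carrier V" for x y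
    using f that by (auto simp: linear_map_iff)
  show "f (x \<ominus>\<^bsub>V\<^esub> y) = f x \<ominus>\<^bsub>W\<^esub> f y" if "x \<in> carrier V" "y \<in> carrier V" for x y
    using that * ** V W by (simp add: vectorspaceD)
  show "f \<zero>\<^bsub>V\<^esub> = \<zero>\<^bsub>W\<^esub>"
    using *(2)[of "\<zero>\<^bsub>V\<^esub>" 0] *(1) V W by (simp add: vectorspaceD)
qed

lemma linear_map_comp:
  assumes "is_linear U V f" "is_linear V W g"
  shows "is_linear U W (\<lambda>x. g (f x))"
  by (rule linear_mapI) (use assms in \<open>auto simp: linear_mapD\<close>)

lemma linear_map_cong:
  assumes "is_linear V W f" "\<And>x. x \<in> carrier V \<Longrightarrow> g x = f x"
  shows "is_linear V W g"
proof -
  have "\<And>x y. x \<in> carrier V \<Longrightarrow> y \<in> carrier V \<Longrightarrow> x \<oplus>\<^bsub>V\<^esub> y \<in> carrier V"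
    "\<And>c x. x \<in> carrier V \<Longrightarrow> c \<odot>\<^bsub>V\<^esub> x \<in> carrier V"
    using assms(1) by (auto dest: linear_mapD(1) intro: vectorspace_closed)
  then show ?thesis
    by (intro linear_mapI) (use assms in \<open>auto simp: linear_mapD\<close>)
qed

lemma linear_map_id: "is_space V \<Longrightarrow> is_linear V V (\<lambda>x. x)"
  by (rule linear_mapI) auto

section \<open>Subspaces and linear spans\<close>

lemma submoduleI:
  assumes "is_space (V :: ('k::field, 'v, 'm) module_scheme)"
    and "N \<subseteq> carrier V" "\<zero>\<^bsub>V\<^esub> \<in> N"
    and "\<And>x y. x \<in> N \<Longrightarrow> y \<in> N \<Longrightarrow> x \<oplus>\<^bsub>V\<^esub> y \<in> N"
    and "\<And>c x. x \<in> N \<Longrightarrow> c \<odot>\<^bsub>V\<^esub> x \<in> N"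
  shows "is_subspace N V"
  using assms by (auto simp: LinearCombinations.submodule_def vectorspace_def)

lemma submoduleD:
  fixes V :: "('k::field, 'v, 'm) module_scheme"
  assumes "is_subspace N V"
  shows "is_space V" "N \<subseteq> carrier V" "\<zero>\<^bsub>V\<^esub> \<in> N"
    and "x \<in> N \<Longrightarrow> x \<in> carrier V"
    and "x \<in> N \<Longrightarrow> y \<in> N \<Longrightarrow> x \<oplus>\<^bsub>V\<^esub> y \<in> N"
    and "x \<in> N \<Longrightarrow> c \<odot>\<^bsub>V\<^esub> x \<in> N"
    and "x \<in> N \<Longrightarrow> y \<in> N \<Longrightarrow> x \<ominus>\<^bsub>V\<^esub> y \<in> N"
proof -
  show V: "is_space V"
    using assms class_field_field by (auto simp: LinearCombinations.submodule_def vectorspace_def)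
  show "x \<in> N \<Longrightarrow> y \<in> N \<Longrightarrow> x \<ominus>\<^bsub>V\<^esub> y \<in> N"
    using assms V by (auto simp: LinearCombinations.submodule_def vectorspaceD(16) subset_iff)
qed (use assms in \<open>auto simp: LinearCombinations.submodule_def\<close>)

lemma submodule_preimage:
  assumes f: "is_linear V W f" and N: "is_subspace N W"
  shows "is_subspace {x \<in> carrier V. f x \<in> N} V"
  by (rule submoduleI) (use linear_mapD[OF f] submoduleD[OF N] in \<open>auto simp: vectorspaceD\<close>)

lemma submodule_image:
  assumes f: "is_linear V W f" and N: "is_subspace N V"
  shows "is_subspace (f ` N) W"
proof (rule submoduleI)
  note f = linear_mapD[OF f] and N = submoduleD[OF N]
  show "is_space W" "f ` N \<subseteq> carrier W" "\<zero>\<^bsub>W\<^esub> \<in> f ` N"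
    using f N by (auto intro: image_eqI[of _ _ "\<zero>\<^bsub>V\<^esub>"])
  show "x \<oplus>\<^bsub>W\<^esub> y \<in> f ` N" if "x \<in> f ` N" "y \<in> f ` N" for x y
    using that f N by (auto simp: f(4)[symmetric])
  show "c \<odot>\<^bsub>W\<^esub> x \<in> f ` N" if "x \<in> f ` N" for c x
    using that f N by (auto simp: f(5)[symmetric])
qed

lemma submodule_zero:
  "is_space V \<Longrightarrow> is_subspace {\<zero>\<^bsub>V\<^esub>} V"
  by (rule submoduleI) (auto simp: vectorspaceD)

lemma submodule_carrier:
  "is_space V \<Longrightarrow> is_subspace (carrier V) V"
  by (rule submoduleI) (auto simp: vectorspaceD)

lemma submodule_Inter:
  assumes "\<S> \<noteq> {}" "\<And>N. N \<in> \<S> \<Longrightarrow> is_subspace N V"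
  shows "is_subspace (\<Inter>\<S>) V"
  using assms
  by (intro submoduleI) (auto dest: submoduleD)

lemma submodule_lin_span:
  assumes "is_space V" "S \<subseteq> carrier V"
  shows "is_subspace (lin_span V S) V"
  using assms unfolding lin_span_def
  by (metis LinearCombinations.module.span_is_submodule vectorspace_def)

lemma lin_span_superset:
  assumes "is_space V" "S \<subseteq> carrier V"
  shows "S \<subseteq> lin_span V S"
  using assms unfolding lin_span_def
  by (metis LinearCombinations.module.in_own_span vectorspace_def)

lemma lin_span_least:
  assumes "is_subspace N V" "S \<subseteq> N"
  shows "lin_span V S \<subseteq> N"
  using assms unfolding lin_span_def
  by (meson LinearCombinations.module.span_is_subset submoduleD(1) vectorspace_def)

text \<open>It suffices to test a linear map on generators, because the preimage of \<open>N\<close>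
  is a subspace.\<close>

lemma lin_span_image:
  assumes "is_linear V W f" "is_subspace N W"
    and "S \<subseteq> carrier V" "f ` S \<subseteq> N" "x \<in> lin_span V S"
  shows "f x \<in> N"
proof -
  have "lin_span V S \<subseteq> {x \<in> carrier V. f x \<in> N}"
    by (rule lin_span_least[OF submodule_preimage[OF assms(1,2)]]) (use assms in auto)
  then show ?thesis using assms by auto
qed

section \<open>Quotient spaces\<close>

context
  fixes V :: "('k::field, 'v, 'm) module_scheme" and N
  assumes N: "is_subspace N V"
begin

interpretation V: vectorspace class_ring V
  by (rule submoduleD(1)[OF N])

interpretation N: abelian_subgroup N V
proof (rule abelian_subgroupI3)
  have "\<ominus>\<^bsub>V\<^esub> x \<in> N" if "x \<in> N" for x
    using submoduleD(7)[OF N submoduleD(3)[OF N] that] submoduleD(4)[OF N that]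
    by (simp add: a_minus_def)
  then have "subgroup N (add_monoid V)"
    using submoduleD(2,3,5)[OF N] by (intro subgroup.intro) (auto simp flip: a_inv_def)
  then show "additive_subgroup N V" by (rule additive_subgroupI)
  show "abelian_group V" ..
qed

lemma carrier_quotient_space: "carrier (quotient_space V N) = (\<lambda>a. N +>\<^bsub>V\<^esub> a) ` carrier V"
  by (auto simp: quotient_space_def A_RCOSETS_def')

lemma coset_eq_iff:
  assumes "a \<in> carrier V" "b \<in> carrier V"
  shows "N +>\<^bsub>V\<^esub> a = N +>\<^bsub>V\<^esub> b \<longleftrightarrow> a \<ominus>\<^bsub>V\<^esub> b \<in> N"
proof -
  have "N +>\<^bsub>V\<^esub> a = N +>\<^bsub>V\<^esub> b \<longleftrightarrow> a \<in> N +>\<^bsub>V\<^esub> b"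
    using assms N.a_rcos_self V.a_repr_independence[OF _ _ N.a_subgroup] by metis
  also have "\<dots> \<longleftrightarrow> a \<ominus>\<^bsub>V\<^esub> b \<in> N"
    using assms N.a_rcos_module[of b a] by (simp add: a_minus_def)
  finally show ?thesis .
qed

lemma coset_memD: "b \<in> N +>\<^bsub>V\<^esub> a \<Longrightarrow> a \<in> carrier V \<Longrightarrow> b \<in> carrier V \<and> N +>\<^bsub>V\<^esub> b = N +>\<^bsub>V\<^esub> a"
proof -
  assume "b \<in> N +>\<^bsub>V\<^esub> a" "a \<in> carrier V"
  then show ?thesis
    using V.a_repr_independence[OF _ _ N.a_subgroup, of b a]
      subsetD[OF V.a_r_coset_subset_G[OF N.a_subset, of a], of b] by metis
qed

lemma coset_self: "a \<in> carrier V \<Longrightarrow> a \<in> N +>\<^bsub>V\<^esub> a"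
  by (rule N.a_rcos_self)

lemma coset_eq_self_iff: "a \<in> carrier V \<Longrightarrow> N +>\<^bsub>V\<^esub> a = N \<longleftrightarrow> a \<in> N"
  by (metis N.a_rcos_const N.a_rcos_self)

lemma zero_quotient_space: "\<zero>\<^bsub>quotient_space V N\<^esub> = N +>\<^bsub>V\<^esub> \<zero>\<^bsub>V\<^esub>"
  using coset_eq_self_iff[of "\<zero>\<^bsub>V\<^esub>"] by (simp add: quotient_space_def)

lemma add_quotient_space:
  "a \<in> carrier V \<Longrightarrow> b \<in> carrier V \<Longrightarrow>
    (N +>\<^bsub>V\<^esub> a) \<oplus>\<^bsub>quotient_space V N\<^esub> (N +>\<^bsub>V\<^esub> b) = N +>\<^bsub>V\<^esub> (a \<oplus>\<^bsub>V\<^esub> b)"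
  by (simp add: quotient_space_def N.a_rcos_sum)

end

text \<open>Each member of the union is the same coset, and the index set contains \<open>a\<close>,
  so the union is not empty.\<close>

lemma coset_map_coset:
  assumes N: "is_subspace N V" and N': "is_subspace N' V'"
    and f: "is_linear V V' f" and "\<And>x. x \<in> N \<Longrightarrow> f x \<in> N'" and a: "a \<in> carrier V"
  shows "coset_map V' N' f (N +>\<^bsub>V\<^esub> a) = N' +>\<^bsub>V'\<^esub> f a"
proof -
  have "N' +>\<^bsub>V'\<^esub> f b = N' +>\<^bsub>V'\<^esub> f a" if "b \<in> N +>\<^bsub>V\<^esub> a" for b
  proof -
    have b: "b \<in> carrier V" "N +>\<^bsub>V\<^esub> b = N +>\<^bsub>V\<^esub> a" using coset_memD[OF N that a] by auto
    then have "b \<ominus>\<^bsub>V\<^esub> a \<in> N" using coset_eq_iff[OF N b(1) a] by simp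
    then have "f b \<ominus>\<^bsub>V'\<^esub> f a \<in> N'" using assms(4) linear_mapD(6)[OF f b(1) a] by metis
    then show ?thesis using coset_eq_iff[OF N'] linear_mapD(3)[OF f] a b by metis
  qed
  then have "coset_map V' N' f (N +>\<^bsub>V\<^esub> a) = (\<Union>b\<in>N +>\<^bsub>V\<^esub> a. N' +>\<^bsub>V'\<^esub> f a)"
    unfolding coset_map_def by (intro SUP_cong) simp_all
  also have "\<dots> = N' +>\<^bsub>V'\<^esub> f a" using coset_self[OF N a] by (intro SUP_eq_const) auto
  finally show ?thesis .
qed

lemma linear_map_smult:
  "is_space (V :: ('k::field, 'v, 'm) module_scheme) \<Longrightarrow> is_linear V V (smult V c)"
proof (rule linear_mapI)
  fix d x
  assume V: "is_space V" and x: "x \<in> carrier V"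
  show "c \<odot>\<^bsub>V\<^esub> (d \<odot>\<^bsub>V\<^esub> x) = d \<odot>\<^bsub>V\<^esub> (c \<odot>\<^bsub>V\<^esub> x)"
    using vectorspaceD(10)[OF V x, of c d] vectorspaceD(10)[OF V x, of d c] by (simp add: mult.commute)
qed (simp_all add: vectorspaceD(4,15))

text \<open>Scalar multiplication on the quotient is itself a \<open>coset_map\<close>, so linearity
  of multiplication by \<open>c\<close> makes this an instance of
  \<open>coset_map_coset\<close>.\<close>

lemma smult_quotient_space:
  assumes "is_subspace N V" "a \<in> carrier V"
  shows "c \<odot>\<^bsub>quotient_space V N\<^esub> (N +>\<^bsub>V\<^esub> a) = N +>\<^bsub>V\<^esub> (c \<odot>\<^bsub>V\<^esub> a)"
  using coset_map_coset[OF assms(1,1) linear_map_smult[OF submoduleD(1)[OF assms(1)]], of c a] assms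
  by (simp add: quotient_space_def submoduleD)

lemma vectorspace_quotient_space:
  assumes N: "is_subspace N V"
  shows "is_space (quotient_space V N)"
proof -
  note V = submoduleD(1)[OF N]
  have "carrier (quotient_space V N) = (\<lambda>a. N +>\<^bsub>V\<^esub> a) ` carrier V"
    by (rule carrier_quotient_space[OF N])
  moreover have "N +>\<^bsub>V\<^esub> (a \<oplus>\<^bsub>V\<^esub> b) = N +>\<^bsub>V\<^esub> (b \<oplus>\<^bsub>V\<^esub> a)"
    if "a \<in> carrier V" "b \<in> carrier V" for a b
    using vectorspaceD(6)[OF V that] by simp
  ultimately show ?thesis
    by (intro vectorspaceI) (auto simp: add_quotient_space[OF N]
      smult_quotient_space[OF N] zero_quotient_space[OF N] vectorspace_simps[OF V])
qed

lemma linear_map_coset: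
  assumes N: "is_subspace N V"
  shows "is_linear V (quotient_space V N) (\<lambda>a. N +>\<^bsub>V\<^esub> a)"
  by (rule linear_mapI) (simp_all add: carrier_quotient_space[OF N] add_quotient_space[OF N]
      smult_quotient_space[OF N] vectorspace_quotient_space[OF N] submoduleD(1)[OF N])

lemma linear_map_coset_map:
  assumes N: "is_subspace N V" and N': "is_subspace N' V'"
    and f: "is_linear V V' f" and "\<And>x. x \<in> N \<Longrightarrow> f x \<in> N'"
  shows "is_linear (quotient_space V N) (quotient_space V' N') (coset_map V' N' f)"
proof -
  note [simp] = coset_map_coset[OF N N' f assms(4)] carrier_quotient_space[OF N] carrier_quotient_space[OF N']
    add_quotient_space[OF N] add_quotient_space[OF N'] smult_quotient_space[OF N] smult_quotient_space[OF N']
    linear_mapD[OF f] vectorspace_simps[OF linear_mapD(1)[OF f]]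
  show ?thesis
    by (rule linear_mapI) (auto simp: vectorspace_quotient_space[OF N] vectorspace_quotient_space[OF N'])
qed

definition quotient_lift :: "('v \<Rightarrow> 'u) \<Rightarrow> 'v set \<Rightarrow> 'u" where
  "quotient_lift f A = f (SOME a. a \<in> A)"

lemma quotient_lift_coset:
  assumes N: "is_subspace N V" and f: "is_linear V U f"
    and 0: "\<And>x. x \<in> N \<Longrightarrow> f x = \<zero>\<^bsub>U\<^esub>" and a: "a \<in> carrier V"
  shows "quotient_lift f (N +>\<^bsub>V\<^esub> a) = f a"
proof -
  let ?b = "SOME b. b \<in> N +>\<^bsub>V\<^esub> a"
  have "?b \<in> N +>\<^bsub>V\<^esub> a" by (rule someI, rule coset_self[OF N a])
  then have b: "?b \<in> carrier V" "N +>\<^bsub>V\<^esub> ?b = N +>\<^bsub>V\<^esub> a" using coset_memD[OF N _ a] by auto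
  then have "f (?b \<ominus>\<^bsub>V\<^esub> a) = \<zero>\<^bsub>U\<^esub>" using 0 coset_eq_iff[OF N b(1) a] by simp
  then show ?thesis
    using linear_mapD[OF f] b a vectorspaceD(17)[OF linear_mapD(2)[OF f]] by (simp add: quotient_lift_def)
qed

lemma linear_map_quotient_lift:
  assumes N: "is_subspace N V" and f: "is_linear V U f"
    and 0: "\<And>x. x \<in> N \<Longrightarrow> f x = \<zero>\<^bsub>U\<^esub>"
  shows "is_linear (quotient_space V N) U (quotient_lift f)"
proof -
  note [simp] = quotient_lift_coset[OF N f 0] carrier_quotient_space[OF N]
    add_quotient_space[OF N] smult_quotient_space[OF N]
    linear_mapD[OF f] vectorspace_simps[OF linear_mapD(1)[OF f]]
  show ?thesis
    by (rule linear_mapI) (auto simp: vectorspace_quotient_space[OF N])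
qed

section \<open>Free vector spaces\<close>

abbreviation scale :: "'k::field \<Rightarrow> ('x \<Rightarrow>\<^sub>0 'k) \<Rightarrow> ('x \<Rightarrow>\<^sub>0 'k)" where
  "scale c \<equiv> Poly_Mapping.map ((*) c)"

lemma lookup_scale [simp]: "lookup (scale c p) x = c * lookup p x"
  by (cases "lookup p x = 0") (simp_all add: Poly_Mapping.map.rep_eq)

lemma scale_single [simp]: "scale c (single x a) = single x (c * a)"
  by (rule poly_mapping_eqI) (simp add: lookup_single when_def)

lemma scale_add: "scale c (p + q) = scale c p + scale c q"
  by (rule poly_mapping_eqI) (simp add: lookup_add distrib_left)

lemma scale_zero [simp]: "scale c 0 = 0"
  by (rule poly_mapping_eqI) simp

lemma scale_minus_one [simp]: "scale (- 1) p = - p"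
  by (rule poly_mapping_eqI) simp

lemma keys_scale: "keys (scale c p) \<subseteq> keys p"
  by (auto simp: in_keys_iff)

lemma free_space_simps [simp]:
  "p \<in> carrier (free_space X) \<longleftrightarrow> keys p \<subseteq> X"
  "\<zero>\<^bsub>free_space X\<^esub> = 0" "p \<oplus>\<^bsub>free_space X\<^esub> q = p + q" "c \<odot>\<^bsub>free_space X\<^esub> p = scale c p"
  by (simp_all add: free_space_def)

lemma keys_add_subset: "keys p \<subseteq> X \<Longrightarrow> keys q \<subseteq> X \<Longrightarrow> keys (p + q) \<subseteq> X"
  using Poly_Mapping.keys_add[of p q] by blast

lemma keys_minus_subset: "keys p \<subseteq> X \<Longrightarrow> keys q \<subseteq> X \<Longrightarrow> keys (p - q) \<subseteq> X"
  using keys_diff[of p q] by blast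

lemma keys_single_subset: "x \<in> X \<Longrightarrow> keys (single x a) \<subseteq> X"
  by simp

lemmas keys_subsetI = keys_add_subset keys_minus_subset keys_single_subset
  order_trans[OF keys_scale]

lemma vectorspace_free_space: "is_space (free_space X :: ('k::field, 'x \<Rightarrow>\<^sub>0 'k) module)"
proof (rule vectorspaceI)
  fix a b :: 'k and p :: "'x \<Rightarrow>\<^sub>0 'k"
  show "(a * b) \<odot>\<^bsub>free_space X\<^esub> p = a \<odot>\<^bsub>free_space X\<^esub> (b \<odot>\<^bsub>free_space X\<^esub> p)"
    "1 \<odot>\<^bsub>free_space X\<^esub> p = p"
    "(a + b) \<odot>\<^bsub>free_space X\<^esub> p = a \<odot>\<^bsub>free_space X\<^esub> p \<oplus>\<^bsub>free_space X\<^esub> b \<odot>\<^bsub>free_space X\<^esub> p"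
    unfolding free_space_simps by (rule poly_mapping_eqI; simp add: lookup_add distrib_right)+
qed (simp_all add: keys_subsetI ac_simps scale_add)

lemma minus_free_space [simp]:
  fixes p q :: "'x \<Rightarrow>\<^sub>0 'k::field"
  assumes "keys p \<subseteq> X" "keys q \<subseteq> X"
  shows "p \<ominus>\<^bsub>free_space X\<^esub> q = p - q"
  using vectorspaceD(16)[OF vectorspace_free_space[of X], of p q] assms by simp

lemma poly_mapping_sum_single:
  fixes p :: "'x \<Rightarrow>\<^sub>0 'k::comm_monoid_add"
  shows "p = (\<Sum>x\<in>keys p. single x (lookup p x))"
  by (rule poly_mapping_eqI) (simp add: lookup_sum lookup_single when_def in_keys_iff)

text \<open>Supports stay in \<open>X\<close> throughout, which lets the \<open>add\<close> case use
  rules that hold only on the carrier of \<open>free_space X\<close>.\<close>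

lemma free_space_induct [consumes 1, case_names zero single add]:
  fixes p :: "'x \<Rightarrow>\<^sub>0 'k::comm_monoid_add"
  assumes "keys p \<subseteq> X" "P 0"
    and "\<And>x c. x \<in> X \<Longrightarrow> P (single x c)"
    and "\<And>p q. keys p \<subseteq> X \<Longrightarrow> keys q \<subseteq> X \<Longrightarrow> P p \<Longrightarrow> P q \<Longrightarrow> P (p + q)"
  shows "P p"
proof -
  \<comment> \<open>The support bound is proved together with \<open>P\<close> because the
    hypothesis on sums asks for it.\<close>
  have "keys (\<Sum>x\<in>A. single x (lookup p x)) \<subseteq> X
      \<and> P (\<Sum>x\<in>A. single x (lookup p x))"
    if "finite A" "A \<subseteq> X" for A
    using that
  proof (induction A)
    case (insert x A)
    then show ?case using assms(3)[of x] by (simp add: keys_subsetI assms(4))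
  qed (use assms in simp)
  from this[OF _ assms(1)] show ?thesis using poly_mapping_sum_single[of p] by simp
qed

lemma linear_map_eq_on_free_space:
  assumes f: "is_linear (free_space X) U f" and g: "is_linear (free_space X) U g"
    and eq: "\<And>x. x \<in> X \<Longrightarrow> f (single x 1) = g (single x 1)"
    and p: "keys p \<subseteq> X"
  shows "f p = g p"
  using p
proof (induction rule: free_space_induct)
  case zero
  then show ?case using linear_mapD(7)[OF f] linear_mapD(7)[OF g] by simp
next
  case (single x c)
  then show ?case
    using linear_mapD(5)[OF f, of "single x 1" c]
      linear_mapD(5)[OF g, of "single x 1" c] eq[of x] by simp
next
  case (add p q)
  then show ?case using linear_mapD(4)[OF f, of p q] linear_mapD(4)[OF g, of p q] by simp
qed

lemma linear_map_from_free_spaceI: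
  assumes "is_space (U :: ('k::field, 'u, 'm) module_scheme)"
    and "\<And>p. keys p \<subseteq> X \<Longrightarrow> f p \<in> carrier U"
    and "\<And>p q. keys p \<subseteq> X \<Longrightarrow> keys q \<subseteq> X \<Longrightarrow> f (p + q) = f p \<oplus>\<^bsub>U\<^esub> f q"
    and "\<And>c p. keys p \<subseteq> X \<Longrightarrow> f (scale c p) = c \<odot>\<^bsub>U\<^esub> f p"
  shows "is_linear (free_space X) U f"
  by (rule linear_mapI) (use assms in \<open>simp_all add: vectorspace_free_space\<close>)

text \<open>Cancellation can make the support of a sum smaller than the union of the supports.
  Summing over any finite superset makes additivity a termwise matter.\<close>

lemma pushforward_superset:
  assumes "finite A" "keys p \<subseteq> A"
  shows "pushforward g p = (\<Sum>x\<in>A. single (g x) (lookup p x))"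
  unfolding pushforward_def using assms by (intro sum.mono_neutral_left) (auto simp: in_keys_iff)

lemma pushforward_zero [simp]: "pushforward g 0 = 0"
  by (simp add: pushforward_def)

lemma pushforward_single [simp]: "pushforward g (single x c) = single (g x) c"
  by (simp add: pushforward_def)

lemma pushforward_add: "pushforward g (p + q) = pushforward g p + pushforward g q"
  using Poly_Mapping.keys_add[of p q]
  by (simp add: pushforward_superset[of "keys p \<union> keys q"] lookup_add single_add
      sum.distrib)

lemma pushforward_scale: "pushforward g (scale c p) = scale c (pushforward g p)"
proof -
  have "(\<Sum>x\<in>A. single (g x) (c * lookup p x))
      = scale c (\<Sum>x\<in>A. single (g x) (lookup p x))" for A
    by (induction A rule: infinite_finite_induct) (simp_all add: scale_add)
  then show ?thesis
    using pushforward_superset[OF _ keys_scale[of c p], of g] by (simp add: pushforward_def)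
qed

lemma pushforward_uminus: "pushforward g (- p) = - pushforward g p"
  using pushforward_scale[of g "- 1" p] by simp

lemma pushforward_diff: "pushforward g (p - q) = pushforward g p - pushforward g q"
  using pushforward_add[of g p "- q"] by (simp add: pushforward_uminus)

lemmas pushforward_simps = pushforward_add pushforward_diff pushforward_uminus

lemma keys_pushforward: "keys (pushforward g p) \<subseteq> g ` keys p"
proof -
  have "keys (pushforward g p)
      \<subseteq> (\<Union>x\<in>keys p. keys (single (g x) (lookup p x)))"
    unfolding pushforward_def by (rule Poly_Mapping.keys_sum)
  then show ?thesis by (auto split: if_splits)
qed

lemma keys_pushforward_subset:
  "keys p \<subseteq> X \<Longrightarrow> (\<And>x. x \<in> X \<Longrightarrow> g x \<in> Y) \<Longrightarrow> keys (pushforward g p) \<subseteq> Y"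
  using keys_pushforward[of g p] by blast

lemma pushforward_pushforward: "pushforward g (pushforward h p) = pushforward (\<lambda>x. g (h x)) p"
  using subset_UNIV[of "keys p"]
  by (induction rule: free_space_induct) (simp_all add: pushforward_add)

lemma pushforward_cong:
  "(\<And>x. x \<in> keys p \<Longrightarrow> g x = h x) \<Longrightarrow> pushforward g p = pushforward h p"
  by (simp add: pushforward_def)

lemma pushforward_ident [simp]: "pushforward (\<lambda>x. x) p = p"
  using poly_mapping_sum_single[of p] by (simp add: pushforward_def)

lemma linear_map_pushforward:
  "(\<And>x. x \<in> X \<Longrightarrow> g x \<in> Y) \<Longrightarrow>
    is_linear (free_space X :: ('k::field, _) module) (free_space Y) (pushforward g)"
  by (rule linear_map_from_free_spaceI)
    (simp_all add: vectorspace_free_space pushforward_add pushforward_scale keys_pushforward_subset)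

section \<open>Universal property of free vector spaces\<close>

definition linear_extension ::
  "('k::field, 'u, 'm) module_scheme \<Rightarrow> ('x \<Rightarrow> 'u) \<Rightarrow> ('x \<Rightarrow>\<^sub>0 'k) \<Rightarrow> 'u" where
  "linear_extension U F p = (\<Oplus>\<^bsub>U\<^esub>x\<in>keys p. lookup p x \<odot>\<^bsub>U\<^esub> F x)"

context
  fixes U :: "('k::field, 'u, 'm) module_scheme" and X :: "'x set" and F
  assumes U: "is_space U" and F: "\<And>x. x \<in> X \<Longrightarrow> F x \<in> carrier U"
begin

interpretation U: vectorspace class_ring U by fact

lemma linear_extension_superset:
  assumes "finite A" "keys p \<subseteq> A" "A \<subseteq> X"
  shows "linear_extension U F p = (\<Oplus>\<^bsub>U\<^esub>x\<in>A. lookup p x \<odot>\<^bsub>U\<^esub> F x)"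
  unfolding linear_extension_def
  by (rule U.M.add.finprod_mono_neutral_cong_left)
    (use assms F U in \<open>auto simp: in_keys_iff vectorspace_simps subset_iff\<close>)

lemma linear_extension_single: "x \<in> X \<Longrightarrow> linear_extension U F (single x c) = c \<odot>\<^bsub>U\<^esub> F x"
  using linear_extension_superset[of "{x}" "single x c"] F[of x] U
  by (simp add: vectorspace_simps)

lemma linear_map_linear_extension: "is_linear (free_space X) U (linear_extension U F)"
proof (rule linear_map_from_free_spaceI)
  have Pi: "(\<lambda>x. lookup p x \<odot>\<^bsub>U\<^esub> F x) \<in> A \<rightarrow> carrier U" if "A \<subseteq> X" for p A
    using that F U by (auto simp: vectorspace_simps)
  show "linear_extension U F p \<in> carrier U" if "keys p \<subseteq> X" for p
    unfolding linear_extension_def by (rule U.M.finsum_closed) (rule Pi[OF that])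
  show "linear_extension U F (p + q) = linear_extension U F p \<oplus>\<^bsub>U\<^esub> linear_extension U F q"
    if "keys p \<subseteq> X" "keys q \<subseteq> X" for p q
  proof -
    let ?A = "keys p \<union> keys q"
    have "(\<Oplus>\<^bsub>U\<^esub>x\<in>?A. lookup (p + q) x \<odot>\<^bsub>U\<^esub> F x)
      = (\<Oplus>\<^bsub>U\<^esub>x\<in>?A. lookup p x \<odot>\<^bsub>U\<^esub> F x \<oplus>\<^bsub>U\<^esub> lookup q x \<odot>\<^bsub>U\<^esub> F x)"
      by (rule U.M.finsum_cong') (use that F U in \<open>auto simp: lookup_add vectorspace_simps\<close>)
    also have "\<dots> = (\<Oplus>\<^bsub>U\<^esub>x\<in>?A. lookup p x \<odot>\<^bsub>U\<^esub> F x)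
        \<oplus>\<^bsub>U\<^esub> (\<Oplus>\<^bsub>U\<^esub>x\<in>?A. lookup q x \<odot>\<^bsub>U\<^esub> F x)"
      by (rule U.M.finsum_addf) (use that in \<open>auto intro!: Pi\<close>)
    finally show ?thesis
      using that Poly_Mapping.keys_add[of p q] by (simp add: linear_extension_superset[of ?A])
  qed
  show "linear_extension U F (scale c p) = c \<odot>\<^bsub>U\<^esub> linear_extension U F p"
    if p: "keys p \<subseteq> X" for c p
  proof -
    have "linear_extension U F (scale c p)
        = (\<Oplus>\<^bsub>U\<^esub>x\<in>keys p. c \<odot>\<^bsub>U\<^esub> (lookup p x \<odot>\<^bsub>U\<^esub> F x))"
      using p keys_scale[of c p] F U
      by (subst linear_extension_superset[of "keys p"])
        (auto intro!: U.M.finsum_cong' simp: vectorspace_simps)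
    also have "\<dots> = c \<odot>\<^bsub>U\<^esub> linear_extension U F p"
      unfolding linear_extension_def
      using Pi[OF p] by (subst U.finsum_smult) auto
    finally show ?thesis .
  qed
qed (rule U)

end

section \<open>Tensor products\<close>

definition bilinear_map ::
  "('k::field, 'v, 'm) module_scheme \<Rightarrow> ('k, 'w, 'n) module_scheme \<Rightarrow> ('k, 'u, 'l) module_scheme
    \<Rightarrow> ('v \<Rightarrow> 'w \<Rightarrow> 'u) \<Rightarrow> bool" where
  "bilinear_map V W U \<beta> \<longleftrightarrow>
    (\<forall>w\<in>carrier W. is_linear V U (\<lambda>v. \<beta> v w)) \<and> (\<forall>v\<in>carrier V. is_linear W U (\<beta> v))"

definition tensor_lift ::
  "('k::field, 'u, 'l) module_scheme \<Rightarrow> ('v \<Rightarrow> 'w \<Rightarrow> 'u) \<Rightarrow> (('v \<times> 'w) \<Rightarrow>\<^sub>0 'k) set \<Rightarrow> 'u" where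
  "tensor_lift U \<beta> = quotient_lift (linear_extension U (\<lambda>(v, w). \<beta> v w))"

context
  fixes V :: "('k::field, 'v, 'm) module_scheme" and W :: "('k, 'w, 'n) module_scheme"
  assumes V: "is_space V" and W: "is_space W"
begin

text \<open>Used with the zero subspace to lift bilinear maps, and with the relations themselves to
  let the swaps act on a tensor product.\<close>

lemma tensor_relations_induct:
  assumes "is_subspace N U" "is_linear (free_space (carrier V \<times> carrier W)) U f"
    and "p \<in> tensor_relations V W"
    and "\<And>x y w. x \<in> carrier V \<Longrightarrow> y \<in> carrier V \<Longrightarrow> w \<in> carrier W \<Longrightarrow>
      f (single (x \<oplus>\<^bsub>V\<^esub> y, w) 1 - single (x, w) 1 - single (y, w) 1) \<in> N"
    and "\<And>v x y. v \<in> carrier V \<Longrightarrow> x \<in> carrier W \<Longrightarrow> y \<in> carrier W \<Longrightarrow>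
      f (single (v, x \<oplus>\<^bsub>W\<^esub> y) 1 - single (v, x) 1 - single (v, y) 1) \<in> N"
    and "\<And>c v w. v \<in> carrier V \<Longrightarrow> w \<in> carrier W \<Longrightarrow>
      f (single (c \<odot>\<^bsub>V\<^esub> v, w) 1 - single (v, w) c) \<in> N"
    and "\<And>c v w. v \<in> carrier V \<Longrightarrow> w \<in> carrier W \<Longrightarrow>
      f (single (v, c \<odot>\<^bsub>W\<^esub> w) 1 - single (v, w) c) \<in> N"
  shows "f p \<in> N"
  using assms(3) unfolding tensor_relations_def
proof (rule lin_span_image[OF assms(2,1), rotated 2], goal_cases)
  case 1
  show ?case by (safe; simp add: keys_subsetI vectorspace_closed[OF V] vectorspace_closed[OF W])
next
  case 2
  show ?case by (safe; simp add: assms(4-7))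
qed

lemma tensor_relations_generators:
  shows submodule_tensor_relations:
      "is_subspace (tensor_relations V W) (free_space (carrier V \<times> carrier W))"
    and "x \<in> carrier V \<Longrightarrow> y \<in> carrier V \<Longrightarrow> w \<in> carrier W \<Longrightarrow>
      single (x \<oplus>\<^bsub>V\<^esub> y, w) 1 - single (x, w) 1 - single (y, w) 1
        \<in> tensor_relations V W"
    and "v \<in> carrier V \<Longrightarrow> x' \<in> carrier W \<Longrightarrow> y' \<in> carrier W \<Longrightarrow>
      single (v, x' \<oplus>\<^bsub>W\<^esub> y') 1 - single (v, x') 1 - single (v, y') 1
        \<in> tensor_relations V W"
    and "v \<in> carrier V \<Longrightarrow> w \<in> carrier W \<Longrightarrow>
      single (c \<odot>\<^bsub>V\<^esub> v, w) 1 - single (v, w) c \<in> tensor_relations V W"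
    and "v \<in> carrier V \<Longrightarrow> w \<in> carrier W \<Longrightarrow>
      single (v, c \<odot>\<^bsub>W\<^esub> w) 1 - single (v, w) c \<in> tensor_relations V W"
proof -
  let ?S = "{single (x \<oplus>\<^bsub>V\<^esub> y, w) 1 - single (x, w) 1 - single (y, w) (1 :: 'k)
        | x y w. x \<in> carrier V \<and> y \<in> carrier V \<and> w \<in> carrier W}
     \<union> {single (v, x \<oplus>\<^bsub>W\<^esub> y) 1 - single (v, x) 1 - single (v, y) 1
        | v x y. v \<in> carrier V \<and> x \<in> carrier W \<and> y \<in> carrier W}
     \<union> {single (c \<odot>\<^bsub>V\<^esub> v, w) 1 - single (v, w) c
        | c v w. v \<in> carrier V \<and> w \<in> carrier W}
     \<union> {single (v, c \<odot>\<^bsub>W\<^esub> w) 1 - single (v, w) c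
        | c v w. v \<in> carrier V \<and> w \<in> carrier W}"
  have S: "?S \<subseteq> carrier (free_space (carrier V \<times> carrier W))"
    by (safe; simp add: keys_subsetI vectorspace_closed[OF V] vectorspace_closed[OF W])
  show "is_subspace (tensor_relations V W) (free_space (carrier V \<times> carrier W))"
    unfolding tensor_relations_def by (rule submodule_lin_span[OF vectorspace_free_space S])
  have *: "?S \<subseteq> tensor_relations V W"
    unfolding tensor_relations_def by (rule lin_span_superset[OF vectorspace_free_space S])
  show "x \<in> carrier V \<Longrightarrow> y \<in> carrier V \<Longrightarrow> w \<in> carrier W \<Longrightarrow>
      single (x \<oplus>\<^bsub>V\<^esub> y, w) 1 - single (x, w) 1 - single (y, w) 1
        \<in> tensor_relations V W" for x y w
    by (rule subsetD[OF *]) blast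
  show "v \<in> carrier V \<Longrightarrow> x \<in> carrier W \<Longrightarrow> y \<in> carrier W \<Longrightarrow>
      single (v, x \<oplus>\<^bsub>W\<^esub> y) 1 - single (v, x) 1 - single (v, y) 1
        \<in> tensor_relations V W" for v x y
    by (rule subsetD[OF *]) blast
  show "v \<in> carrier V \<Longrightarrow> w \<in> carrier W \<Longrightarrow>
      single (c \<odot>\<^bsub>V\<^esub> v, w) 1 - single (v, w) c \<in> tensor_relations V W" for v w c
    by (rule subsetD[OF *]) blast
  show "v \<in> carrier V \<Longrightarrow> w \<in> carrier W \<Longrightarrow>
      single (v, c \<odot>\<^bsub>W\<^esub> w) 1 - single (v, w) c \<in> tensor_relations V W" for v w c
    by (rule subsetD[OF *]) blast
qed

lemma vectorspace_tensor_space: "is_space (tensor_space V W)"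
  unfolding tensor_space_def by (rule vectorspace_quotient_space[OF submodule_tensor_relations])

text \<open>Every element of the tensor space is the class of a combination of pairs, so agreement
  can be tested on the basis of the free space above it.\<close>

lemma linear_map_eq_on_tensor:
  assumes f: "is_linear (tensor_space V W) U f" and g: "is_linear (tensor_space V W) U g"
    and eq: "\<And>v w. v \<in> carrier V \<Longrightarrow> w \<in> carrier W \<Longrightarrow> f (pure_tensor V W v w) = g (pure_tensor V W v w)"
    and t: "t \<in> carrier (tensor_space V W)"
  shows "f t = g t"
proof -
  let ?F = "free_space (carrier V \<times> carrier W) :: ('k, _) module" and ?N = "tensor_relations V W"
  note N = submodule_tensor_relations
  have c: "is_linear ?F (tensor_space V W) (\<lambda>a. ?N +>\<^bsub>?F\<^esub> a)"
    unfolding tensor_space_def by (rule linear_map_coset[OF N])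
  from t obtain p where p: "keys p \<subseteq> carrier V \<times> carrier W" "t = ?N +>\<^bsub>?F\<^esub> p"
    unfolding tensor_space_def carrier_quotient_space[OF N] by auto
  show ?thesis unfolding p(2)
    by (rule linear_map_eq_on_free_space[OF linear_map_comp[OF c f] linear_map_comp[OF c g] _ p(1)])
      (auto simp: eq simp flip: pure_tensor_def)
qed

lemma bilinear_map_pure_tensor: "bilinear_map V W (tensor_space V W) (pure_tensor V W)"
proof -
  let ?F = "free_space (carrier V \<times> carrier W) :: ('k, _) module" and ?N = "tensor_relations V W"
  note N = submodule_tensor_relations
  have c: "is_linear ?F (tensor_space V W) (\<lambda>a. ?N +>\<^bsub>?F\<^esub> a)"
    unfolding tensor_space_def by (rule linear_map_coset[OF N])
  have add: "?N +>\<^bsub>?F\<^esub> single a 1 =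
      (?N +>\<^bsub>?F\<^esub> single b 1) \<oplus>\<^bsub>tensor_space V W\<^esub> (?N +>\<^bsub>?F\<^esub> single b' 1)"
    if "single a 1 - single b 1 - single b' 1 \<in> ?N"
      "a \<in> carrier V \<times> carrier W" "b \<in> carrier V \<times> carrier W" "b' \<in> carrier V \<times> carrier W" for a b b'
  proof -
    have "?N +>\<^bsub>?F\<^esub> single a 1 = ?N +>\<^bsub>?F\<^esub> (single b 1 + single b' 1)"
      using that by (subst coset_eq_iff[OF N]) (simp_all add: keys_subsetI diff_diff_eq)
    then show ?thesis
      using linear_mapD(4)[OF c, of "single b 1" "single b' 1"] that by simp
  qed
  have scl: "?N +>\<^bsub>?F\<^esub> single a 1 = k \<odot>\<^bsub>tensor_space V W\<^esub> (?N +>\<^bsub>?F\<^esub> single b 1)"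
    if "single a 1 - single b k \<in> ?N"
      "a \<in> carrier V \<times> carrier W" "b \<in> carrier V \<times> carrier W" for a b k
  proof -
    have "?N +>\<^bsub>?F\<^esub> single a 1 = ?N +>\<^bsub>?F\<^esub> single b k"
      using that by (subst coset_eq_iff[OF N]) (simp_all add: keys_subsetI)
    then show ?thesis
      using linear_mapD(5)[OF c, of "single b 1" k] that by simp
  qed
  have cl: "pure_tensor V W v w \<in> carrier (tensor_space V W)"
    if "v \<in> carrier V" "w \<in> carrier W" for v w
    unfolding pure_tensor_def by (rule linear_mapD(3)[OF c]) (use that in simp)
  note gens = tensor_relations_generators(2-5)
  show ?thesis
    unfolding bilinear_map_def
    by (intro conjI ballI linear_mapI V W vectorspace_tensor_space cl)
      (simp_all add: pure_tensor_def add scl gens V W vectorspace_closed)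
qed

lemmas pure_tensor_linear =
  bspec[OF conjunct1[OF bilinear_map_pure_tensor[unfolded bilinear_map_def]]]
  bspec[OF conjunct2[OF bilinear_map_pure_tensor[unfolded bilinear_map_def]]]

lemma pure_tensor_closed: "v \<in> carrier V \<Longrightarrow> w \<in> carrier W \<Longrightarrow> pure_tensor V W v w \<in> carrier (tensor_space V W)"
  using linear_mapD(3)[OF pure_tensor_linear(2)] .

context
  fixes U :: "('k, 'u, 'l) module_scheme" and \<beta>
  assumes \<beta>: "bilinear_map V W U \<beta>"
begin

lemma tensor_lift_kernel:
  shows linear_map_tensor_lift_free:
      "is_linear (free_space (carrier V \<times> carrier W)) U (linear_extension U (\<lambda>(v, w). \<beta> v w))"
    and "p \<in> tensor_relations V W \<Longrightarrow> linear_extension U (\<lambda>(v, w). \<beta> v w) p = \<zero>\<^bsub>U\<^esub>"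
proof -
  let ?f = "linear_extension U (\<lambda>(v, w). \<beta> v w)"
  have \<beta>1: "is_linear V U (\<lambda>v. \<beta> v w)" if "w \<in> carrier W" for w
    using \<beta> that by (simp add: bilinear_map_def)
  have \<beta>2: "is_linear W U (\<beta> v)" if "v \<in> carrier V" for v
    using \<beta> that by (simp add: bilinear_map_def)
  have U: "is_space U" using \<beta>1[of "\<zero>\<^bsub>W\<^esub>"] W by (simp add: linear_map_iff vectorspace_closed)
  have cl: "\<And>x. x \<in> carrier V \<times> carrier W \<Longrightarrow> (case x of (v, w) \<Rightarrow> \<beta> v w) \<in> carrier U"
    using linear_mapD(3)[OF \<beta>1] by auto
  show f: "is_linear (free_space (carrier V \<times> carrier W)) U ?f"
    by (rule linear_map_linear_extension[OF U cl])
  note fD = linear_mapD[OF f]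
  have single: "?f (single (v, w) c) = c \<odot>\<^bsub>U\<^esub> \<beta> v w" if "v \<in> carrier V" "w \<in> carrier W" for v w c
    using linear_extension_single[OF U cl, where x = "(v, w)"] that by simp
  have diff: "?f (p - q) = ?f p \<ominus>\<^bsub>U\<^esub> ?f q"
    if "keys p \<subseteq> carrier V \<times> carrier W" "keys q \<subseteq> carrier V \<times> carrier W" for p q
    using fD(6)[of p q] that by simp
  \<comment> \<open>One computation serves both additivity families, which differ only in the factor
    that is split.\<close>
  have add3: "?f (single (v, w) 1 - single (x, y) 1 - single (x', y') 1) = \<zero>\<^bsub>U\<^esub>"
    if "v \<in> carrier V" "w \<in> carrier W" "x \<in> carrier V" "y \<in> carrier W" "x' \<in> carrier V" "y' \<in> carrier W"
      "\<beta> v w = \<beta> x y \<oplus>\<^bsub>U\<^esub> \<beta> x' y'" for v w x y x' y'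
  proof -
    have "?f (single (v, w) 1 - (single (x, y) 1 + single (x', y') 1)) = \<zero>\<^bsub>U\<^esub>"
      using that fD(4)[of "single (x, y) 1" "single (x', y') 1"]
        linear_mapD(3)[OF \<beta>1] U
      by (subst diff) (simp_all add: keys_subsetI single vectorspace_simps)
    then show ?thesis by (simp add: diff_diff_eq)
  qed
  have scl: "?f (single (v, w) 1 - single (x, y) c) = \<zero>\<^bsub>U\<^esub>"
    if "v \<in> carrier V" "w \<in> carrier W" "x \<in> carrier V" "y \<in> carrier W" "\<beta> v w = c \<odot>\<^bsub>U\<^esub> \<beta> x y" for v w x y c
    using that linear_mapD(3)[OF \<beta>1] U
    by (subst diff) (simp_all add: keys_subsetI single vectorspace_simps)
  show "?f p = \<zero>\<^bsub>U\<^esub>" if "p \<in> tensor_relations V W" for p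
  proof -
    have "?f p \<in> {\<zero>\<^bsub>U\<^esub>}"
      by (rule tensor_relations_induct[OF submodule_zero[OF U] f that])
        (simp_all add: add3 scl V W vectorspace_closed linear_mapD(4,5)[OF \<beta>1] linear_mapD(4,5)[OF \<beta>2])
    then show ?thesis by simp
  qed
qed

lemma linear_map_tensor_lift: "is_linear (tensor_space V W) U (tensor_lift U \<beta>)"
  unfolding tensor_lift_def tensor_space_def
  by (rule linear_map_quotient_lift[OF submodule_tensor_relations tensor_lift_kernel])

lemma tensor_lift_pure_tensor:
  assumes "v \<in> carrier V" "w \<in> carrier W"
  shows "tensor_lift U \<beta> (pure_tensor V W v w) = \<beta> v w"
proof -
  have "tensor_lift U \<beta> (pure_tensor V W v w)
      = linear_extension U (\<lambda>(v, w). \<beta> v w) (single (v, w) 1)"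
    unfolding tensor_lift_def pure_tensor_def
    by (rule quotient_lift_coset[OF submodule_tensor_relations tensor_lift_kernel]) (use assms in simp_all)
  also have "\<dots> = 1 \<odot>\<^bsub>U\<^esub> \<beta> v w"
    using \<beta> assms by (subst linear_extension_single[of U "{(v, w)}"])
      (auto simp: bilinear_map_def linear_map_iff)
  also have "\<dots> = \<beta> v w"
    using \<beta> assms by (auto simp: bilinear_map_def linear_map_iff vectorspace_simps)
  finally show ?thesis .
qed

end

end

section \<open>Ideals, quotients and isomorphisms of operads\<close>

lemma shift_mem: "i \<in> {1..m} \<Longrightarrow> j \<in> {1..m} \<Longrightarrow> j \<noteq> i \<Longrightarrow> shift i n j \<in> {1..m + n - 1}"
  by (auto simp: shift_def)

lemma block_perm_block:
  assumes "i \<in> {1..m}" "k \<in> {1..n}"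
  shows "block_perm m n i \<sigma> \<tau> (i - 1 + k) = \<sigma> i - 1 + \<tau> k"
proof -
  have "i - 1 + k \<in> {1..m + n - 1}" "\<not> i - 1 + k < i" "i - 1 + k < i + n" "i - 1 + k - i + 1 = k"
    using assms by auto
  then show ?thesis by (simp add: block_perm_def)
qed

lemma block_perm_shift:
  assumes "i \<in> {1..m}" "j \<in> {1..m}" "j \<noteq> i"
  shows "block_perm m n i \<sigma> \<tau> (shift i n j) = shift (\<sigma> i) n (\<sigma> j)"
proof (cases "j < i")
  case True
  then show ?thesis using assms by (auto simp: block_perm_def shift_def)
next
  case False
  then have "j + n - 1 - n + 1 = j" "\<not> j + n - 1 < i + n" "j + n - 1 \<in> {1..m + n - 1}" "\<not> j + n - 1 < i"
    using assms by auto
  then show ?thesis using False by (simp add: block_perm_def shift_def)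
qed

text \<open>Inside the range, every input either belongs to the block or is a shifted outer input.
  The block sits at \<open>\<sigma> i\<close> after the permutation, which is why the inverse is
  taken at that position.\<close>

lemma block_perm_inverse:
  assumes i: "i \<in> {1..m}" and \<sigma>: "\<sigma> permutes {1..m}" and \<tau>: "\<tau> permutes {1..n}"
  shows "block_perm m n (\<sigma> i) (inv_into UNIV \<sigma>) (inv_into UNIV \<tau>) (block_perm m n i \<sigma> \<tau> l) = l"
proof -
  have inv_simps [simp]: "inv_into UNIV \<sigma> (\<sigma> j) = j" "inv_into UNIV \<tau> (\<tau> j) = j" for j
    by (simp_all add: permutes_inverses(2)[OF \<sigma>] permutes_inverses(2)[OF \<tau>])
  have \<sigma>m: "\<sigma> j \<in> {1..m} \<longleftrightarrow> j \<in> {1..m}" for j by (rule permutes_in_image[OF \<sigma>])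
  have \<tau>m: "\<tau> j \<in> {1..n} \<longleftrightarrow> j \<in> {1..n}" for j by (rule permutes_in_image[OF \<tau>])
  have \<sigma>i: "\<sigma> j = \<sigma> i \<longleftrightarrow> j = i" for j using inv_simps(1) by metis
  consider "l \<notin> {1..m + n - 1}" | k where "l = i - 1 + k" "k \<in> {1..n}"
    | j where "l = shift i n j" "j \<in> {1..m}" "j \<noteq> i"
  proof (cases "l \<in> {1..m + n - 1}")
    case True
    then consider "l < i" | "i \<le> l" "l < i + n" | "i + n \<le> l" by linarith
    then show ?thesis
    proof cases
      case 1
      then show ?thesis using True i by (intro that(3)[of l]) (auto simp: shift_def)
    next
      case 2
      then show ?thesis using i by (intro that(2)[of "l - i + 1"]) auto
    next
      case 3
      then show ?thesis using True i by (intro that(3)[of "l - n + 1"]) (auto simp: shift_def)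
    qed
  qed
  then show ?thesis
  proof cases
    case 1
    then show ?thesis by (simp add: block_perm_def)
  next
    case 2
    then show ?thesis using i \<sigma>m \<tau>m by (simp only: block_perm_block inv_simps)
  next
    case 3
    then show ?thesis using i \<sigma>m \<sigma>i by (simp only: block_perm_shift inv_simps not_False_eq_True)
  qed
qed

lemma
  assumes i: "i \<in> {1..m}" and \<sigma>: "\<sigma> permutes {1..m}" and \<tau>: "\<tau> permutes {1..n}"
  shows block_perm_permutes: "block_perm m n i \<sigma> \<tau> permutes {1..m + n - 1}"
    and inv_block_perm: "inv_into UNIV (block_perm m n i \<sigma> \<tau>) = block_perm m n (\<sigma> i) (inv_into UNIV \<sigma>) (inv_into UNIV \<tau>)"
proof -
  have 1: "block_perm m n (\<sigma> i) (inv_into UNIV \<sigma>) (inv_into UNIV \<tau>) (block_perm m n i \<sigma> \<tau> l) = l" for l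
    by (rule block_perm_inverse[OF assms])
  \<comment> \<open>The same lemma for the inverse permutations, started at
    \<open>\<sigma> i\<close>, is the inverse law on the other side.\<close>
  have "block_perm m n (inv_into UNIV \<sigma> (\<sigma> i)) (inv_into UNIV (inv_into UNIV \<sigma>)) (inv_into UNIV (inv_into UNIV \<tau>)) (block_perm m n (\<sigma> i) (inv_into UNIV \<sigma>) (inv_into UNIV \<tau>) l) = l" for l
    by (rule block_perm_inverse) (use permutes_in_image[OF \<sigma>] i \<sigma> \<tau> in \<open>auto simp: permutes_inv\<close>)
  then have 2: "block_perm m n i \<sigma> \<tau> (block_perm m n (\<sigma> i) (inv_into UNIV \<sigma>) (inv_into UNIV \<tau>) l) = l" for l
    by (simp add: permutes_inverses[OF \<sigma>] inv_inv_eq permutes_bij[OF \<sigma>] permutes_bij[OF \<tau>])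
  show "inv_into UNIV (block_perm m n i \<sigma> \<tau>) = block_perm m n (\<sigma> i) (inv_into UNIV \<sigma>) (inv_into UNIV \<tau>)"
    by (rule inv_equality) (rule 1, rule 2)
  show "block_perm m n i \<sigma> \<tau> permutes {1..m + n - 1}"
    unfolding permutes_def
  proof (intro conjI allI impI)
    show "\<exists>!x. block_perm m n i \<sigma> \<tau> x = y" for y
      by (rule ex1I[of _ "block_perm m n (\<sigma> i) (inv_into UNIV \<sigma>) (inv_into UNIV \<tau>) y"]) (use 1 2 in auto)
  qed (simp add: block_perm_def)
qed

section \<open>Operad ideals\<close>

lemma operad_idealD:
  assumes "operad_ideal P I"
  shows "is_subspace (I n) (arity P n)"
    and "\<sigma> permutes {1..n} \<Longrightarrow> p \<in> I n \<Longrightarrow> act P n \<sigma> p \<in> I n"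
    and "i \<in> {1..m} \<Longrightarrow> p \<in> I m \<Longrightarrow> q \<in> carrier (arity P n) \<Longrightarrow> pcomp P m n i p q \<in> I (m + n - 1)"
    and "i \<in> {1..m} \<Longrightarrow> p \<in> carrier (arity P m) \<Longrightarrow> q \<in> I n \<Longrightarrow> pcomp P m n i p q \<in> I (m + n - 1)"
  using assms by (simp_all add: operad_ideal_def)

lemma operad_idealI:
  assumes "\<And>n. is_subspace (I n) (arity P n)"
    and "\<And>n \<sigma> p. \<sigma> permutes {1..n} \<Longrightarrow> p \<in> I n \<Longrightarrow> act P n \<sigma> p \<in> I n"
    and "\<And>m n i p q. i \<in> {1..m} \<Longrightarrow> p \<in> I m \<Longrightarrow> q \<in> carrier (arity P n) \<Longrightarrow>
      pcomp P m n i p q \<in> I (m + n - 1)"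
    and "\<And>m n i p q. i \<in> {1..m} \<Longrightarrow> p \<in> carrier (arity P m) \<Longrightarrow> q \<in> I n \<Longrightarrow>
      pcomp P m n i p q \<in> I (m + n - 1)"
  shows "operad_ideal P I"
  unfolding operad_ideal_def using assms by blast

context operad
begin

text \<open>That arities are vector spaces is contained in the linearity of the action, here of the
  identity permutation.\<close>

lemma vectorspace_arity: "is_space (arity P n)"
  using linear_mapD(1)[OF act_linear[OF permutes_id]] .

lemma act_closed: "\<sigma> permutes {1..n} \<Longrightarrow> p \<in> carrier (arity P n) \<Longrightarrow> act P n \<sigma> p \<in> carrier (arity P n)"
  by (rule linear_mapD(3)[OF act_linear])

lemma pcomp_closed:
  "i \<in> {1..m} \<Longrightarrow> p \<in> carrier (arity P m) \<Longrightarrow> q \<in> carrier (arity P n) \<Longrightarrow>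
    pcomp P m n i p q \<in> carrier (arity P (m + n - 1))"
  by (rule linear_mapD(3)[OF pcomp_linear_right])

end

section \<open>Quotient operads\<close>

lemma quotient_operad_simps:
  "arity (quotient_operad P I) n = quotient_space (arity P n) (I n)"
  "unit (quotient_operad P I) = I 1 +>\<^bsub>arity P 1\<^esub> unit P"
  by (simp_all add: quotient_operad_def)

context
  fixes P :: "('k::field, 'a) operad_data" and I
  assumes P: "operad P" and I: "operad_ideal P I"
begin

interpretation operad P by fact

private lemmas N = operad_idealD(1)[OF I]

lemma act_quotient_operad:
  assumes "\<sigma> permutes {1..n}" "p \<in> carrier (arity P n)"
  shows "act (quotient_operad P I) n \<sigma> (I n +>\<^bsub>arity P n\<^esub> p) = I n +>\<^bsub>arity P n\<^esub> act P n \<sigma> p"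
  using coset_map_coset[OF N N act_linear[OF assms(1)] operad_idealD(2)[OF I assms(1)] assms(2)]
  by (simp add: quotient_operad_def)

text \<open>Composition in the quotient is a union, over representatives on the left, of maps
  induced on the right. The right argument collapses first; what remains is the map induced by the
  left argument.\<close>

lemma pcomp_quotient_operad:
  assumes i: "i \<in> {1..m}" and p: "p \<in> carrier (arity P m)" and q: "q \<in> carrier (arity P n)"
  shows "pcomp (quotient_operad P I) m n i (I m +>\<^bsub>arity P m\<^esub> p) (I n +>\<^bsub>arity P n\<^esub> q)
    = I (m + n - 1) +>\<^bsub>arity P (m + n - 1)\<^esub> pcomp P m n i p q"
proof -
  let ?C = "\<lambda>x. I (m + n - 1) +>\<^bsub>arity P (m + n - 1)\<^esub> x"
  have right: "coset_map (arity P (m + n - 1)) (I (m + n - 1)) (pcomp P m n i a) (I n +>\<^bsub>arity P n\<^esub> q)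
      = ?C (pcomp P m n i a q)" if "a \<in> carrier (arity P m)" for a
    by (rule coset_map_coset[OF N N pcomp_linear_right[OF i that] operad_idealD(4)[OF I i that] q])
  have left: "coset_map (arity P (m + n - 1)) (I (m + n - 1)) (\<lambda>a. pcomp P m n i a q) (I m +>\<^bsub>arity P m\<^esub> p)
      = ?C (pcomp P m n i p q)"
    by (rule coset_map_coset[OF N N pcomp_linear_left[OF i q] operad_idealD(3)[OF I i _ q] p])
  have "pcomp (quotient_operad P I) m n i (I m +>\<^bsub>arity P m\<^esub> p) (I n +>\<^bsub>arity P n\<^esub> q)
      = (\<Union>a\<in>I m +>\<^bsub>arity P m\<^esub> p. ?C (pcomp P m n i a q))"
    unfolding quotient_operad_def operad_data.simps
    by (intro SUP_cong refl right) (rule conjunct1[OF coset_memD[OF N _ p]])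
  then show ?thesis using left unfolding coset_map_def by (rule trans)
qed

lemma quotient_operad_rep:
  assumes "A \<in> carrier (arity (quotient_operad P I) n)"
  obtains p where "p \<in> carrier (arity P n)" "A = I n +>\<^bsub>arity P n\<^esub> p"
  using assms unfolding quotient_operad_simps carrier_quotient_space[OF N] by auto

text \<open>Every element has a representative and all operations are computed on representatives,
  so each axiom is inherited.\<close>

lemma operad_quotient_operad: "operad (quotient_operad P I)"
proof (rule operad.intro)
  let ?Q = "quotient_operad P I"
  note Q = quotient_operad_simps and aQ = act_quotient_operad and pQ = pcomp_quotient_operad
  fix \<sigma> :: "nat \<Rightarrow> nat" and n assume \<sigma>: "\<sigma> permutes {1..n}"
  have act: "act ?Q n \<sigma> = coset_map (arity P n) (I n) (act P n \<sigma>)"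
    by (simp add: quotient_operad_def)
  show "is_linear (arity ?Q n) (arity ?Q n) (act ?Q n \<sigma>)"
    unfolding Q act
    by (rule linear_map_coset_map[OF N N act_linear[OF \<sigma>] operad_idealD(2)[OF I \<sigma>]])
  fix \<tau> p assume \<tau>: "\<tau> permutes {1..n}" and "p \<in> carrier (arity ?Q n)"
  then obtain a where a: "a \<in> carrier (arity P n)" "p = I n +>\<^bsub>arity P n\<^esub> a" by (rule_tac quotient_operad_rep)
  show "act ?Q n \<tau> (act ?Q n \<sigma> p) = act ?Q n (\<sigma> \<circ> \<tau>) p"
    using \<sigma> \<tau> a by (simp add: aQ act_closed act_comp permutes_compose)
next
  let ?Q = "quotient_operad P I"
  fix p n assume "p \<in> carrier (arity ?Q n)"
  then obtain a where a: "a \<in> carrier (arity P n)" "p = I n +>\<^bsub>arity P n\<^esub> a" by (rule quotient_operad_rep)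
  then show "act ?Q n id p = p" by (simp add: act_quotient_operad permutes_id act_id)
next
  let ?Q = "quotient_operad P I"
  note Q = quotient_operad_simps
  note cl = carrier_quotient_space[OF N] and ops = add_quotient_space[OF N] smult_quotient_space[OF N]
  note qs = vectorspace_quotient_space[OF N]
  fix i m n :: nat and q assume i: "i \<in> {1..m}" and "q \<in> carrier (arity ?Q n)"
  then obtain b where b: "b \<in> carrier (arity P n)" "q = I n +>\<^bsub>arity P n\<^esub> b" by (rule_tac quotient_operad_rep)
  note lin = pcomp_linear_left[OF i b(1)]
  show "is_linear (arity ?Q m) (arity ?Q (m + n - 1)) (\<lambda>p. pcomp ?Q m n i p q)"
  proof (rule linear_map_cong)
    show "is_linear (arity ?Q m) (arity ?Q (m + n - 1))
        (coset_map (arity P (m + n - 1)) (I (m + n - 1)) (\<lambda>p. pcomp P m n i p b))"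
      unfolding Q by (rule linear_map_coset_map[OF N N lin operad_idealD(3)[OF I i _ b(1)]])
    fix p assume "p \<in> carrier (arity ?Q m)"
    then obtain a where a: "a \<in> carrier (arity P m)" "p = I m +>\<^bsub>arity P m\<^esub> a" by (rule quotient_operad_rep)
    show "pcomp ?Q m n i p q = coset_map (arity P (m + n - 1)) (I (m + n - 1)) (\<lambda>p. pcomp P m n i p b) p"
      unfolding a b pcomp_quotient_operad[OF i a(1) b(1)]
      by (rule coset_map_coset[OF N N lin operad_idealD(3)[OF I i _ b(1)] a(1), symmetric])
  qed
next
  let ?Q = "quotient_operad P I"
  note Q = quotient_operad_simps
  fix i m n :: nat and p assume i: "i \<in> {1..m}" and "p \<in> carrier (arity ?Q m)"
  then obtain a where a: "a \<in> carrier (arity P m)" "p = I m +>\<^bsub>arity P m\<^esub> a" by (rule_tac quotient_operad_rep)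
  note lin = pcomp_linear_right[OF i a(1)]
  show "is_linear (arity ?Q n) (arity ?Q (m + n - 1)) (\<lambda>q. pcomp ?Q m n i p q)"
  proof (rule linear_map_cong)
    show "is_linear (arity ?Q n) (arity ?Q (m + n - 1))
        (coset_map (arity P (m + n - 1)) (I (m + n - 1)) (pcomp P m n i a))"
      unfolding Q by (rule linear_map_coset_map[OF N N lin operad_idealD(4)[OF I i a(1)]])
    fix q assume "q \<in> carrier (arity ?Q n)"
    then obtain b where b: "b \<in> carrier (arity P n)" "q = I n +>\<^bsub>arity P n\<^esub> b" by (rule quotient_operad_rep)
    show "pcomp ?Q m n i p q = coset_map (arity P (m + n - 1)) (I (m + n - 1)) (pcomp P m n i a) q"
      unfolding a b pcomp_quotient_operad[OF i a(1) b(1)]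
      by (rule coset_map_coset[OF N N lin operad_idealD(4)[OF I i a(1)] b(1), symmetric])
  qed
next
  let ?Q = "quotient_operad P I"
  show "unit ?Q \<in> carrier (arity ?Q 1)"
    unfolding quotient_operad_simps carrier_quotient_space[OF N] using unit_closed by blast
  fix q n assume "q \<in> carrier (arity ?Q n)"
  then obtain b where b: "b \<in> carrier (arity P n)" "q = I n +>\<^bsub>arity P n\<^esub> b" by (rule quotient_operad_rep)
  show "pcomp ?Q 1 n 1 (unit ?Q) q = q"
    using pcomp_quotient_operad[of 1 1 "unit P" b n] unit_closed unit_left[OF b(1)]
    by (simp add: b quotient_operad_simps)
next
  let ?Q = "quotient_operad P I"
  fix i m :: nat and p assume i: "i \<in> {1..m}" and "p \<in> carrier (arity ?Q m)"
  then obtain a where a: "a \<in> carrier (arity P m)" "p = I m +>\<^bsub>arity P m\<^esub> a" by (rule_tac quotient_operad_rep)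
  show "pcomp ?Q m 1 i p (unit ?Q) = p"
    using pcomp_quotient_operad[OF i a(1), of "unit P" 1] unit_closed unit_right[OF i a(1)]
    by (simp add: a quotient_operad_simps)
next
  let ?Q = "quotient_operad P I"
  fix i l j m n :: nat and p q r
  assume i: "i \<in> {1..l}" and j: "j \<in> {1..m}"
    and "p \<in> carrier (arity ?Q l)" "q \<in> carrier (arity ?Q m)" "r \<in> carrier (arity ?Q n)"
  then obtain a b c where a: "a \<in> carrier (arity P l)" "p = I l +>\<^bsub>arity P l\<^esub> a"
    and b: "b \<in> carrier (arity P m)" "q = I m +>\<^bsub>arity P m\<^esub> b"
    and c: "c \<in> carrier (arity P n)" "r = I n +>\<^bsub>arity P n\<^esub> c" by (meson quotient_operad_rep)
  \<comment> \<open>The two sides name their arity differently. With truncated subtraction the names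
    agree because the ranges of \<open>i\<close> and \<open>j\<close> make \<open>l\<close> and
    \<open>m\<close> positive.\<close>
  have eq: "l + m - 1 + n - 1 = l + (m + n - 1) - 1" using i j by auto
  have "i - 1 + j \<in> {1..l + m - 1}" using i j by auto
  then have "pcomp ?Q (l + m - 1) n (i - 1 + j) (pcomp ?Q l m i p q) r
      = I (l + m - 1 + n - 1) +>\<^bsub>arity P (l + m - 1 + n - 1)\<^esub>
        pcomp P (l + m - 1) n (i - 1 + j) (pcomp P l m i a b) c"
    unfolding a(2) b(2) c(2) pcomp_quotient_operad[OF i a(1) b(1)]
    by (rule pcomp_quotient_operad[OF _ pcomp_closed[OF i a(1) b(1)] c(1)])
  moreover have "pcomp ?Q l (m + n - 1) i p (pcomp ?Q m n j q r)
      = I (l + (m + n - 1) - 1) +>\<^bsub>arity P (l + (m + n - 1) - 1)\<^esub>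
        pcomp P l (m + n - 1) i a (pcomp P m n j b c)"
    unfolding a(2) b(2) c(2) pcomp_quotient_operad[OF j b(1) c(1)]
    by (rule pcomp_quotient_operad[OF i a(1) pcomp_closed[OF j b(1) c(1)]])
  ultimately show "pcomp ?Q (l + m - 1) n (i - 1 + j) (pcomp ?Q l m i p q) r =
      pcomp ?Q l (m + n - 1) i p (pcomp ?Q m n j q r)"
    using sequential[OF i j a(1) b(1) c(1)] unfolding eq by simp
next
  let ?Q = "quotient_operad P I"
  fix i k l m n :: nat and p q r
  assume i: "1 \<le> i" and k: "i < k" and l: "k \<le> l"
    and "p \<in> carrier (arity ?Q l)" "q \<in> carrier (arity ?Q m)" "r \<in> carrier (arity ?Q n)"
  then obtain a b c where a: "a \<in> carrier (arity P l)" "p = I l +>\<^bsub>arity P l\<^esub> a"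
    and b: "b \<in> carrier (arity P m)" "q = I m +>\<^bsub>arity P m\<^esub> b"
    and c: "c \<in> carrier (arity P n)" "r = I n +>\<^bsub>arity P n\<^esub> c" by (meson quotient_operad_rep)
  have eq: "l + m - 1 + n - 1 = l + n - 1 + m - 1" using i k l by auto
  have i': "i \<in> {1..l}" and k': "k \<in> {1..l}" and "k - 1 + m \<in> {1..l + m - 1}" "i \<in> {1..l + n - 1}"
    using i k l by auto
  then have "pcomp ?Q (l + m - 1) n (k - 1 + m) (pcomp ?Q l m i p q) r
      = I (l + m - 1 + n - 1) +>\<^bsub>arity P (l + m - 1 + n - 1)\<^esub>
        pcomp P (l + m - 1) n (k - 1 + m) (pcomp P l m i a b) c"
    unfolding a(2) b(2) c(2) pcomp_quotient_operad[OF i' a(1) b(1)]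
    by (intro pcomp_quotient_operad[OF _ pcomp_closed[OF i' a(1) b(1)] c(1)])
  moreover have "pcomp ?Q (l + n - 1) m i (pcomp ?Q l n k p r) q
      = I (l + n - 1 + m - 1) +>\<^bsub>arity P (l + n - 1 + m - 1)\<^esub>
        pcomp P (l + n - 1) m i (pcomp P l n k a c) b"
    unfolding a(2) b(2) c(2) pcomp_quotient_operad[OF k' a(1) c(1)]
    by (rule pcomp_quotient_operad[OF \<open>i \<in> {1..l + n - 1}\<close> pcomp_closed[OF k' a(1) c(1)] b(1)])
  ultimately show "pcomp ?Q (l + m - 1) n (k - 1 + m) (pcomp ?Q l m i p q) r =
      pcomp ?Q (l + n - 1) m i (pcomp ?Q l n k p r) q"
    using parallel[OF i k l a(1) b(1) c(1)] unfolding eq by simp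
next
  let ?Q = "quotient_operad P I"
  fix i m n \<sigma> \<tau> p q
  assume i: "i \<in> {1..m}" and \<sigma>: "\<sigma> permutes {1..m}" and \<tau>: "\<tau> permutes {1..n}"
    and "p \<in> carrier (arity ?Q m)" "q \<in> carrier (arity ?Q n)"
  then obtain a b where a: "a \<in> carrier (arity P m)" "p = I m +>\<^bsub>arity P m\<^esub> a"
    and b: "b \<in> carrier (arity P n)" "q = I n +>\<^bsub>arity P n\<^esub> b" by (meson quotient_operad_rep)
  have \<sigma>i: "\<sigma> i \<in> {1..m}" using permutes_in_image[OF \<sigma>] i by blast
  show "pcomp ?Q m n i (act ?Q m \<sigma> p) (act ?Q n \<tau> q) =
      act ?Q (m + n - 1) (block_perm m n i \<sigma> \<tau>) (pcomp ?Q m n (\<sigma> i) p q)"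
    unfolding a(2) b(2) act_quotient_operad[OF \<sigma> a(1)] act_quotient_operad[OF \<tau> b(1)]
      pcomp_quotient_operad[OF \<sigma>i a(1) b(1)]
      pcomp_quotient_operad[OF i act_closed[OF \<sigma> a(1)] act_closed[OF \<tau> b(1)]]
      act_quotient_operad[OF block_perm_permutes[OF i \<sigma> \<tau>] pcomp_closed[OF \<sigma>i a(1) b(1)]]
      equivariant[OF i \<sigma> \<tau> a(1) b(1)] ..
qed

end

section \<open>Generated ideals\<close>

context
  fixes P :: "('k::field, 'a) operad_data"
  assumes P: "operad P"
begin

interpretation operad P by fact

text \<open>Ensures that \<open>generated_ideal\<close> intersects a nonempty family whenever the
  relations lie in the carriers.\<close>

lemma operad_ideal_carrier: "operad_ideal P (\<lambda>n. carrier (arity P n))"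
  by (intro operad_idealI submodule_carrier vectorspace_arity act_closed pcomp_closed)

lemma operad_ideal_generated_ideal:
  assumes R: "\<And>n. R n \<subseteq> carrier (arity P n)"
  shows "operad_ideal P (generated_ideal P R)"
proof (rule operad_idealI)
  show "is_subspace (generated_ideal P R n) (arity P n)" for n
    unfolding generated_ideal_def
    by (rule submodule_Inter) (use operad_ideal_carrier R in \<open>auto dest: operad_idealD(1)\<close>)
  have mem: "p \<in> generated_ideal P R n \<longleftrightarrow> (\<forall>I. operad_ideal P I \<longrightarrow> (\<forall>m. R m \<subseteq> I m) \<longrightarrow> p \<in> I n)" for p n
    unfolding generated_ideal_def by blast
  show "act P n \<sigma> p \<in> generated_ideal P R n" if "\<sigma> permutes {1..n}" "p \<in> generated_ideal P R n" for n \<sigma> p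
    unfolding mem
  proof (intro allI impI)
    fix I assume I: "operad_ideal P I" "\<forall>m. R m \<subseteq> I m"
    then have "p \<in> I n" using that unfolding mem by blast
    then show "act P n \<sigma> p \<in> I n" by (rule operad_idealD(2)[OF I(1) that(1)])
  qed
  show "pcomp P m n i p q \<in> generated_ideal P R (m + n - 1)"
    if "i \<in> {1..m}" "p \<in> generated_ideal P R m" "q \<in> carrier (arity P n)" for m n i p q
    unfolding mem
  proof (intro allI impI)
    fix I assume I: "operad_ideal P I" "\<forall>m. R m \<subseteq> I m"
    then have "p \<in> I m" using that unfolding mem by blast
    then show "pcomp P m n i p q \<in> I (m + n - 1)" by (rule operad_idealD(3)[OF I(1) that(1) _ that(3)])
  qed
  show "pcomp P m n i p q \<in> generated_ideal P R (m + n - 1)"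
    if "i \<in> {1..m}" "p \<in> carrier (arity P m)" "q \<in> generated_ideal P R n" for m n i p q
    unfolding mem
  proof (intro allI impI)
    fix I assume I: "operad_ideal P I" "\<forall>m. R m \<subseteq> I m"
    then have "q \<in> I n" using that unfolding mem by blast
    then show "pcomp P m n i p q \<in> I (m + n - 1)" by (rule operad_idealD(4)[OF I(1) that(1,2)])
  qed
qed

lemma generated_ideal_superset: "R n \<subseteq> generated_ideal P R n"
  by (auto simp: generated_ideal_def)

lemma generated_ideal_least: "operad_ideal P I \<Longrightarrow> (\<And>n. R n \<subseteq> I n) \<Longrightarrow> generated_ideal P R n \<subseteq> I n"
  by (auto simp: generated_ideal_def)

end

section \<open>Transport of ideals along isomorphisms\<close>

lemma operad_isoD:
  assumes "operad_iso P Q f"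
  shows "is_linear (arity P n) (arity Q n) (f n)"
    and "bij_betw (f n) (carrier (arity P n)) (carrier (arity Q n))"
    and "\<sigma> permutes {1..n} \<Longrightarrow> p \<in> carrier (arity P n) \<Longrightarrow> f n (act P n \<sigma> p) = act Q n \<sigma> (f n p)"
    and "i \<in> {1..m} \<Longrightarrow> p \<in> carrier (arity P m) \<Longrightarrow> q \<in> carrier (arity P n) \<Longrightarrow>
      f (m + n - 1) (pcomp P m n i p q) = pcomp Q m n i (f m p) (f n q)"
    and "f 1 (unit P) = unit Q"
  using assms unfolding operad_iso_def by blast+

context
  fixes P :: "('k::field, 'a) operad_data" and Q :: "('k, 'b) operad_data" and f
  assumes P: "operad P" and Q: "operad Q" and f: "operad_iso P Q f"
begin

interpretation P: operad P by (rule P)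
interpretation Q: operad Q by (rule Q)

private lemmas fD = operad_isoD[OF f]

lemma operad_iso_quotient_operad:
  assumes I: "operad_ideal P I" and J: "operad_ideal Q J" and fI: "\<And>n. f n ` I n = J n"
  shows "operad_iso (quotient_operad P I) (quotient_operad Q J) (\<lambda>n. coset_map (arity Q n) (J n) (f n))"
proof -
  note NI = operad_idealD(1)[OF I] and NJ = operad_idealD(1)[OF J]
  let ?g = "\<lambda>n. coset_map (arity Q n) (J n) (f n)"
  have g: "?g n (I n +>\<^bsub>arity P n\<^esub> p) = J n +>\<^bsub>arity Q n\<^esub> f n p" if "p \<in> carrier (arity P n)" for n p
    by (rule coset_map_coset[OF NI NJ fD(1) _ that]) (use fI in auto)
  have fcl: "f n p \<in> carrier (arity Q n)" if "p \<in> carrier (arity P n)" for n p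
    using linear_mapD(3)[OF fD(1) that] .
  have "inj_on (?g n) (carrier (arity (quotient_operad P I) n))" for n
  proof (rule inj_onI)
    fix A B assume "A \<in> carrier (arity (quotient_operad P I) n)" "B \<in> carrier (arity (quotient_operad P I) n)"
      and eq: "?g n A = ?g n B"
    then obtain a b where a: "a \<in> carrier (arity P n)" "A = I n +>\<^bsub>arity P n\<^esub> a"
      and b: "b \<in> carrier (arity P n)" "B = I n +>\<^bsub>arity P n\<^esub> b" by (meson quotient_operad_rep[OF P I])
    have "J n +>\<^bsub>arity Q n\<^esub> f n a = J n +>\<^bsub>arity Q n\<^esub> f n b" using eq unfolding a(2) b(2) g[OF a(1)] g[OF b(1)] .
    then have "f n (a \<ominus>\<^bsub>arity P n\<^esub> b) \<in> f n ` I n"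
      unfolding fI linear_mapD(6)[OF fD(1) a(1) b(1)] coset_eq_iff[OF NJ fcl[OF a(1)] fcl[OF b(1)]] .
    then obtain c where c: "c \<in> I n" "f n (a \<ominus>\<^bsub>arity P n\<^esub> b) = f n c" by auto
    \<comment> \<open>Injectivity of \<open>f n\<close> pulls the membership of the difference back
      from \<open>J n\<close> to \<open>I n\<close>.\<close>
    then have "a \<ominus>\<^bsub>arity P n\<^esub> b = c"
      using bij_betw_imp_inj_on[OF fD(2)] submoduleD(4)[OF NI] a(1) b(1) vectorspaceD(3)[OF P.vectorspace_arity]
      by (metis inj_on_eq_iff)
    then show "A = B" using c(1) a b by (simp add: coset_eq_iff[OF NI])
  qed
  moreover have "?g n ` carrier (arity (quotient_operad P I) n) = carrier (arity (quotient_operad Q J) n)" for n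
  proof -
    have "?g n ` carrier (arity (quotient_operad P I) n) = (\<lambda>p. J n +>\<^bsub>arity Q n\<^esub> f n p) ` carrier (arity P n)"
      unfolding quotient_operad_simps carrier_quotient_space[OF NI] image_image
      by (intro image_cong refl g)
    also have "\<dots> = (\<lambda>q. J n +>\<^bsub>arity Q n\<^esub> q) ` (f n ` carrier (arity P n))" by (simp add: image_image)
    finally show ?thesis
      unfolding bij_betw_imp_surj_on[OF fD(2)] quotient_operad_simps carrier_quotient_space[OF NJ] .
  qed
  ultimately have bij: "bij_betw (?g n) (carrier (arity (quotient_operad P I) n))
      (carrier (arity (quotient_operad Q J) n))" for n
    by (simp add: bij_betw_def)
  have lin: "is_linear (arity (quotient_operad P I) n) (arity (quotient_operad Q J) n) (?g n)" for n
    unfolding quotient_operad_simps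
    by (rule linear_map_coset_map[OF NI NJ fD(1)]) (use fI in auto)
  have act: "?g n (act (quotient_operad P I) n \<sigma> A) = act (quotient_operad Q J) n \<sigma> (?g n A)"
    if \<sigma>: "\<sigma> permutes {1..n}" and "A \<in> carrier (arity (quotient_operad P I) n)" for n \<sigma> A
  proof -
    from that(2) obtain a where a: "a \<in> carrier (arity P n)" "A = I n +>\<^bsub>arity P n\<^esub> a"
      by (rule quotient_operad_rep[OF P I])
    show ?thesis
      unfolding a(2) act_quotient_operad[OF P I \<sigma> a(1)] g[OF a(1)] g[OF P.act_closed[OF \<sigma> a(1)]]
        act_quotient_operad[OF Q J \<sigma> fcl[OF a(1)]] fD(3)[OF \<sigma> a(1)] ..
  qed
  have pcomp: "?g (m + n - 1) (pcomp (quotient_operad P I) m n i A B)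
      = pcomp (quotient_operad Q J) m n i (?g m A) (?g n B)"
    if i: "i \<in> {1..m}" and "A \<in> carrier (arity (quotient_operad P I) m)"
      "B \<in> carrier (arity (quotient_operad P I) n)" for m n i A B
  proof -
    from that(2,3) obtain a b where a: "a \<in> carrier (arity P m)" "A = I m +>\<^bsub>arity P m\<^esub> a"
      and b: "b \<in> carrier (arity P n)" "B = I n +>\<^bsub>arity P n\<^esub> b" by (meson quotient_operad_rep[OF P I])
    show ?thesis
      unfolding a(2) b(2) pcomp_quotient_operad[OF P I i a(1) b(1)] g[OF P.pcomp_closed[OF i a(1) b(1)]]
        g[OF a(1)] g[OF b(1)] pcomp_quotient_operad[OF Q J i fcl[OF a(1)] fcl[OF b(1)]]
        fD(4)[OF i a(1) b(1)] ..
  qed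
  show ?thesis
    unfolding operad_iso_def
    using lin bij act pcomp g[OF P.unit_closed] fD(5) by (simp add: quotient_operad_simps)
qed

lemma operad_ideal_preimage:
  assumes J: "operad_ideal Q J"
  shows "operad_ideal P (\<lambda>n. {p \<in> carrier (arity P n). f n p \<in> J n})"
proof (rule operad_idealI)
  note fcl = linear_mapD(3)[OF fD(1)]
  show "is_subspace {p \<in> carrier (arity P n). f n p \<in> J n} (arity P n)" for n
    by (rule submodule_preimage[OF fD(1) operad_idealD(1)[OF J]])
  show "act P n \<sigma> p \<in> {p \<in> carrier (arity P n). f n p \<in> J n}"
    if "\<sigma> permutes {1..n}" "p \<in> {p \<in> carrier (arity P n). f n p \<in> J n}" for n \<sigma> p
    using that P.act_closed[OF that(1)] fD(3)[OF that(1)] operad_idealD(2)[OF J that(1)] by simp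
  show "pcomp P m n i p q \<in> {p \<in> carrier (arity P (m + n - 1)). f (m + n - 1) p \<in> J (m + n - 1)}"
    if "i \<in> {1..m}" "p \<in> {p \<in> carrier (arity P m). f m p \<in> J m}" "q \<in> carrier (arity P n)" for m n i p q
    using that(2) P.pcomp_closed[OF that(1) _ that(3)] fD(4)[OF that(1) _ that(3)]
      operad_idealD(3)[OF J that(1) _ fcl[OF that(3)]] by simp
  show "pcomp P m n i p q \<in> {p \<in> carrier (arity P (m + n - 1)). f (m + n - 1) p \<in> J (m + n - 1)}"
    if "i \<in> {1..m}" "p \<in> carrier (arity P m)" "q \<in> {p \<in> carrier (arity P n). f n p \<in> J n}" for m n i p q
    using that(3) P.pcomp_closed[OF that(1,2)] fD(4)[OF that(1,2)]
      operad_idealD(4)[OF J that(1) fcl[OF that(2)]] by simp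
qed

text \<open>The image absorbs arbitrary elements of \<open>Q\<close> because these lift to
  \<open>P\<close>, by surjectivity of \<open>f\<close>.\<close>

lemma operad_ideal_image:
  assumes I: "operad_ideal P I"
  shows "operad_ideal Q (\<lambda>n. f n ` I n)"
proof -
  have sub: "p \<in> carrier (arity P n)" if "p \<in> I n" for p n
    using submoduleD(4)[OF operad_idealD(1)[OF I] that] .
  have surj: "\<exists>p\<in>carrier (arity P n). q = f n p" if "q \<in> carrier (arity Q n)" for q n
    using bij_betw_imp_surj_on[OF fD(2)] that by blast
  show ?thesis
  proof (rule operad_idealI)
    show "is_subspace (f n ` I n) (arity Q n)" for n
      by (rule submodule_image[OF fD(1) operad_idealD(1)[OF I]])
    show "act Q n \<sigma> q \<in> f n ` I n" if "\<sigma> permutes {1..n}" "q \<in> f n ` I n" for n \<sigma> q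
    proof -
      from that obtain p where p: "p \<in> I n" "q = f n p" by blast
      show ?thesis
        using fD(3)[OF that(1) sub[OF p(1)]] operad_idealD(2)[OF I that(1) p(1)] p(2) by (metis imageI)
    qed
    show "pcomp Q m n i p q \<in> f (m + n - 1) ` I (m + n - 1)"
      if i: "i \<in> {1..m}" and "p \<in> f m ` I m" "q \<in> carrier (arity Q n)" for m n i p q
    proof -
      from that surj obtain a b where "a \<in> I m" "p = f m a" "b \<in> carrier (arity P n)" "q = f n b" by blast
      then show ?thesis using fD(4)[OF i, of a b n] operad_idealD(3)[OF I i, of a b n] sub by (metis imageI)
    qed
    show "pcomp Q m n i p q \<in> f (m + n - 1) ` I (m + n - 1)"
      if i: "i \<in> {1..m}" and "p \<in> carrier (arity Q m)" "q \<in> f n ` I n" for m n i p q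
    proof -
      from that surj obtain a b where "b \<in> I n" "p = f m a" "a \<in> carrier (arity P m)" "q = f n b" by blast
      then show ?thesis using fD(4)[OF i, of a b n] operad_idealD(4)[OF I i, of a b n] sub by (metis imageI)
    qed
  qed
qed

text \<open>It is enough that each family of relations lands in the ideal generated by the other.
  One inclusion pulls an ideal back along \<open>f\<close>, the other pushes one forward.\<close>

lemma generated_ideal_image:
  assumes R: "\<And>n. R n \<subseteq> carrier (arity P n)" and R': "\<And>n. R' n \<subseteq> carrier (arity Q n)"
    and 1: "\<And>n. f n ` R n \<subseteq> generated_ideal Q R' n"
    and 2: "\<And>n. R' n \<subseteq> f n ` generated_ideal P R n"
  shows "f n ` generated_ideal P R n = generated_ideal Q R' n"
proof
  have "generated_ideal P R n \<subseteq> {p \<in> carrier (arity P n). f n p \<in> generated_ideal Q R' n}"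
    by (rule generated_ideal_least[OF P operad_ideal_preimage[OF operad_ideal_generated_ideal[OF Q R']]])
      (use 1 R in auto)
  then show "f n ` generated_ideal P R n \<subseteq> generated_ideal Q R' n" by auto
  show "generated_ideal Q R' n \<subseteq> f n ` generated_ideal P R n"
    by (rule generated_ideal_least[OF Q operad_ideal_image[OF operad_ideal_generated_ideal[OF P R]] 2])
qed

end

section \<open>The operad of trees\<close>

text \<open>Relabelling and grafting are both substitutions at the leaves, so this law reduces the
  operad axioms for trees to a comparison leaf by leaf.\<close>

lemma subst_leaves_subst_leaves:
  "subst_leaves f (subst_leaves g t) = subst_leaves (\<lambda>j. subst_leaves f (g j)) t"
  by (induction t) simp_all

lemma subst_leaves_cong: "(\<And>j. j \<in> set (leaves t) \<Longrightarrow> f j = g j) \<Longrightarrow> subst_leaves f t = subst_leaves g t"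
  by (induction t) simp_all

lemma subst_leaves_Leaf [simp]: "subst_leaves Leaf t = t"
  by (induction t) simp_all

lemma leaves_subst_leaves: "leaves (subst_leaves f t) = concat (map (\<lambda>j. leaves (f j)) (leaves t))"
  by (induction t) simp_all

lemma labels_subst_leaves: "labels (subst_leaves f t) = labels t \<union> (\<Union>j\<in>set (leaves t). labels (f j))"
  by (induction t) auto

lemma relabel_simps [simp]:
  "relabel g (Leaf j) = Leaf (g j)" "relabel g (Node v s t) = Node v (relabel g s) (relabel g t)"
  by (simp_all add: relabel_def)

lemma leaves_relabel [simp]: "leaves (relabel g t) = map g (leaves t)"
  by (induction t) simp_all

lemma labels_relabel [simp]: "labels (relabel g t) = labels t"
  by (induction t) simp_all

lemma subst_leaves_relabel: "subst_leaves f (relabel g t) = subst_leaves (\<lambda>j. f (g j)) t"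
  by (simp add: relabel_def subst_leaves_subst_leaves)

lemma relabel_relabel: "relabel f (relabel g t) = relabel (\<lambda>j. f (g j)) t"
  by (induction t) simp_all

lemma relabel_cong: "(\<And>j. j \<in> set (leaves t) \<Longrightarrow> f j = g j) \<Longrightarrow> relabel f t = relabel g t"
  unfolding relabel_def by (rule subst_leaves_cong) simp

lemma relabel_id [simp]: "relabel (\<lambda>j. j) t = t" "relabel id t = t"
  by (induction t) simp_all

lemma btreesD:
  assumes "t \<in> btrees X n"
  shows "labels t \<subseteq> X" "distinct (leaves t)" "set (leaves t) = {1..n}" "length (leaves t) = n" "1 \<le> n"
proof -
  show *: "labels t \<subseteq> X" "distinct (leaves t)" "set (leaves t) = {1..n}"
    using assms by (auto simp: btrees_def)
  show n: "length (leaves t) = n" using distinct_card[OF *(2)] *(3) by simp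
  have "leaves t \<noteq> []" by (induction t) simp_all
  then show "1 \<le> n" using n by (cases n) auto
qed

text \<open>Distinctness comes from counting: \<open>n\<close> leaves that cover \<open>n\<close>
  labels cannot repeat.\<close>

lemma btreesI:
  assumes "labels t \<subseteq> X" "set (leaves t) = {1..n}" "length (leaves t) = n"
  shows "t \<in> btrees X n"
  using assms card_distinct[of "leaves t"] by (simp add: btrees_def)

lemma relabel_btrees:
  assumes "\<sigma> permutes {1..n}" "t \<in> btrees X n"
  shows "relabel \<sigma> t \<in> btrees X n"
  using btreesD[OF assms(2)] permutes_image[OF assms(1)] by (intro btreesI) simp_all

text \<open>Kept as a constant so that the truncated subtraction stays closed during tree
  computations and is opened only for arithmetic.\<close>

definition offset :: "nat \<Rightarrow> nat \<Rightarrow> nat" where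
  "offset i k = i - 1 + k"

lemma graft_offset:
  "graft n i s t = subst_leaves (\<lambda>j. if j = i then relabel (offset i) t else Leaf (shift i n j)) s"
proof -
  have "offset i = (\<lambda>k. i - 1 + k)" by (simp add: fun_eq_iff offset_def)
  then show ?thesis unfolding graft_def by (simp only:)
qed

text \<open>The leaves of the graft are counted and shown to cover \<open>{1..m + n - 1}\<close>;
  \<open>btreesI\<close> then supplies distinctness.\<close>

lemma graft_btrees:
  assumes i: "i \<in> {1..m}" and s: "s \<in> btrees X m" and t: "t \<in> btrees X n"
  shows "graft n i s t \<in> btrees X (m + n - 1)"
proof (rule btreesI)
  note s = btreesD[OF s] and t = btreesD[OF t]
  let ?f = "\<lambda>j. if j = i then relabel (offset i) t else Leaf (shift i n j)"
  have "labels (?f j) \<subseteq> X" for j using t(1) by simp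
  then show "labels (graft n i s t) \<subseteq> X"
    using s(1) unfolding graft_offset labels_subst_leaves by blast
  have l: "leaves (graft n i s t) = concat (map (\<lambda>j. leaves (?f j)) (leaves s))"
    by (simp add: graft_offset leaves_subst_leaves)
  have "length (leaves (graft n i s t)) = (\<Sum>j\<leftarrow>leaves s. length (leaves (?f j)))"
    unfolding l by (simp add: length_concat comp_def)
  also have "\<dots> = (\<Sum>j\<in>{1..m}. length (leaves (?f j)))"
    using s by (simp add: sum_list_distinct_conv_sum_set)
  also have "\<dots> = n + (m - 1)"
    using i t(4) by (simp add: sum.remove)
  finally show "length (leaves (graft n i s t)) = m + n - 1" using i by simp
  have "set (leaves (graft n i s t)) = (\<Union>j\<in>{1..m}. set (leaves (?f j)))"
    unfolding l by (simp add: s)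
  also have "\<dots> = set (leaves (?f i)) \<union> (\<Union>j\<in>{1..m} - {i}. set (leaves (?f j)))" using i by blast
  also have "\<dots> = offset i ` {1..n} \<union> shift i n ` ({1..m} - {i})" using t(3) by auto
  also have "\<dots> = {1..m + n - 1}"
  proof
    show "{1..m + n - 1} \<subseteq> offset i ` {1..n} \<union> shift i n ` ({1..m} - {i})"
    proof
      fix l assume l: "l \<in> {1..m + n - 1}"
      consider "l < i" | "i \<le> l" "l < i + n" | "i + n \<le> l" by linarith
      then show "l \<in> offset i ` {1..n} \<union> shift i n ` ({1..m} - {i})"
      proof cases
        case 1
        then show ?thesis using i l by (intro UnI2 image_eqI[of _ _ l]) (auto simp: shift_def)
      next
        case 2
        then show ?thesis using i by (intro UnI1 image_eqI[of _ _ "l - i + 1"]) (auto simp: offset_def)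
      next
        case 3
        then show ?thesis using i l by (intro UnI2 image_eqI[of _ _ "l - n + 1"]) (auto simp: shift_def)
      qed
    qed
    have "offset i k \<in> {1..m + n - 1}" if "k \<in> {1..n}" for k
      using that i by (auto simp: offset_def)
    then show "offset i ` {1..n} \<union> shift i n ` ({1..m} - {i}) \<subseteq> {1..m + n - 1}"
      using shift_mem[OF i] by blast
  qed
  finally show "set (leaves (graft n i s t)) = {1..m + n - 1}" .
qed

text \<open>Compared at the leaves of \<open>s\<close>: at leaf \<open>i\<close> the two insertions
  nest and their offsets add up; at the other leaves the two shifts compose to the shift for a block
  of size \<open>m + n - 1\<close>.\<close>

lemma graft_sequential:
  assumes "i \<in> {1..l}" "j \<in> {1..m}" "s \<in> btrees X l" "t \<in> btrees X m" "u \<in> btrees X n"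
  shows "graft n (i - 1 + j) (graft m i s t) u = graft (m + n - 1) i s (graft n j t u)"
proof -
  let ?f = "\<lambda>b. if b = i - 1 + j then relabel (offset (i - 1 + j)) u else Leaf (shift (i - 1 + j) n b)"
  note s = btreesD[OF assms(3)] and t = btreesD[OF assms(4)] and u = btreesD[OF assms(5)]
  have "relabel (offset (i - 1 + j)) u = relabel (offset i) (relabel (offset j) u)"
    unfolding relabel_relabel by (rule relabel_cong) (use assms(1,2) in \<open>simp add: offset_def\<close>)
  moreover have "offset i b = i - 1 + j \<longleftrightarrow> b = j" "b \<noteq> j \<Longrightarrow> shift (i - 1 + j) n (offset i b) = offset i (shift j n b)"
    if "b \<in> {1..m}" for b
    using that assms(1,2) by (auto simp: offset_def shift_def)
  ultimately have 1: "subst_leaves ?f (relabel (offset i) t) = relabel (offset i) (graft n j t u)"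
    unfolding subst_leaves_relabel unfolding graft_offset relabel_def[of "offset i"] subst_leaves_subst_leaves
    using t(3) by (intro subst_leaves_cong) (simp add: relabel_def[of "offset i", symmetric])
  have 2: "?f (shift i m a) = Leaf (shift i (m + n - 1) a)" if "a \<in> {1..l}" "a \<noteq> i" for a
    using that assms(1,2) t(5) u(5) by (auto simp: shift_def)
  show ?thesis
    unfolding graft_offset[of n "i - 1 + j"] graft_offset[of m i] graft_offset[of "m + n - 1" i]
      subst_leaves_subst_leaves
  proof (rule subst_leaves_cong)
    fix a assume "a \<in> set (leaves s)"
    then have "a \<in> {1..l}" using s(3) by simp
    then show "subst_leaves ?f (if a = i then relabel (offset i) t else Leaf (shift i m a)) =
        (if a = i then relabel (offset i) (graft n j t u) else Leaf (shift i (m + n - 1) a))"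
      using 1 2[of a] by (cases "a = i") (simp_all only: if_True if_False subst_leaves.simps simp_thms not_False_eq_True)
  qed
qed

text \<open>The inserted blocks do not meet. A later insertion moves the other block as a whole or
  not at all, and the shifts of the remaining leaves commute.\<close>

lemma graft_parallel:
  assumes "1 \<le> i" "i < k" "k \<le> l" "s \<in> btrees X l" "t \<in> btrees X m" "u \<in> btrees X n"
  shows "graft n (k - 1 + m) (graft m i s t) u = graft m i (graft n k s u) t"
proof -
  let ?f = "\<lambda>b. if b = k - 1 + m then relabel (offset (k - 1 + m)) u else Leaf (shift (k - 1 + m) n b)"
  let ?g = "\<lambda>b. if b = i then relabel (offset i) t else Leaf (shift i m b)"
  note s = btreesD[OF assms(4)] and t = btreesD[OF assms(5)] and u = btreesD[OF assms(6)]
  have "offset i b \<noteq> k - 1 + m" "shift (k - 1 + m) n (offset i b) = offset i b" if "b \<in> {1..m}" for b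
    using that assms(1-3) by (auto simp: offset_def shift_def)
  then have 1: "subst_leaves ?f (relabel (offset i) t) = relabel (offset i) t"
    unfolding subst_leaves_relabel unfolding relabel_def
    using t(3) by (intro subst_leaves_cong) simp
  have "offset k b \<noteq> i" "shift i m (offset k b) = offset (k - 1 + m) b" if "b \<in> {1..n}" for b
    using that assms(1-3) t(5) by (auto simp: offset_def shift_def)
  then have 2: "subst_leaves ?g (relabel (offset k) u) = relabel (offset (k - 1 + m)) u"
    unfolding subst_leaves_relabel unfolding relabel_def
    using u(3) by (intro subst_leaves_cong) simp
  have 3: "shift i m k = k - 1 + m" "shift k n i = i" using assms(1-3) by (auto simp: shift_def)
  have 4: "?f (shift i m a) = ?g (shift k n a)" if "a \<in> {1..l}" "a \<noteq> i" "a \<noteq> k" for a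
    using that assms(1-3) t(5) u(5) by (auto simp: shift_def)
  show ?thesis
    unfolding graft_offset[of n "k - 1 + m"] graft_offset[of m i] graft_offset[of n k] subst_leaves_subst_leaves
  proof (rule subst_leaves_cong)
    fix a assume "a \<in> set (leaves s)"
    then have a: "a \<in> {1..l}" using s(3) by simp
    consider "a = i" | "a = k" | "a \<noteq> i" "a \<noteq> k" by blast
    then show "subst_leaves ?f (if a = i then relabel (offset i) t else Leaf (shift i m a)) =
        subst_leaves ?g (if a = k then relabel (offset k) u else Leaf (shift k n a))"
    proof cases
      case 1
      then show ?thesis
        using \<open>subst_leaves ?f (relabel (offset i) t) = _\<close> 3 assms(2)
        by (simp only: subst_leaves.simps if_True if_False simp_thms) simp
    next
      case 2
      then show ?thesis
        using \<open>subst_leaves ?g (relabel (offset k) u) = _\<close> 3 assms(2)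
        by (simp only: subst_leaves.simps if_True if_False simp_thms) simp
    next
      case neither: 3
      then show ?thesis using 4[OF a neither] by (simp only: subst_leaves.simps if_False simp_thms)
    qed
  qed
qed

text \<open>A right action relabels by inverses, so this is applied to inverse permutations, where
  \<open>inv_block_perm\<close> identifies the inverse of the block permutation.\<close>

lemma graft_equivariant:
  assumes i: "i \<in> {1..m}" and \<sigma>: "\<sigma> permutes {1..m}" and s: "s \<in> btrees X m" and t: "t \<in> btrees X n"
  shows "graft n (\<sigma> i) (relabel \<sigma> s) (relabel \<tau> t) = relabel (block_perm m n i \<sigma> \<tau>) (graft n i s t)"
proof -
  note s = btreesD[OF s] and t = btreesD[OF t]
  have inj: "\<sigma> j = \<sigma> i \<longleftrightarrow> j = i" for j using permutes_inj[OF \<sigma>] by (auto dest: injD)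
  have blk: "relabel (offset (\<sigma> i)) (relabel \<tau> t) = relabel (block_perm m n i \<sigma> \<tau>) (relabel (offset i) t)"
    unfolding relabel_relabel
    by (rule relabel_cong) (use t block_perm_block[OF i, of _ n \<sigma> \<tau>] in \<open>simp add: offset_def\<close>)
  have sh: "Leaf (shift (\<sigma> i) n (\<sigma> j)) = relabel (block_perm m n i \<sigma> \<tau>) (Leaf (shift i n j))"
    if "j \<in> {1..m}" "j \<noteq> i" for j
    using block_perm_shift[OF i that] by simp
  show ?thesis
    unfolding graft_offset subst_leaves_relabel
    unfolding relabel_def[of "block_perm m n i \<sigma> \<tau>"] subst_leaves_subst_leaves
  proof (rule subst_leaves_cong)
    fix j assume "j \<in> set (leaves s)"
    then have "j \<in> {1..m}" using s(3) by simp
    then show "(if \<sigma> j = \<sigma> i then relabel (offset (\<sigma> i)) (relabel \<tau> t) else Leaf (shift (\<sigma> i) n (\<sigma> j))) =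
        subst_leaves (\<lambda>j. Leaf (block_perm m n i \<sigma> \<tau> j))
          (if j = i then relabel (offset i) t else Leaf (shift i n j))"
      using blk sh[of j] unfolding inj relabel_def[of "block_perm m n i \<sigma> \<tau>"]
      by metis
  qed
qed

lemma graft_unit: "graft n 1 (Leaf 1) t = t"
  using relabel_cong[of t "offset 1" "\<lambda>k. k"] by (simp add: graft_offset offset_def)

text \<open>The composition of \<open>tree_operad\<close> with the sum over \<open>q\<close>
  absorbed into \<open>pushforward\<close>, from which it inherits linearity in
  \<open>q\<close>.\<close>

definition tree_comp ::
  "nat \<Rightarrow> nat \<Rightarrow> ('v btree \<Rightarrow>\<^sub>0 'k::field) \<Rightarrow> ('v btree \<Rightarrow>\<^sub>0 'k) \<Rightarrow> 'v btree \<Rightarrow>\<^sub>0 'k" where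
  "tree_comp n i p q = (\<Sum>s\<in>keys p. scale (lookup p s) (pushforward (graft n i s) q))"

lemma scale_sum: "scale c (sum f A) = (\<Sum>x\<in>A. scale c (f x))"
  by (induction A rule: infinite_finite_induct) (simp_all add: scale_add)

lemma scale_add_left: "scale (a + b) p = scale a p + scale b p"
  by (rule poly_mapping_eqI) (simp add: lookup_add distrib_right)

lemma scale_scale [simp]: "scale a (scale b p) = scale (a * b) p"
  by (rule poly_mapping_eqI) simp

lemma scale_zero_left [simp]: "scale 0 p = 0"
  by (rule poly_mapping_eqI) simp

lemma scale_one [simp]: "scale 1 p = p"
  by (rule poly_mapping_eqI) simp

lemma tree_comp_superset:
  assumes "finite A" "keys p \<subseteq> A"
  shows "tree_comp n i p q = (\<Sum>s\<in>A. scale (lookup p s) (pushforward (graft n i s) q))"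
  unfolding tree_comp_def using assms by (intro sum.mono_neutral_left) (auto simp: in_keys_iff)

lemma tree_comp_zero [simp]: "tree_comp n i 0 q = 0" "tree_comp n i p 0 = 0"
  by (simp_all add: tree_comp_def)

lemma tree_comp_single:
  "tree_comp n i (single s c) q = scale c (pushforward (graft n i s) q)"
  by (simp add: tree_comp_superset[of "{s}"])

lemma tree_comp_add:
  "tree_comp n i (p + p') q = tree_comp n i p q + tree_comp n i p' q"
  "tree_comp n i p (q + q') = tree_comp n i p q + tree_comp n i p q'"
proof -
  show "tree_comp n i (p + p') q = tree_comp n i p q + tree_comp n i p' q"
    using Poly_Mapping.keys_add[of p p']
    by (simp add: tree_comp_superset[of "keys p \<union> keys p'"] lookup_add
        scale_add_left sum.distrib)
  show "tree_comp n i p (q + q') = tree_comp n i p q + tree_comp n i p q'"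
    by (simp add: tree_comp_def pushforward_add scale_add sum.distrib)
qed

lemma tree_comp_scale:
  "tree_comp n i (scale c p) q = scale c (tree_comp n i p q)"
  "tree_comp n i p (scale c q) = scale c (tree_comp n i p q)"
proof -
  show "tree_comp n i (scale c p) q = scale c (tree_comp n i p q)"
    using tree_comp_superset[OF _ keys_scale[of c p]] by (simp add: tree_comp_def scale_sum)
  show "tree_comp n i p (scale c q) = scale c (tree_comp n i p q)"
    by (simp add: tree_comp_def scale_sum pushforward_scale mult.commute)
qed

lemma tree_comp_single_right:
  "tree_comp n i p (single t c) = scale c (pushforward (\<lambda>s. graft n i s t) p)"
  using subset_UNIV[of "keys p"]
proof (induction rule: free_space_induct)
  case (single s a)
  show ?case by (simp add: tree_comp_single) (simp only: mult.commute)
qed (simp_all add: tree_comp_add pushforward_add scale_add)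

lemma tree_operad_simps:
  "arity (tree_operad X) n = free_space (btrees X n)"
  "act (tree_operad X) n \<sigma> = pushforward (relabel (inv_into UNIV \<sigma>))"
  "pcomp (tree_operad X) m n i p q = tree_comp n i p q"
  "unit (tree_operad X) = single (Leaf 1) 1"
proof -
  have "(\<Sum>t\<in>A. single (graft n i s t) (c * lookup q t)) =
      scale c (\<Sum>t\<in>A. single (graft n i s t) (lookup q t))" for A s c
    by (induction A rule: infinite_finite_induct) (simp_all add: scale_add)
  then show "pcomp (tree_operad X) m n i p q = tree_comp n i p q"
    by (simp add: tree_operad_def tree_comp_def pushforward_def)
qed (simp_all add: tree_operad_def)

lemma keys_tree_comp:
  assumes i: "i \<in> {1..m}" and p: "keys p \<subseteq> btrees X m" and q: "keys q \<subseteq> btrees X n"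
  shows "keys (tree_comp n i p q) \<subseteq> btrees X (m + n - 1)"
  using p
proof (induction rule: free_space_induct)
  case (single s c)
  have "keys (pushforward (graft n i s) q) \<subseteq> btrees X (m + n - 1)"
    by (rule keys_pushforward_subset[OF q]) (rule graft_btrees[OF i single])
  then show ?case by (simp add: tree_comp_single keys_subsetI)
qed (simp_all add: tree_comp_add keys_subsetI)

text \<open>The composition and equivariance axioms are multilinear, so nested inductions on the
  arguments reduce them to the grafting laws for single trees.\<close>

lemma operad_tree_operad: "operad (tree_operad X :: ('k::field, 'v btree \<Rightarrow>\<^sub>0 'k) operad_data)"
proof (rule operad.intro, unfold tree_operad_simps)
  fix \<sigma> :: "nat \<Rightarrow> nat" and n assume \<sigma>: "\<sigma> permutes {1..n}"
  show "is_linear (free_space (btrees X n)) (free_space (btrees X n)) (pushforward (relabel (inv_into UNIV \<sigma>)))"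
    by (rule linear_map_pushforward) (rule relabel_btrees[OF permutes_inv[OF \<sigma>]])
  fix \<tau> p assume \<tau>: "\<tau> permutes {1..n}"
  show "pushforward (relabel (inv_into UNIV \<tau>)) (pushforward (relabel (inv_into UNIV \<sigma>)) p)
      = pushforward (relabel (inv_into UNIV (\<sigma> \<circ> \<tau>))) p"
    unfolding pushforward_pushforward relabel_relabel
    using o_inv_distrib[OF permutes_bij[OF \<sigma>] permutes_bij[OF \<tau>]] by (simp add: comp_def)
next
  show "pushforward (relabel (inv_into UNIV id)) p = p" for p :: "'v btree \<Rightarrow>\<^sub>0 'k"
    using pushforward_cong[of p "relabel id" "\<lambda>t. t"] by simp
next
  fix i m n :: nat and q :: "'v btree \<Rightarrow>\<^sub>0 'k"
  assume "i \<in> {1..m}" "q \<in> carrier (free_space (btrees X n))"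
  then show "is_linear (free_space (btrees X m)) (free_space (btrees X (m + n - 1))) (\<lambda>p. tree_comp n i p q)"
    by (intro linear_map_from_free_spaceI)
      (simp_all add: vectorspace_free_space tree_comp_add tree_comp_scale keys_tree_comp del: One_nat_def)
next
  fix i m n :: nat and p :: "'v btree \<Rightarrow>\<^sub>0 'k"
  assume "i \<in> {1..m}" "p \<in> carrier (free_space (btrees X m))"
  then show "is_linear (free_space (btrees X n)) (free_space (btrees X (m + n - 1))) (tree_comp n i p)"
    by (intro linear_map_from_free_spaceI)
      (simp_all add: vectorspace_free_space tree_comp_add tree_comp_scale keys_tree_comp del: One_nat_def)
next
  show "single (Leaf 1) 1 \<in> carrier (free_space (btrees X 1))"
    by (simp add: btrees_def)
next
  fix q :: "'v btree \<Rightarrow>\<^sub>0 'k" and n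
  show "tree_comp n 1 (single (Leaf 1) 1) q = q"
    unfolding tree_comp_single
    using pushforward_cong[of q "graft n 1 (Leaf 1)" "\<lambda>t. t"] by (simp add: graft_unit del: One_nat_def)
next
  fix i m and p :: "'v btree \<Rightarrow>\<^sub>0 'k"
  assume i: "i \<in> {1..m}" and p: "p \<in> carrier (free_space (btrees X m))"
  have "graft 1 i s (Leaf 1) = s" for s :: "'v btree"
    using i unfolding graft_def by (subst (2) subst_leaves_Leaf[symmetric], intro subst_leaves_cong) (auto simp: shift_def)
  then show "tree_comp 1 i p (single (Leaf 1) 1) = p"
    by (simp add: tree_comp_single_right)
next
  fix i l j m n and p q r :: "'v btree \<Rightarrow>\<^sub>0 'k"
  assume i: "i \<in> {1..l}" and j: "j \<in> {1..m}" and "p \<in> carrier (free_space (btrees X l))"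
    "q \<in> carrier (free_space (btrees X m))" "r \<in> carrier (free_space (btrees X n))"
  then have p: "keys p \<subseteq> btrees X l" and q: "keys q \<subseteq> btrees X m"
    and r: "keys r \<subseteq> btrees X n" by simp_all
  show "tree_comp n (i - 1 + j) (tree_comp m i p q) r = tree_comp (m + n - 1) i p (tree_comp n j q r)"
    using p
  proof (induction rule: free_space_induct)
    case (single s a)
    show ?case
      using q
    proof (induction rule: free_space_induct)
      case (single t b)
      show ?case
        using r
        by (induction rule: free_space_induct)
          (simp_all add: tree_comp_single tree_comp_add pushforward_add scale_add mult.assoc
            graft_sequential[OF i j \<open>s \<in> btrees X l\<close> single] del: One_nat_def)
    qed (simp_all add: tree_comp_add)
  qed (simp_all add: tree_comp_add)
next
  fix i k l m n :: nat and p q r :: "'v btree \<Rightarrow>\<^sub>0 'k"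
  assume i: "1 \<le> i" "i < k" "k \<le> l" and "p \<in> carrier (free_space (btrees X l))"
    "q \<in> carrier (free_space (btrees X m))" "r \<in> carrier (free_space (btrees X n))"
  then have p: "keys p \<subseteq> btrees X l" and q: "keys q \<subseteq> btrees X m"
    and r: "keys r \<subseteq> btrees X n" by simp_all
  show "tree_comp n (k - 1 + m) (tree_comp m i p q) r = tree_comp m i (tree_comp n k p r) q"
    using p
  proof (induction rule: free_space_induct)
    case (single s a)
    show ?case
      using q
    proof (induction rule: free_space_induct)
      case (single t b)
      show ?case
        using r
      proof (induction rule: free_space_induct)
        case (single u c)
        show ?case
          by (simp add: tree_comp_single graft_parallel[OF i \<open>s \<in> btrees X l\<close> \<open>t \<in> btrees X m\<close> single] del: One_nat_def)
            (simp only: ac_simps)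
      qed (simp_all add: tree_comp_add)
    qed (simp_all add: tree_comp_add)
  qed (simp_all add: tree_comp_add)
next
  fix i m n :: nat and \<sigma> \<tau> and p q :: "'v btree \<Rightarrow>\<^sub>0 'k"
  assume i: "i \<in> {1..m}" and \<sigma>: "\<sigma> permutes {1..m}" and \<tau>: "\<tau> permutes {1..n}"
    and "p \<in> carrier (free_space (btrees X m))" "q \<in> carrier (free_space (btrees X n))"
  then have p: "keys p \<subseteq> btrees X m" and q: "keys q \<subseteq> btrees X n" by simp_all
  have \<sigma>i: "\<sigma> i \<in> {1..m}" using permutes_in_image[OF \<sigma>] i by blast
  have graft: "graft n i (relabel (inv_into UNIV \<sigma>) s) (relabel (inv_into UNIV \<tau>) t) =
      relabel (inv_into UNIV (block_perm m n i \<sigma> \<tau>)) (graft n (\<sigma> i) s t)"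
    if "s \<in> btrees X m" "t \<in> btrees X n" for s t
    using graft_equivariant[OF \<sigma>i permutes_inv[OF \<sigma>] that, of "inv_into UNIV \<tau>"]
    by (simp add: inv_block_perm[OF i \<sigma> \<tau>] permutes_inverses(2)[OF \<sigma>])
  show "tree_comp n i (pushforward (relabel (inv_into UNIV \<sigma>)) p) (pushforward (relabel (inv_into UNIV \<tau>)) q) =
      pushforward (relabel (inv_into UNIV (block_perm m n i \<sigma> \<tau>))) (tree_comp n (\<sigma> i) p q)"
    using p
  proof (induction rule: free_space_induct)
    case (single s a)
    show ?case
      using q
      by (induction rule: free_space_induct)
        (simp_all add: tree_comp_single tree_comp_add pushforward_add scale_add graft[OF single])
  qed (simp_all add: tree_comp_add pushforward_add)
qed

section \<open>The free operad\<close>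

text \<open>A vertex relation puts no condition on the subtrees of its vertex, so substitution at
  the leaves keeps its shape. This covers both relabelling and grafting onto the trees of a
  relation.\<close>

lemma vertex_relations_subst_leaves:
  "r \<in> vertex_relations V \<Longrightarrow> pushforward (subst_leaves f) r \<in> vertex_relations V"
proof (induction rule: vertex_relations.induct)
  case (left r x t)
  from vertex_relations.left[OF left.IH, of x "subst_leaves f t"] show ?case
    by (simp add: pushforward_pushforward)
next
  case (right r x s)
  from vertex_relations.right[OF right.IH, of x "subst_leaves f s"] show ?case
    by (simp add: pushforward_pushforward)
qed (auto simp: pushforward_simps intro: vertex_relations.intros)

text \<open>Here the relation is plugged into a fixed tree. Because leaf \<open>i\<close> occurs
  only once, the rules \<open>left\<close> and \<open>right\<close> follow the path to it, and the
  tree does not vary off that path.\<close>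

lemma vertex_relations_graft:
  assumes r: "r \<in> vertex_relations V" and "distinct (leaves s)" "i \<in> set (leaves s)"
  shows "pushforward (\<lambda>t. subst_leaves (\<lambda>j. if j = i then relabel g t else f j) s) r \<in> vertex_relations V"
  using assms(2,3)
proof (induction s)
  case (Leaf j)
  then show ?case using vertex_relations_subst_leaves[OF r, of "\<lambda>j. Leaf (g j)"] by (simp add: relabel_def)
next
  case (Node v a b)
  let ?h = "\<lambda>t. subst_leaves (\<lambda>j. if j = i then relabel g t else f j)"
  have const: "?h t c = subst_leaves f c" if "i \<notin> set (leaves c)" for t c
    using that by (intro subst_leaves_cong) auto
  show ?case
  proof (cases "i \<in> set (leaves a)")
    case True
    then have "i \<notin> set (leaves b)" using Node.prems by auto
    with True show ?thesis
      using vertex_relations.left[OF Node.IH(1), of v "subst_leaves f b"] Node.prems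
      by (simp add: pushforward_pushforward const)
  next
    case False
    then show ?thesis
      using vertex_relations.right[OF Node.IH(2), of v "subst_leaves f a"] Node.prems
      by (simp add: pushforward_pushforward const)
  qed
qed

lemma submodule_tree_relations: "is_subspace (tree_relations V n) (free_space (btrees (carrier V) n))"
  unfolding tree_relations_def by (rule submodule_lin_span[OF vectorspace_free_space]) simp

lemma vertex_relations_subset_tree_relations:
  "r \<in> vertex_relations V \<Longrightarrow> keys r \<subseteq> btrees (carrier V) n \<Longrightarrow> r \<in> tree_relations V n"
  unfolding tree_relations_def
  by (rule subsetD[OF lin_span_superset[OF vectorspace_free_space]]) auto

lemma tree_relations_image:
  assumes "is_linear (free_space (btrees (carrier V) n)) U f" "is_subspace N U"
    and "\<And>r. r \<in> vertex_relations V \<Longrightarrow> keys r \<subseteq> btrees (carrier V) n \<Longrightarrow> f r \<in> N"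
    and "r \<in> tree_relations V n"
  shows "f r \<in> N"
  using assms(4) unfolding tree_relations_def
  by (rule lin_span_image[OF assms(1,2), rotated 2]) (use assms(3) in auto)

lemma operad_ideal_tree_relations:
  fixes V :: "('k::field, 'v) s2module"
  shows "operad_ideal (tree_operad (carrier V)) (tree_relations V)"
proof (rule operad_idealI, unfold tree_operad_simps)
  interpret T: operad "tree_operad (carrier V) :: ('k, 'v btree \<Rightarrow>\<^sub>0 'k) operad_data"
    by (rule operad_tree_operad)
  show "is_subspace (tree_relations V n) (free_space (btrees (carrier V) n))" for n
    by (rule submodule_tree_relations)
  show "pushforward (relabel (inv_into UNIV \<sigma>)) r \<in> tree_relations V n"
    if \<sigma>: "\<sigma> permutes {1..n}" and r: "r \<in> tree_relations V n" for n \<sigma> r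
  proof (rule tree_relations_image[OF T.act_linear[OF \<sigma>, unfolded tree_operad_simps] submodule_tree_relations _ r])
    fix r assume r: "r \<in> vertex_relations V" "keys r \<subseteq> btrees (carrier V) n"
    have "pushforward (relabel (inv_into UNIV \<sigma>)) r \<in> vertex_relations V"
      unfolding relabel_def by (rule vertex_relations_subst_leaves[OF r(1)])
    then show "pushforward (relabel (inv_into UNIV \<sigma>)) r \<in> tree_relations V n"
      by (rule vertex_relations_subset_tree_relations)
        (rule keys_pushforward_subset[OF r(2) relabel_btrees[OF permutes_inv[OF \<sigma>]]])
  qed
  show "tree_comp n i r q \<in> tree_relations V (m + n - 1)"
    if i: "i \<in> {1..m}" and r: "r \<in> tree_relations V m" and q: "q \<in> carrier (free_space (btrees (carrier V) n))"
    for m n i r q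
  proof (rule tree_relations_image[OF T.pcomp_linear_left[OF i, unfolded tree_operad_simps, OF q]
        submodule_tree_relations _ r])
    fix r assume r: "r \<in> vertex_relations V" "keys r \<subseteq> btrees (carrier V) m"
    from q have "keys q \<subseteq> btrees (carrier V) n" by simp
    then show "tree_comp n i r q \<in> tree_relations V (m + n - 1)"
    proof (induction rule: free_space_induct)
      case zero
      then show ?case using submoduleD(3)[OF submodule_tree_relations] by simp
    next
      case (single t c)
      have "pushforward (\<lambda>s. graft n i s t) r \<in> vertex_relations V"
        unfolding graft_def by (rule vertex_relations_subst_leaves[OF r(1)])
      then have "pushforward (\<lambda>s. graft n i s t) r \<in> tree_relations V (m + n - 1)"
        by (rule vertex_relations_subset_tree_relations)
          (rule keys_pushforward_subset[OF r(2) graft_btrees[OF i _ single]])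
      then show ?case
        using submoduleD(6)[OF submodule_tree_relations] by (simp add: tree_comp_single_right)
    next
      case (add p q)
      then show ?case
        using submoduleD(5)[OF submodule_tree_relations] by (simp add: tree_comp_add)
    qed
  qed
  show "tree_comp n i p r \<in> tree_relations V (m + n - 1)"
    if i: "i \<in> {1..m}" and p: "p \<in> carrier (free_space (btrees (carrier V) m))" and r: "r \<in> tree_relations V n"
    for m n i p r
  proof (rule tree_relations_image[OF T.pcomp_linear_right[OF i, unfolded tree_operad_simps, OF p]
        submodule_tree_relations _ r])
    fix r assume r: "r \<in> vertex_relations V" "keys r \<subseteq> btrees (carrier V) n"
    from p have "keys p \<subseteq> btrees (carrier V) m" by simp
    then show "tree_comp n i p r \<in> tree_relations V (m + n - 1)"
    proof (induction rule: free_space_induct)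
      case zero
      then show ?case using submoduleD(3)[OF submodule_tree_relations] by simp
    next
      case (single s c)
      have "pushforward (graft n i s) r \<in> vertex_relations V"
        unfolding graft_def[abs_def] using btreesD[OF single] i by (intro vertex_relations_graft r) auto
      then have "pushforward (graft n i s) r \<in> tree_relations V (m + n - 1)"
        by (rule vertex_relations_subset_tree_relations)
          (rule keys_pushforward_subset[OF r(2) graft_btrees[OF i single]])
      then show ?case
        using submoduleD(6)[OF submodule_tree_relations] by (simp add: tree_comp_single)
    next
      case (add p q)
      then show ?case
        using submoduleD(5)[OF submodule_tree_relations] by (simp add: tree_comp_add)
    qed
  qed
qed

lemma operad_free_operad: "operad (free_operad V)"
  unfolding free_operad_def by (rule operad_quotient_operad[OF operad_tree_operad operad_ideal_tree_relations])

lemma arity_free_operad: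
  "arity (free_operad V) n = quotient_space (free_space (btrees (carrier V) n)) (tree_relations V n)"
  by (simp add: free_operad_def quotient_operad_simps tree_operad_simps)

lemma carrier_free_operad:
  "carrier (arity (free_operad V) n) = tree_class V n ` {p. keys p \<subseteq> btrees (carrier V) n}"
  unfolding arity_free_operad carrier_quotient_space[OF submodule_tree_relations] tree_class_def by auto

lemma linear_map_tree_class:
  "is_linear (free_space (btrees (carrier V) n)) (arity (free_operad V) n) (tree_class V n)"
  unfolding arity_free_operad tree_class_def by (rule linear_map_coset[OF submodule_tree_relations])

lemma tree_class_eq_iff:
  assumes "keys p \<subseteq> btrees (carrier V) n" "keys q \<subseteq> btrees (carrier V) n"
  shows "tree_class V n p = tree_class V n q \<longleftrightarrow> p - q \<in> tree_relations V n"
  unfolding tree_class_def using coset_eq_iff[OF submodule_tree_relations, of p V n q] assms by simp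

lemma act_tree_class:
  assumes "\<sigma> permutes {1..n}" "keys p \<subseteq> btrees (carrier V) n"
  shows "act (free_operad V) n \<sigma> (tree_class V n p) = tree_class V n (pushforward (relabel (inv_into UNIV \<sigma>)) p)"
  using act_quotient_operad[OF operad_tree_operad operad_ideal_tree_relations assms(1), of p V] assms(2)
  unfolding free_operad_def tree_class_def tree_operad_simps by simp

subsection \<open>Functoriality\<close>

lemma leaves_map_btree [simp]: "leaves (map_btree \<phi> t) = leaves t"
  by (induction t) simp_all

lemma map_btree_btrees: "t \<in> btrees X n \<Longrightarrow> (\<And>x. x \<in> X \<Longrightarrow> \<phi> x \<in> Y) \<Longrightarrow> map_btree \<phi> t \<in> btrees Y n"
  by (auto simp: btrees_def btree.set_map)

lemma map_btree_subst_leaves: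
  "map_btree \<phi> (subst_leaves f t) = subst_leaves (\<lambda>j. map_btree \<phi> (f j)) (map_btree \<phi> t)"
  by (induction t) simp_all

lemma map_btree_relabel: "map_btree \<phi> (relabel g t) = relabel g (map_btree \<phi> t)"
  by (induction t) simp_all

lemma map_btree_graft: "map_btree \<phi> (graft n i s t) = graft n i (map_btree \<phi> s) (map_btree \<phi> t)"
  unfolding graft_def map_btree_subst_leaves
  by (intro subst_leaves_cong) (simp add: map_btree_relabel)

lemma map_btree_map_btree_id:
  assumes "t \<in> btrees X n" "\<And>x. x \<in> X \<Longrightarrow> \<psi> (\<phi> x) = x"
  shows "map_btree \<psi> (map_btree \<phi> t) = t"
proof -
  have "map_btree (\<lambda>x. \<psi> (\<phi> x)) t = map_btree (\<lambda>x. x) t"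
    by (rule btree.map_cong0) (use assms btreesD(1) in blast)
  then show ?thesis by (simp add: btree.map_comp comp_def btree.map_ident)
qed

lemma pushforward_map_btree_id:
  assumes "keys p \<subseteq> btrees X n" "\<And>x. x \<in> X \<Longrightarrow> \<psi> (\<phi> x) = x"
  shows "pushforward (map_btree \<psi>) (pushforward (map_btree \<phi>) p) = p"
proof -
  have "pushforward (\<lambda>t. map_btree \<psi> (map_btree \<phi> t)) p = pushforward (\<lambda>t. t) p"
  proof (rule pushforward_cong)
    fix t assume "t \<in> keys p"
    then show "map_btree \<psi> (map_btree \<phi> t) = t"
      using assms(1) by (intro map_btree_map_btree_id[of t X n] assms(2)) auto
  qed
  then show ?thesis by (simp add: pushforward_pushforward)
qed

lemma operad_iso_tree_operad:
  assumes \<phi>: "\<And>x. x \<in> X \<Longrightarrow> \<phi> x \<in> Y" and \<psi>: "\<And>y. y \<in> Y \<Longrightarrow> \<psi> y \<in> X"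
    and inv: "\<And>x. x \<in> X \<Longrightarrow> \<psi> (\<phi> x) = x" "\<And>y. y \<in> Y \<Longrightarrow> \<phi> (\<psi> y) = y"
  shows "operad_iso (tree_operad X :: ('k::field, _) operad_data) (tree_operad Y) (\<lambda>n. pushforward (map_btree \<phi>))"
  unfolding operad_iso_def tree_operad_simps
proof (intro conjI allI impI ballI)
  show "is_linear (free_space (btrees X n) :: ('k, _) module) (free_space (btrees Y n)) (pushforward (map_btree \<phi>))" for n
    by (rule linear_map_pushforward) (rule map_btree_btrees[OF _ \<phi>])
  show "bij_betw (pushforward (map_btree \<phi>)) (carrier (free_space (btrees X n) :: ('k, _) module)) (carrier (free_space (btrees Y n)))" for n
  proof (rule bij_betwI)
    show "pushforward (map_btree \<phi>) \<in> carrier (free_space (btrees X n) :: ('k, _) module) \<rightarrow> carrier (free_space (btrees Y n))"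
      by (simp add: Pi_def keys_pushforward_subset[OF _ map_btree_btrees[OF _ \<phi>]])
    show "pushforward (map_btree \<psi>) \<in> carrier (free_space (btrees Y n) :: ('k, _) module) \<rightarrow> carrier (free_space (btrees X n))"
      by (simp add: Pi_def keys_pushforward_subset[OF _ map_btree_btrees[OF _ \<psi>]])
  qed (simp_all add: pushforward_map_btree_id[where X = X and \<phi> = \<phi>, OF _ inv(1)]
      pushforward_map_btree_id[where X = Y and \<phi> = \<psi>, OF _ inv(2)])
  show "pushforward (map_btree \<phi>) (pushforward (relabel (inv_into UNIV \<sigma>)) p) =
      pushforward (relabel (inv_into UNIV \<sigma>)) (pushforward (map_btree \<phi>) p)" for \<sigma> and p :: "'a btree \<Rightarrow>\<^sub>0 'k"
    by (simp add: pushforward_pushforward map_btree_relabel)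
  show "pushforward (map_btree \<phi>) (tree_comp n i p q) =
      tree_comp n i (pushforward (map_btree \<phi>) p) (pushforward (map_btree \<phi>) q)" for n i and p q :: "'a btree \<Rightarrow>\<^sub>0 'k"
    using subset_UNIV[of "keys p"]
    by (induction rule: free_space_induct)
      (simp_all add: tree_comp_single tree_comp_add pushforward_add pushforward_scale pushforward_pushforward
        map_btree_graft)
qed simp

lemma vertex_relations_map_btree:
  assumes \<phi>: "is_linear V W \<phi>" "\<And>x. x \<in> carrier V \<Longrightarrow> \<phi> (swap V x) = swap W (\<phi> x)"
    and r: "r \<in> vertex_relations V"
  shows "pushforward (map_btree \<phi>) r \<in> vertex_relations W"
  using r
proof (induction rule: vertex_relations.induct)
  case (left r x t)
  from vertex_relations.left[OF left.IH, of "\<phi> x" "map_btree \<phi> t"] show ?case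
    by (simp add: pushforward_pushforward)
next
  case (right r x s)
  from vertex_relations.right[OF right.IH, of "\<phi> x" "map_btree \<phi> s"] show ?case
    by (simp add: pushforward_pushforward)
qed (auto simp: pushforward_simps linear_mapD[OF \<phi>(1)] \<phi>(2) intro: vertex_relations.intros)

lemma tree_relations_map_btree:
  assumes \<phi>: "is_linear V W \<phi>" "\<And>x. x \<in> carrier V \<Longrightarrow> \<phi> (swap V x) = swap W (\<phi> x)"
    and r: "r \<in> tree_relations V n"
  shows "pushforward (map_btree \<phi>) r \<in> tree_relations W n"
proof (rule tree_relations_image[OF _ submodule_tree_relations _ r])
  have *: "map_btree \<phi> t \<in> btrees (carrier W) n" if "t \<in> btrees (carrier V) n" for t
    by (rule map_btree_btrees[OF that linear_mapD(3)[OF \<phi>(1)]])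
  show "is_linear (free_space (btrees (carrier V) n)) (free_space (btrees (carrier W) n)) (pushforward (map_btree \<phi>))"
    by (rule linear_map_pushforward[OF *])
  show "pushforward (map_btree \<phi>) r \<in> tree_relations W n"
    if "r \<in> vertex_relations V" "keys r \<subseteq> btrees (carrier V) n" for r
    by (intro vertex_relations_subset_tree_relations vertex_relations_map_btree[OF \<phi>] that
        keys_pushforward_subset[OF that(2)] *)
qed

definition free_map ::
  "('k::field, 'w) s2module \<Rightarrow> ('v \<Rightarrow> 'w) \<Rightarrow> nat \<Rightarrow> ('v btree \<Rightarrow>\<^sub>0 'k) set \<Rightarrow> ('w btree \<Rightarrow>\<^sub>0 'k) set" where
  "free_map W \<phi> n = coset_map (free_space (btrees (carrier W) n)) (tree_relations W n) (pushforward (map_btree \<phi>))"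

lemma
  assumes \<phi>: "is_linear V W \<phi>" "\<And>x. x \<in> carrier V \<Longrightarrow> \<phi> (swap V x) = swap W (\<phi> x)"
  shows free_map_tree_class: "keys p \<subseteq> btrees (carrier V) n \<Longrightarrow>
      free_map W \<phi> n (tree_class V n p) = tree_class W n (pushforward (map_btree \<phi>) p)"
    and linear_map_free_map: "is_linear (arity (free_operad V) n) (arity (free_operad W) n) (free_map W \<phi> n)"
proof -
  have *: "map_btree \<phi> t \<in> btrees (carrier W) n" if "t \<in> btrees (carrier V) n" for t
    by (rule map_btree_btrees[OF that linear_mapD(3)[OF \<phi>(1)]])
  note c = submodule_tree_relations submodule_tree_relations linear_map_pushforward[OF *]
    tree_relations_map_btree[OF \<phi>]
  show "free_map W \<phi> n (tree_class V n p) = tree_class W n (pushforward (map_btree \<phi>) p)"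
    if "keys p \<subseteq> btrees (carrier V) n"
    unfolding free_map_def tree_class_def by (rule coset_map_coset[OF c]) (use that in simp_all)
  show "is_linear (arity (free_operad V) n) (arity (free_operad W) n) (free_map W \<phi> n)"
    unfolding free_map_def arity_free_operad by (rule linear_map_coset_map[OF c])
qed

text \<open>The isomorphism of tree operads matches the tree relations exactly, since
  \<open>\<psi>\<close> supplies preimages that are again relations.\<close>

lemma operad_iso_free_operad:
  assumes \<phi>: "is_linear V W \<phi>" "\<And>x. x \<in> carrier V \<Longrightarrow> \<phi> (swap V x) = swap W (\<phi> x)"
    and \<psi>: "is_linear W V \<psi>" "\<And>x. x \<in> carrier W \<Longrightarrow> \<psi> (swap W x) = swap V (\<psi> x)"
    and inv: "\<And>x. x \<in> carrier V \<Longrightarrow> \<psi> (\<phi> x) = x" "\<And>y. y \<in> carrier W \<Longrightarrow> \<phi> (\<psi> y) = y"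
  shows "operad_iso (free_operad V) (free_operad W) (free_map W \<phi>)"
proof -
  have iso: "operad_iso (tree_operad (carrier V) :: ('a, _) operad_data) (tree_operad (carrier W)) (\<lambda>n. pushforward (map_btree \<phi>))"
    by (rule operad_iso_tree_operad[of _ _ _ \<psi>]) (use linear_mapD(3)[OF \<phi>(1)] linear_mapD(3)[OF \<psi>(1)] inv in auto)
  have "pushforward (map_btree \<phi>) ` tree_relations V n = tree_relations W n" for n
  proof
    show "pushforward (map_btree \<phi>) ` tree_relations V n \<subseteq> tree_relations W n"
      using tree_relations_map_btree[OF \<phi>] by blast
    show "tree_relations W n \<subseteq> pushforward (map_btree \<phi>) ` tree_relations V n"
    proof
      fix r assume r: "r \<in> tree_relations W n"
      then have "keys r \<subseteq> btrees (carrier W) n"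
        using submoduleD(4)[OF submodule_tree_relations r] by simp
      then have "r = pushforward (map_btree \<phi>) (pushforward (map_btree \<psi>) r)"
        by (intro pushforward_map_btree_id[where X = "carrier W", symmetric] inv(2))
      then show "r \<in> pushforward (map_btree \<phi>) ` tree_relations V n"
        using tree_relations_map_btree[OF \<psi> r] by (rule image_eqI)
    qed
  qed
  from operad_iso_quotient_operad[OF operad_tree_operad operad_tree_operad iso operad_ideal_tree_relations
      operad_ideal_tree_relations this]
  show ?thesis unfolding free_operad_def free_map_def[abs_def] tree_operad_simps .
qed

lemma operad_operad_of:
  assumes "\<And>n. rels P n \<subseteq> carrier (arity (free_operad (gens P)) n)"
  shows "operad (operad_of P)"
  unfolding operad_of_def
  by (intro operad_quotient_operad operad_free_operad operad_ideal_generated_ideal assms)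

section \<open>Representations of the symmetric group on two letters\<close>

lemma with_swap_simps [simp]:
  "carrier (with_swap M f) = carrier M" "add (with_swap M f) = add M" "zero (with_swap M f) = zero M"
  "smult (with_swap M f) = smult M" "swap (with_swap M f) = f"
  by (simp_all add: with_swap_def module.extend_def s2module.fields_def)

lemma vectorspace_with_swap [simp]: "is_space (with_swap M f) \<longleftrightarrow> is_space M"
  by (auto elim: vectorspace_cong)

lemma linear_map_with_swap [simp]:
  "is_linear (with_swap M f) W g \<longleftrightarrow> is_linear M W g"
  "is_linear V (with_swap M f) h \<longleftrightarrow> is_linear V M h"
  by (simp_all add: linear_map_iff)

lemma s2_moduleD:
  assumes "s2_module V"
  shows "is_space V" "is_linear V V (swap V)" "v \<in> carrier V \<Longrightarrow> swap V (swap V v) = v"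
    "v \<in> carrier V \<Longrightarrow> swap V v \<in> carrier V"
  using assms linear_mapD(1,3)[of V V "swap V"] by (auto simp: s2_module_def)

section \<open>Tensor products of representations\<close>

lemma bilinear_mapI:
  assumes "is_space V" "is_space W" "is_space U"
    and "\<And>v w. v \<in> carrier V \<Longrightarrow> w \<in> carrier W \<Longrightarrow> \<beta> v w \<in> carrier U"
    and "\<And>v v' w. v \<in> carrier V \<Longrightarrow> v' \<in> carrier V \<Longrightarrow> w \<in> carrier W \<Longrightarrow>
      \<beta> (v \<oplus>\<^bsub>V\<^esub> v') w = \<beta> v w \<oplus>\<^bsub>U\<^esub> \<beta> v' w"
    and "\<And>v w w'. v \<in> carrier V \<Longrightarrow> w \<in> carrier W \<Longrightarrow> w' \<in> carrier W \<Longrightarrow>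
      \<beta> v (w \<oplus>\<^bsub>W\<^esub> w') = \<beta> v w \<oplus>\<^bsub>U\<^esub> \<beta> v w'"
    and "\<And>c v w. v \<in> carrier V \<Longrightarrow> w \<in> carrier W \<Longrightarrow> \<beta> (c \<odot>\<^bsub>V\<^esub> v) w = c \<odot>\<^bsub>U\<^esub> \<beta> v w"
    and "\<And>c v w. v \<in> carrier V \<Longrightarrow> w \<in> carrier W \<Longrightarrow> \<beta> v (c \<odot>\<^bsub>W\<^esub> w) = c \<odot>\<^bsub>U\<^esub> \<beta> v w"
  shows "bilinear_map V W U \<beta>"
  unfolding bilinear_map_def by (intro conjI ballI linear_mapI) (use assms in auto)

context
  fixes V :: "('k::field, 'v) s2module" and W :: "('k, 'w) s2module"
  assumes V: "s2_module V" and W: "s2_module W"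
begin

private lemmas Vs = s2_moduleD(1)[OF V] and Ws = s2_moduleD(1)[OF W]

lemma s2_tensor_simps [simp]:
  "carrier (s2_tensor V W) = carrier (tensor_space V W)" "add (s2_tensor V W) = add (tensor_space V W)"
  "zero (s2_tensor V W) = zero (tensor_space V W)" "smult (s2_tensor V W) = smult (tensor_space V W)"
  by (simp_all add: s2_tensor_def)

lemma
  shows linear_map_swap_s2_tensor: "is_linear (tensor_space V W) (tensor_space V W) (swap (s2_tensor V W))"
    and swap_pure_tensor: "v \<in> carrier V \<Longrightarrow> w \<in> carrier W \<Longrightarrow>
      swap (s2_tensor V W) (pure_tensor V W v w) = pure_tensor V W (swap V v) (swap W w)"
proof -
  let ?F = "free_space (carrier V \<times> carrier W) :: ('k, _) module" and ?N = "tensor_relations V W"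
  let ?f = "pushforward (map_prod (swap V) (swap W)) :: _ \<Rightarrow> (_ \<Rightarrow>\<^sub>0 'k)"
  note N = submodule_tensor_relations[OF Vs Ws]
  have f: "is_linear ?F ?F ?f"
    by (rule linear_map_pushforward) (auto simp: s2_moduleD(4)[OF V] s2_moduleD(4)[OF W])
  have fN: "?f r \<in> ?N" if "r \<in> ?N" for r
    by (rule tensor_relations_induct[OF Vs Ws N f that])
      (simp_all add: pushforward_diff linear_mapD(4,5)[OF s2_moduleD(2)[OF V]]
        linear_mapD(4,5)[OF s2_moduleD(2)[OF W]] tensor_relations_generators[OF Vs Ws]
        s2_moduleD(4)[OF V] s2_moduleD(4)[OF W])
  have sw: "swap (s2_tensor V W) = coset_map ?F ?N ?f"
    by (simp add: s2_tensor_def)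
  show "is_linear (tensor_space V W) (tensor_space V W) (swap (s2_tensor V W))"
    unfolding sw tensor_space_def by (rule linear_map_coset_map[OF N N f fN])
  assume "v \<in> carrier V" "w \<in> carrier W"
  then show "swap (s2_tensor V W) (pure_tensor V W v w) = pure_tensor V W (swap V v) (swap W w)"
    using coset_map_coset[OF N N f fN, of "single (v, w) 1"]
    by (simp add: sw pure_tensor_def)
qed

lemma s2_module_s2_tensor: "s2_module (s2_tensor V W)"
  unfolding s2_module_def
proof (intro conjI ballI)
  note lin = linear_map_swap_s2_tensor
  show "is_linear (s2_tensor V W) (s2_tensor V W) (swap (s2_tensor V W))"
    using lin unfolding s2_tensor_def by simp
  fix t assume "t \<in> carrier (s2_tensor V W)"
  then have "t \<in> carrier (tensor_space V W)" by simp
  then show "swap (s2_tensor V W) (swap (s2_tensor V W) t) = t"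
    by (rule linear_map_eq_on_tensor[OF Vs Ws linear_map_comp[OF lin lin] linear_map_id[OF linear_mapD(1)[OF lin]], rotated])
      (simp add: swap_pure_tensor s2_moduleD(3,4)[OF V] s2_moduleD(3,4)[OF W])
qed

lemma linear_map_s2_tensor [simp]:
  "is_linear (s2_tensor V W) U g \<longleftrightarrow> is_linear (tensor_space V W) U g"
  "is_linear U (s2_tensor V W) h \<longleftrightarrow> is_linear U (tensor_space V W) h"
  by (simp_all add: s2_tensor_def)

end

section \<open>The concrete representations\<close>

lemma s2_module_side_rep: "s2_module (side_rep :: ('k::field, _) s2module)"
  unfolding s2_module_def
proof (intro conjI ballI)
  show "is_linear side_rep side_rep (swap (side_rep :: ('k, _) s2module))"
    by (simp add: side_rep_def linear_map_pushforward)
  have "(\<lambda>x. case_side Succ Prec (case_side Succ Prec x)) = (\<lambda>x. x)" by (auto simp: fun_eq_iff split: side.split)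
  then show "swap side_rep (swap side_rep v) = v" for v :: "side \<Rightarrow>\<^sub>0 'k"
    by (simp add: side_rep_def pushforward_pushforward)
qed

lemma permutes_two: "{\<pi>. \<pi> permutes {1, 2 :: nat}} = {id, Transposition.transpose 1 2}"
  by (auto simp: permutes_doubleton_iff)

lemma s2_module_regular_rep: "s2_module (regular_rep :: ('k::field, _) s2module)"
  unfolding s2_module_def
proof (intro conjI ballI)
  show "is_linear regular_rep regular_rep (swap (regular_rep :: ('k, _) s2module))"
    unfolding regular_rep_def with_swap_simps linear_map_with_swap
    by (rule linear_map_pushforward) (auto simp: permutes_compose permutes_swap_id)
  show "swap regular_rep (swap regular_rep v) = v" for v :: "(nat \<Rightarrow> nat) \<Rightarrow>\<^sub>0 'k"
    by (simp add: regular_rep_def pushforward_pushforward comp_assoc)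
qed

lemma s2_module_sgn_rep: "s2_module (sgn_rep :: ('k::field, _) s2module)"
proof -
  have "is_space (sgn_rep :: ('k, _) s2module)"
    by (rule vectorspaceI) (simp_all add: sgn_rep_def algebra_simps)
  then have "is_linear sgn_rep sgn_rep (swap (sgn_rep :: ('k, _) s2module))"
    by (intro linear_mapI) (assumption, assumption, simp_all add: sgn_rep_def)
  then show ?thesis by (simp add: s2_module_def sgn_rep_def)
qed

lemma s2_module_bsu_gens: "s2_module V \<Longrightarrow> s2_module (bsu_gens V)"
  unfolding bsu_gens_def by (rule s2_module_s2_tensor[OF _ s2_module_side_rep])

lemma s2_module_black_gens: "s2_module V \<Longrightarrow> s2_module W \<Longrightarrow> s2_module (black_gens V W)"
  unfolding black_gens_def by (intro s2_module_s2_tensor s2_module_sgn_rep)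

lemma bilinear_mapD:
  assumes "bilinear_map V W U \<beta>"
  shows "w \<in> carrier W \<Longrightarrow> is_linear V U (\<lambda>v. \<beta> v w)" "v \<in> carrier V \<Longrightarrow> is_linear W U (\<beta> v)"
  using assms by (auto simp: bilinear_map_def)

lemma carrier_sgn_rep [simp]: "c \<in> carrier sgn_rep"
  by (simp add: sgn_rep_def)

section \<open>The tensors that generate the black product\<close>

lemma bilinear_map_black_tensor:
  assumes V: "s2_module V" and W: "s2_module W"
  shows "bilinear_map V W (black_gens V W) (black_tensor V W)"
proof -
  note VW = s2_module_s2_tensor[OF V W]
  note s = s2_moduleD(1)[OF VW] s2_moduleD(1)[OF s2_module_sgn_rep]
  have out: "is_linear (tensor_space V W) (black_gens V W) (\<lambda>t. pure_tensor (s2_tensor V W) sgn_rep t 1)"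
    using pure_tensor_linear(1)[OF s, of 1]
    by (simp add: black_gens_def linear_map_s2_tensor[OF VW s2_module_sgn_rep] linear_map_s2_tensor[OF V W])
  note inner = bilinear_map_pure_tensor[OF s2_moduleD(1)[OF V] s2_moduleD(1)[OF W]]
  show ?thesis
    unfolding bilinear_map_def black_tensor_def
    using linear_map_comp[OF bilinear_mapD(1)[OF inner] out] linear_map_comp[OF bilinear_mapD(2)[OF inner] out]
    by blast
qed

text \<open>The third factor carries the sign representation; its sign is moved out of the tensor by
  linearity.\<close>

lemma swap_black_tensor:
  fixes V :: "('k::field, 'v) s2module" and W :: "('k, 'w) s2module"
  assumes V: "s2_module V" and W: "s2_module W" and v: "v \<in> carrier V" and w: "w \<in> carrier W"
  shows "swap (black_gens V W) (black_tensor V W v w) = - 1 \<odot>\<^bsub>black_gens V W\<^esub> black_tensor V W (swap V v) (swap W w)"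
proof -
  note VW = s2_module_s2_tensor[OF V W]
  note s = s2_moduleD(1)[OF VW] s2_moduleD(1)[OF s2_module_sgn_rep]
  have t: "pure_tensor V W v' w' \<in> carrier (s2_tensor V W)" if "v' \<in> carrier V" "w' \<in> carrier W" for v' w'
    using pure_tensor_closed[OF s2_moduleD(1)[OF V] s2_moduleD(1)[OF W] that] by (simp add: s2_tensor_simps[OF V W])
  have one: "1 \<in> carrier sgn_rep" "swap sgn_rep 1 = - 1 \<odot>\<^bsub>sgn_rep\<^esub> (1 :: 'k)" by (simp_all add: sgn_rep_def)
  have "swap (black_gens V W) (black_tensor V W v w)
      = pure_tensor (s2_tensor V W) sgn_rep (pure_tensor V W (swap V v) (swap W w)) (- 1 \<odot>\<^bsub>sgn_rep\<^esub> 1)"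
    unfolding black_gens_def black_tensor_def
    using swap_pure_tensor[OF VW s2_module_sgn_rep t[OF v w] one(1)] swap_pure_tensor[OF V W v w] one(2) by simp
  also have "\<dots> = - 1 \<odot>\<^bsub>black_gens V W\<^esub> black_tensor V W (swap V v) (swap W w)"
    using linear_mapD(5)[OF pure_tensor_linear(2)[OF s t[OF s2_moduleD(4)[OF V v] s2_moduleD(4)[OF W w]]] one(1)]
    by (simp add: black_gens_def black_tensor_def s2_tensor_simps[OF VW s2_module_sgn_rep])
  finally show ?thesis .
qed

text \<open>The third factor is one-dimensional, so a tensor with the scalar \<open>c\<close> there
  is a multiple of a \<open>black_tensor\<close>. Uniqueness on tensor products is then applied
  twice.\<close>

lemma black_gens_eqI:
  fixes V :: "('k::field, 'v) s2module" and W :: "('k, 'w) s2module"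
  assumes V: "s2_module V" and W: "s2_module W"
    and f: "is_linear (black_gens V W) U f" and g: "is_linear (black_gens V W) U g"
    and eq: "\<And>v w. v \<in> carrier V \<Longrightarrow> w \<in> carrier W \<Longrightarrow> f (black_tensor V W v w) = g (black_tensor V W v w)"
    and t: "t \<in> carrier (black_gens V W)"
  shows "f t = g t"
proof -
  note VW = s2_module_s2_tensor[OF V W]
  note s = s2_moduleD(1)[OF VW] s2_moduleD(1)[OF s2_module_sgn_rep]
  have f': "is_linear (tensor_space (s2_tensor V W) sgn_rep) U f"
    and g': "is_linear (tensor_space (s2_tensor V W) sgn_rep) U g"
    using f g by (simp_all add: black_gens_def linear_map_s2_tensor[OF VW s2_module_sgn_rep])
  have t': "t \<in> carrier (tensor_space (s2_tensor V W) sgn_rep)"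
    using t by (simp add: black_gens_def s2_tensor_simps[OF VW s2_module_sgn_rep])
  show ?thesis
  proof (rule linear_map_eq_on_tensor[OF s f' g' _ t'])
    fix x and c :: 'k assume x: "x \<in> carrier (s2_tensor V W)" and c: "c \<in> carrier sgn_rep"
    have p: "is_linear (tensor_space V W) (tensor_space (s2_tensor V W) sgn_rep)
        (\<lambda>x. pure_tensor (s2_tensor V W) sgn_rep x c)"
      using pure_tensor_linear(1)[OF s c] by (simp add: linear_map_s2_tensor[OF V W])
    show "f (pure_tensor (s2_tensor V W) sgn_rep x c) = g (pure_tensor (s2_tensor V W) sgn_rep x c)"
    proof (rule linear_map_eq_on_tensor[OF s2_moduleD(1)[OF V] s2_moduleD(1)[OF W] linear_map_comp[OF p f'] linear_map_comp[OF p g']])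
      show "x \<in> carrier (tensor_space V W)" using x by (simp add: s2_tensor_simps[OF V W])
      fix v w assume vw: "v \<in> carrier V" "w \<in> carrier W"
      have pt: "pure_tensor V W v w \<in> carrier (s2_tensor V W)"
        using pure_tensor_closed[OF s2_moduleD(1)[OF V] s2_moduleD(1)[OF W] vw] by (simp add: s2_tensor_simps[OF V W])
      have "c = c \<odot>\<^bsub>sgn_rep\<^esub> 1" "1 \<in> carrier sgn_rep" by (simp_all add: sgn_rep_def)
      then have "pure_tensor (s2_tensor V W) sgn_rep (pure_tensor V W v w) c
          = c \<odot>\<^bsub>tensor_space (s2_tensor V W) sgn_rep\<^esub> black_tensor V W v w"
        using linear_mapD(5)[OF pure_tensor_linear(2)[OF s pt], of 1 c] by (simp add: black_tensor_def)
      moreover have "black_tensor V W v w \<in> carrier (tensor_space (s2_tensor V W) sgn_rep)"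
        unfolding black_tensor_def by (rule pure_tensor_closed[OF s pt]) (simp add: sgn_rep_def)
      ultimately show "f (pure_tensor (s2_tensor V W) sgn_rep (pure_tensor V W v w) c)
          = g (pure_tensor (s2_tensor V W) sgn_rep (pure_tensor V W v w) c)"
        using linear_mapD(5)[OF f'] linear_mapD(5)[OF g'] eq[OF vw] by simp
    qed
  qed
qed

subsection \<open>The generators of the bisuccessor and of the black product with \<open>PreLie\<close>\<close>

definition side_to_regular :: "(side \<Rightarrow>\<^sub>0 'k::field) \<Rightarrow> (nat \<Rightarrow> nat) \<Rightarrow>\<^sub>0 'k" where
  "side_to_regular s = single id (lookup s Prec)
    - single (Transposition.transpose 1 2) (lookup s Succ)"

text \<open>The same formula in the other direction, as the sign on the second basis vector is its
  own inverse.\<close>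

definition regular_to_side :: "((nat \<Rightarrow> nat) \<Rightarrow>\<^sub>0 'k::field) \<Rightarrow> side \<Rightarrow>\<^sub>0 'k" where
  "regular_to_side a = single Prec (lookup a id)
    - single Succ (lookup a (Transposition.transpose 1 2))"

lemma carrier_reps [simp]:
  "a \<in> carrier regular_rep \<longleftrightarrow> keys a \<subseteq> {id, Transposition.transpose 1 2}"
  "s \<in> carrier side_rep"
  unfolding regular_rep_def side_rep_def permutes_two by simp_all

lemma transpose_neq_id [simp]:
  "Transposition.transpose (Suc 0) 2 \<noteq> id" "id \<noteq> Transposition.transpose (Suc 0) 2"
  by (auto simp: fun_eq_iff Transposition.transpose_def intro!: exI[of _ 2])

lemma scale_diff: "scale c (p - q) = scale c p - scale c q"
  by (rule poly_mapping_eqI) (simp add: lookup_minus right_diff_distrib)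

lemma linear_map_side_to_regular: "is_linear side_rep regular_rep side_to_regular"
proof -
  have "is_linear (free_space UNIV :: ('k::field, _) module) (free_space {id, Transposition.transpose 1 2}) side_to_regular"
    by (rule linear_map_from_free_spaceI)
      (simp_all add: vectorspace_free_space side_to_regular_def keys_subsetI lookup_add single_add scale_diff)
  then show ?thesis unfolding side_rep_def regular_rep_def permutes_two by simp
qed

lemma linear_map_regular_to_side: "is_linear regular_rep side_rep regular_to_side"
proof -
  have "is_linear (free_space {id, Transposition.transpose 1 2} :: ('k::field, _) module) (free_space UNIV) regular_to_side"
    by (rule linear_map_from_free_spaceI)
      (simp_all add: vectorspace_free_space regular_to_side_def lookup_add single_add scale_diff)
  then show ?thesis unfolding side_rep_def regular_rep_def permutes_two by simp
qed

lemma regular_to_side_inverse: "regular_to_side (side_to_regular s) = s"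
proof (rule poly_mapping_eqI)
  show "lookup (regular_to_side (side_to_regular s)) e = lookup s e" for e
    by (cases e) (simp_all add: regular_to_side_def side_to_regular_def lookup_minus lookup_single)
qed

text \<open>Only two coefficients survive \<open>regular_to_side\<close>; the carrier condition says
  that there are no others.\<close>

lemma side_to_regular_inverse:
  assumes "a \<in> carrier regular_rep"
  shows "side_to_regular (regular_to_side a) = a"
proof (rule poly_mapping_eqI)
  fix \<pi> :: "nat \<Rightarrow> nat"
  consider "\<pi> = id" | "\<pi> = Transposition.transpose 1 2" | "\<pi> \<noteq> id" "\<pi> \<noteq> Transposition.transpose 1 2" by blast
  then show "lookup (side_to_regular (regular_to_side a)) \<pi> = lookup a \<pi>"
  proof cases
    case 3
    then have "\<pi> \<notin> keys a" using assms by auto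
    then show ?thesis using 3 by (simp add: side_to_regular_def lookup_minus lookup_single in_keys_iff when_def)
  qed (simp_all add: regular_to_side_def side_to_regular_def lookup_minus lookup_single)
qed

text \<open>This sign is the one that \<open>swap_black_tensor\<close> produces, so the induced map
  on generators is equivariant.\<close>

lemma side_to_regular_swap:
  "side_to_regular (swap side_rep s) = - 1 \<odot>\<^bsub>regular_rep\<^esub> swap regular_rep (side_to_regular s)"
proof -
  have sw: "swap side_rep s = single Succ (lookup s Prec)
      + single Prec (lookup s Succ)"
  proof -
    have "s = single Prec (lookup s Prec) + single Succ (lookup s Succ)"
    proof (rule poly_mapping_eqI)
      show "lookup s e = lookup (single Prec (lookup s Prec)
          + single Succ (lookup s Succ)) e" for e
        by (cases e) (simp_all add: lookup_add lookup_single)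
    qed
    then have "swap side_rep s = pushforward (case_side Succ Prec) (single Prec (lookup s Prec)
        + single Succ (lookup s Succ))"
      by (simp add: side_rep_def)
    then show ?thesis by (simp add: pushforward_add)
  qed
  show ?thesis
    unfolding sw
    by (simp add: side_to_regular_def regular_rep_def lookup_add lookup_single pushforward_diff free_space_def)
qed

definition bsu_to_black ::
  "('k::field, 'v) s2module \<Rightarrow> (('v \<times> (side \<Rightarrow>\<^sub>0 'k)) \<Rightarrow>\<^sub>0 'k) set \<Rightarrow> ('k, (nat \<Rightarrow> nat) \<Rightarrow>\<^sub>0 'k, 'v) black" where
  "bsu_to_black V = tensor_lift (black_gens regular_rep V) (\<lambda>v s. black_tensor regular_rep V (side_to_regular s) v)"

text \<open>Two nested lifts, because a generator lives in the tensor product of a tensor product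
  with the one-dimensional \<open>sgn_rep\<close>, whose element \<open>c\<close> acts as a
  scalar.\<close>

definition black_to_bsu ::
  "('k::field, 'v) s2module \<Rightarrow> ('k, (nat \<Rightarrow> nat) \<Rightarrow>\<^sub>0 'k, 'v) black \<Rightarrow> (('v \<times> (side \<Rightarrow>\<^sub>0 'k)) \<Rightarrow>\<^sub>0 'k) set" where
  "black_to_bsu V = tensor_lift (bsu_gens V) (\<lambda>t c. c \<odot>\<^bsub>bsu_gens V\<^esub>
    tensor_lift (bsu_gens V) (\<lambda>a v. pure_tensor V side_rep v (regular_to_side a)) t)"

context
  fixes V :: "('k::field, 'v) s2module"
  assumes V: "s2_module V"
begin

private lemmas V_space = s2_moduleD(1)[OF V]
private lemmas side_space = s2_moduleD(1)[OF s2_module_side_rep]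
private lemmas reg_space = s2_moduleD(1)[OF s2_module_regular_rep]
private lemmas RV = s2_module_s2_tensor[OF s2_module_regular_rep V]
private lemmas bl = bilinear_map_black_tensor[OF s2_module_regular_rep V]

lemma bsu_gens_simps:
  "carrier (bsu_gens V) = carrier (tensor_space V side_rep)" "add (bsu_gens V) = add (tensor_space V side_rep)"
  "smult (bsu_gens V) = smult (tensor_space V side_rep)"
  "is_linear (bsu_gens V) U f \<longleftrightarrow> is_linear (tensor_space V side_rep) U f"
  "is_linear U (bsu_gens V) h \<longleftrightarrow> is_linear U (tensor_space V side_rep) h"
  by (simp_all add: bsu_gens_def s2_tensor_simps[OF V s2_module_side_rep] linear_map_s2_tensor[OF V s2_module_side_rep])

lemma
  shows linear_map_bsu_to_black: "is_linear (bsu_gens V) (black_gens regular_rep V) (bsu_to_black V)"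
    and bsu_to_black_pure_tensor: "v \<in> carrier V \<Longrightarrow>
      bsu_to_black V (pure_tensor V side_rep v s) = black_tensor regular_rep V (side_to_regular s) v"
proof -
  have b: "bilinear_map V side_rep (black_gens regular_rep V) (\<lambda>v s. black_tensor regular_rep V (side_to_regular s) v)"
    unfolding bilinear_map_def
    using linear_map_comp[OF linear_map_side_to_regular bilinear_mapD(1)[OF bl]]
      bilinear_mapD(2)[OF bl linear_mapD(3)[OF linear_map_side_to_regular]] by blast
  show "is_linear (bsu_gens V) (black_gens regular_rep V) (bsu_to_black V)"
    unfolding bsu_to_black_def bsu_gens_simps by (rule linear_map_tensor_lift[OF V_space side_space b])
  show "bsu_to_black V (pure_tensor V side_rep v s) = black_tensor regular_rep V (side_to_regular s) v"
    if "v \<in> carrier V"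
    unfolding bsu_to_black_def by (rule tensor_lift_pure_tensor[OF V_space side_space b that carrier_reps(2)])
qed

lemma
  shows linear_map_black_to_bsu: "is_linear (black_gens regular_rep V) (bsu_gens V) (black_to_bsu V)"
    and black_to_bsu_black_tensor: "a \<in> carrier regular_rep \<Longrightarrow> v \<in> carrier V \<Longrightarrow>
      black_to_bsu V (black_tensor regular_rep V a v) = pure_tensor V side_rep v (regular_to_side a)"
proof -
  let ?f = "tensor_lift (bsu_gens V) (\<lambda>a v. pure_tensor V side_rep v (regular_to_side a))"
  have b: "bilinear_map regular_rep V (bsu_gens V) (\<lambda>a v. pure_tensor V side_rep v (regular_to_side a))"
    unfolding bilinear_map_def bsu_gens_simps
    using linear_map_comp[OF linear_map_regular_to_side pure_tensor_linear(2)[OF V_space side_space]]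
      pure_tensor_linear(1)[OF V_space side_space] by auto
  have f: "is_linear (s2_tensor regular_rep V) (bsu_gens V) ?f"
    using linear_map_tensor_lift[OF reg_space V_space b] by (simp add: linear_map_s2_tensor[OF s2_module_regular_rep V])
  have sp: "is_space (bsu_gens V)" by (rule s2_moduleD(1)[OF s2_module_bsu_gens[OF V]])
  have sgn: "add sgn_rep = (+)" "smult sgn_rep = (*)" by (simp_all add: sgn_rep_def)
  have b2: "bilinear_map (s2_tensor regular_rep V) sgn_rep (bsu_gens V) (\<lambda>t c. c \<odot>\<^bsub>bsu_gens V\<^esub> ?f t)"
    unfolding bilinear_map_def
    by (intro conjI ballI linear_map_comp[OF f linear_map_smult[OF sp]] linear_mapI
        s2_moduleD(1)[OF s2_module_sgn_rep] sp)
      (simp_all add: sgn vectorspaceD(4,10,14)[OF sp] linear_mapD(3)[OF f])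
  show "is_linear (black_gens regular_rep V) (bsu_gens V) (black_to_bsu V)"
    unfolding black_to_bsu_def black_gens_def linear_map_s2_tensor[OF RV s2_module_sgn_rep]
    by (rule linear_map_tensor_lift[OF s2_moduleD(1)[OF RV] s2_moduleD(1)[OF s2_module_sgn_rep] b2])
  assume a: "a \<in> carrier regular_rep" and v: "v \<in> carrier V"
  have pt: "pure_tensor regular_rep V a v \<in> carrier (s2_tensor regular_rep V)"
    using pure_tensor_closed[OF reg_space V_space a v] by (simp add: s2_tensor_simps[OF s2_module_regular_rep V])
  have "black_to_bsu V (black_tensor regular_rep V a v) = 1 \<odot>\<^bsub>bsu_gens V\<^esub> ?f (pure_tensor regular_rep V a v)"
    unfolding black_to_bsu_def black_tensor_def
    by (rule tensor_lift_pure_tensor[OF s2_moduleD(1)[OF RV] s2_moduleD(1)[OF s2_module_sgn_rep] b2 pt carrier_sgn_rep])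
  also have "\<dots> = pure_tensor V side_rep v (regular_to_side a)"
    using tensor_lift_pure_tensor[OF reg_space V_space b a v] linear_mapD(3)[OF f pt] by (simp add: vectorspaceD(11)[OF sp])
  finally show "black_to_bsu V (black_tensor regular_rep V a v) = pure_tensor V side_rep v (regular_to_side a)" .
qed

lemma black_to_bsu_inverse:
  assumes "t \<in> carrier (bsu_gens V)"
  shows "black_to_bsu V (bsu_to_black V t) = t"
proof -
  have "t \<in> carrier (tensor_space V side_rep)" using assms by (simp add: bsu_gens_simps)
  then show ?thesis
    using linear_map_eq_on_tensor[OF V_space side_space
        linear_map_comp[OF linear_map_bsu_to_black[unfolded bsu_gens_simps] linear_map_black_to_bsu[unfolded bsu_gens_simps]]
        linear_map_id[OF vectorspace_tensor_space[OF V_space side_space]], of t]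
    by (simp add: bsu_to_black_pure_tensor black_to_bsu_black_tensor linear_mapD(3)[OF linear_map_side_to_regular]
        regular_to_side_inverse del: carrier_reps(1))
qed

lemma bsu_to_black_inverse:
  assumes "t \<in> carrier (black_gens regular_rep V)"
  shows "bsu_to_black V (black_to_bsu V t) = t"
  using linear_map_comp[OF linear_map_black_to_bsu linear_map_bsu_to_black]
    linear_map_id[OF s2_moduleD(1)[OF s2_module_black_gens[OF s2_module_regular_rep V]]] _ assms
  by (rule black_gens_eqI[OF s2_module_regular_rep V])
    (simp add: bsu_to_black_pure_tensor black_to_bsu_black_tensor side_to_regular_inverse del: carrier_reps(1))

lemma bsu_to_black_swap:
  assumes "t \<in> carrier (bsu_gens V)"
  shows "bsu_to_black V (swap (bsu_gens V) t) = swap (black_gens regular_rep V) (bsu_to_black V t)"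
proof -
  let ?B = "black_gens (regular_rep :: ('k, _) s2module) V"
  have B: "s2_module ?B" by (rule s2_module_black_gens[OF s2_module_regular_rep V])
  have t: "t \<in> carrier (tensor_space V side_rep)" using assms by (simp add: bsu_gens_simps)
  note \<psi> = linear_map_bsu_to_black[unfolded bsu_gens_simps]
  have sw: "is_linear (tensor_space V side_rep) (tensor_space V side_rep) (swap (bsu_gens V))"
    unfolding bsu_gens_def by (rule linear_map_swap_s2_tensor[OF V s2_module_side_rep])
  show ?thesis
  proof (rule linear_map_eq_on_tensor[OF V_space side_space linear_map_comp[OF sw \<psi>] linear_map_comp[OF \<psi> s2_moduleD(2)[OF B]] _ t])
    fix v :: 'v and s :: "side \<Rightarrow>\<^sub>0 'k" assume v: "v \<in> carrier V"
    let ?a = "side_to_regular s"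
    have a: "?a \<in> carrier regular_rep" by (rule linear_mapD(3)[OF linear_map_side_to_regular carrier_reps(2)])
    have "bsu_to_black V (swap (bsu_gens V) (pure_tensor V side_rep v s))
        = black_tensor regular_rep V (- 1 \<odot>\<^bsub>regular_rep\<^esub> swap regular_rep ?a) (swap V v)"
      unfolding bsu_gens_def swap_pure_tensor[OF V s2_module_side_rep v carrier_reps(2)]
        bsu_to_black_pure_tensor[OF s2_moduleD(4)[OF V v]] side_to_regular_swap ..
    also have "\<dots> = - 1 \<odot>\<^bsub>?B\<^esub> black_tensor regular_rep V (swap regular_rep ?a) (swap V v)"
      by (rule linear_mapD(5)[OF bilinear_mapD(1)[OF bl s2_moduleD(4)[OF V v]] s2_moduleD(4)[OF s2_module_regular_rep a]])
    also have "\<dots> = swap ?B (bsu_to_black V (pure_tensor V side_rep v s))"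
      unfolding bsu_to_black_pure_tensor[OF v] swap_black_tensor[OF s2_module_regular_rep V a v] ..
    finally show "bsu_to_black V (swap (bsu_gens V) (pure_tensor V side_rep v s))
        = swap ?B (bsu_to_black V (pure_tensor V side_rep v s))" .
  qed
qed

lemma operad_iso_bsu_black:
  "operad_iso (free_operad (bsu_gens V)) (free_operad (black_gens regular_rep V))
    (free_map (black_gens regular_rep V) (bsu_to_black V))"
proof (rule operad_iso_free_operad[OF linear_map_bsu_to_black bsu_to_black_swap linear_map_black_to_bsu _
      black_to_bsu_inverse bsu_to_black_inverse])
  let ?B = "black_gens (regular_rep :: ('k, _) s2module) V"
  fix y assume y: "y \<in> carrier ?B"
  let ?x = "black_to_bsu V y"
  have x: "?x \<in> carrier (bsu_gens V)" by (rule linear_mapD(3)[OF linear_map_black_to_bsu y])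
  \<comment> \<open>Equivariance of the inverse is read off from that of \<open>bsu_to_black\<close>
    instead of being checked on tensors.\<close>
  have "swap ?B y = bsu_to_black V (swap (bsu_gens V) ?x)"
    using bsu_to_black_swap[OF x] bsu_to_black_inverse[OF y] by simp
  then show "black_to_bsu V (swap ?B y) = swap (bsu_gens V) ?x"
    using black_to_bsu_inverse[OF s2_moduleD(4)[OF s2_module_bsu_gens[OF V] x]] by simp
qed

end

section \<open>The free operad in arity three\<close>

lemma vectorspace_add_add:
  assumes U: "is_space U" and "a \<in> carrier U" "b \<in> carrier U" "c \<in> carrier U" "d \<in> carrier U"
  shows "(a \<oplus>\<^bsub>U\<^esub> b) \<oplus>\<^bsub>U\<^esub> (c \<oplus>\<^bsub>U\<^esub> d) = (a \<oplus>\<^bsub>U\<^esub> c) \<oplus>\<^bsub>U\<^esub> (b \<oplus>\<^bsub>U\<^esub> d)"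
proof -
  interpret U: vectorspace class_ring U by (rule U)
  show ?thesis using assms by (simp add: U.M.add.m_ac)
qed

abbreviation comb_tree :: "nat \<Rightarrow> nat \<Rightarrow> nat \<Rightarrow> 'v \<Rightarrow> 'v \<Rightarrow> 'v btree" where
  "comb_tree a b c \<omega> \<nu> \<equiv> Node \<omega> (Node \<nu> (Leaf a) (Leaf b)) (Leaf c)"

text \<open>All leaf orders are allowed, unlike in \<open>manin_circ\<close>, so the symmetry moves
  at the two vertices can be stated without case distinction.\<close>

definition left_comb ::
  "('k::field, 'v) s2module \<Rightarrow> nat \<Rightarrow> nat \<Rightarrow> nat \<Rightarrow> 'v \<Rightarrow> 'v \<Rightarrow> ('v btree \<Rightarrow>\<^sub>0 'k) set" where
  "left_comb V a b c \<omega> \<nu> = tree_class V 3 (single (comb_tree a b c \<omega> \<nu>) 1)"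

definition is_perm3 :: "nat \<Rightarrow> nat \<Rightarrow> nat \<Rightarrow> bool" where
  "is_perm3 a b c \<longleftrightarrow> distinct [a, b, c] \<and> {a, b, c} = {1..3}"

lemma is_perm3_cases:
  assumes "is_perm3 a b c"
  obtains "a = 1" "b = 2" "c = 3" | "a = 2" "b = 1" "c = 3" | "a = 2" "b = 3" "c = 1"
    | "a = 3" "b = 2" "c = 1" | "a = 3" "b = 1" "c = 2" | "a = 1" "b = 3" "c = 2"
proof -
  have "a \<in> {1..3}" "b \<in> {1..3}" "c \<in> {1..3}" "a \<noteq> b" "a \<noteq> c" "b \<noteq> c"
    using assms by (auto simp: is_perm3_def)
  then have "(a = 1 \<or> a = 2 \<or> a = 3) \<and> (b = 1 \<or> b = 2 \<or> b = 3) \<and> (c = 1 \<or> c = 2 \<or> c = 3)" by auto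
  then show ?thesis using that \<open>a \<noteq> b\<close> \<open>a \<noteq> c\<close> \<open>b \<noteq> c\<close> by blast
qed

lemma atLeastAtMost_1_3: "{1..3} = {1, 2, 3 :: nat}"
  by auto

lemma is_perm3_simps [simp]: "is_perm3 1 2 3" "is_perm3 2 3 1" "is_perm3 3 1 2"
  "is_perm3 (Suc 0) 2 3" "is_perm3 2 3 (Suc 0)" "is_perm3 3 (Suc 0) 2"
  by (simp_all add: is_perm3_def atLeastAtMost_1_3[simplified]) auto

lemma is_perm3_swap: "is_perm3 a b c \<Longrightarrow> is_perm3 b a c"
  by (auto simp: is_perm3_def)

lemma comb_tree_btrees:
  "is_perm3 a b c \<Longrightarrow> \<omega> \<in> X \<Longrightarrow> \<nu> \<in> X \<Longrightarrow> comb_tree a b c \<omega> \<nu> \<in> btrees X 3"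
  "is_perm3 a b c \<Longrightarrow> \<omega> \<in> X \<Longrightarrow> \<nu> \<in> X \<Longrightarrow> Node \<omega> (Leaf c) (Node \<nu> (Leaf a) (Leaf b)) \<in> btrees X 3"
  by (auto simp: btrees_def is_perm3_def)

lemma leaves_nonempty [simp]: "leaves t \<noteq> []"
  by (induction t) simp_all

lemma length_leaves_1: "length (leaves t) = 1 \<Longrightarrow> \<exists>j. t = Leaf j"
  by (cases t) (auto simp: add_is_1)

lemma length_leaves_ge_1: "1 \<le> length (leaves t)"
  by (simp add: Suc_le_eq)

lemma length_leaves_2:
  assumes "length (leaves t) = 2"
  obtains \<nu> a b where "t = Node \<nu> (Leaf a) (Leaf b)"
proof (cases t)
  case (Node \<nu> s u)
  then have "length (leaves s) = 1" "length (leaves u) = 1"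
    using assms length_leaves_ge_1[of s] length_leaves_ge_1[of u] by auto
  then show ?thesis using that Node length_leaves_1 by blast
qed (use assms in simp)

text \<open>Three leaves split as two and one or as one and two, and a subtree with two leaves is a
  single vertex.\<close>

lemma btrees_3_cases:
  assumes "t \<in> btrees X 3"
  obtains (left) \<omega> \<nu> a b c where "\<omega> \<in> X" "\<nu> \<in> X" "is_perm3 a b c" "t = comb_tree a b c \<omega> \<nu>"
    | (right) \<omega> \<nu> a b c where "\<omega> \<in> X" "\<nu> \<in> X" "is_perm3 a b c" "t = Node \<omega> (Leaf c) (Node \<nu> (Leaf a) (Leaf b))"
proof (cases t)
  case (Node \<omega> s u)
  note t = btreesD[OF assms]
  from t(4) Node have "length (leaves s) + length (leaves u) = 3" by simp
  then consider "length (leaves s) = 2" "length (leaves u) = 1" | "length (leaves s) = 1" "length (leaves u) = 2"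
    using length_leaves_ge_1[of s] length_leaves_ge_1[of u] by linarith
  then show ?thesis
  proof cases
    case 1
    then obtain \<nu> a b c where "s = Node \<nu> (Leaf a) (Leaf b)" "u = Leaf c"
      using length_leaves_1 length_leaves_2 by metis
    then show ?thesis using left t(1-3) Node by (auto simp: is_perm3_def insert_commute)
  next
    case 2
    then obtain \<nu> a b c where "u = Node \<nu> (Leaf a) (Leaf b)" "s = Leaf c"
      using length_leaves_1 length_leaves_2 by metis
    then show ?thesis using right t(1-3) Node by (auto simp: is_perm3_def insert_commute)
  qed
qed (use btreesD[OF assms] in simp)

lemma manin_circ_left_comb:
  "manin_circ V Type_I = left_comb V 1 2 3" "manin_circ V Type_II = left_comb V 2 3 1"
  "manin_circ V Type_III = left_comb V 3 1 2"
  by (simp_all add: fun_eq_iff manin_circ_def left_comb_def)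

lemma manin_tree_btrees: "\<omega> \<in> X \<Longrightarrow> \<nu> \<in> X \<Longrightarrow> manin_tree u \<omega> \<nu> \<in> btrees X 3"
  by (cases u) (simp_all add: comb_tree_btrees)

context
  fixes V :: "('k::field, 'v) s2module"
  assumes V: "s2_module V"
begin

private lemma space_arity: "is_space (arity (free_operad V) n)"
  by (rule linear_mapD(2)[OF linear_map_tree_class])

section \<open>Vertex relations as equations between classes of trees\<close>

lemma tree_class_single_eqI:
  assumes "single s 1 - single t 1 \<in> vertex_relations V"
    and "s \<in> btrees (carrier V) n" "t \<in> btrees (carrier V) n"
  shows "tree_class V n (single s 1) = tree_class V n (single t 1)"
  using assms by (subst tree_class_eq_iff) (simp_all add: vertex_relations_subset_tree_relations keys_subsetI)

lemma tree_class_single_add: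
  assumes "single s 1 - single t 1 - single u 1 \<in> vertex_relations V"
    and "s \<in> btrees (carrier V) n" "t \<in> btrees (carrier V) n" "u \<in> btrees (carrier V) n"
  shows "tree_class V n (single s 1) =
    tree_class V n (single t 1) \<oplus>\<^bsub>arity (free_operad V) n\<^esub> tree_class V n (single u 1)"
proof -
  have "tree_class V n (single s 1) = tree_class V n (single t 1 + single u 1)"
    using assms by (subst tree_class_eq_iff)
      (simp_all add: vertex_relations_subset_tree_relations keys_subsetI flip: diff_diff_eq)
  then show ?thesis
    using linear_mapD(4)[OF linear_map_tree_class, of "single t 1" V n "single u 1"] assms
    by simp
qed

lemma tree_class_single_smult:
  assumes "single s 1 - single t c \<in> vertex_relations V"
    and "s \<in> btrees (carrier V) n" "t \<in> btrees (carrier V) n"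
  shows "tree_class V n (single s 1) = c \<odot>\<^bsub>arity (free_operad V) n\<^esub> tree_class V n (single t 1)"
proof -
  have "tree_class V n (single s 1) = tree_class V n (single t c)"
    using assms by (subst tree_class_eq_iff)
      (simp_all add: vertex_relations_subset_tree_relations keys_subsetI)
  then show ?thesis
    using linear_mapD(5)[OF linear_map_tree_class, of "single t 1" V n c] assms by simp
qed

context
  fixes a b c assumes p: "is_perm3 a b c"
begin

lemma left_comb_closed: "\<omega> \<in> carrier V \<Longrightarrow> \<nu> \<in> carrier V \<Longrightarrow> left_comb V a b c \<omega> \<nu> \<in> carrier (arity (free_operad V) 3)"
  unfolding left_comb_def by (rule linear_mapD(3)[OF linear_map_tree_class]) (simp add: comb_tree_btrees p)

lemma left_comb_swap:
  assumes "\<omega> \<in> carrier V" "\<nu> \<in> carrier V"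
  shows "left_comb V a b c \<omega> \<nu> = left_comb V b a c \<omega> (swap V \<nu>)"
  unfolding left_comb_def
  by (rule tree_class_single_eqI)
    (use vertex_relations.left[OF vertex_relations.swap[OF assms(2), of "Leaf a" "Leaf b"], of \<omega> "Leaf c"] assms
      in \<open>simp_all add: pushforward_diff comb_tree_btrees p is_perm3_swap s2_moduleD(4)[OF V]\<close>)

lemma tree_class_right_comb:
  assumes "\<omega> \<in> carrier V" "\<nu> \<in> carrier V"
  shows "tree_class V 3 (single (Node \<omega> (Leaf c) (Node \<nu> (Leaf a) (Leaf b))) 1) =
    left_comb V a b c (swap V \<omega>) \<nu>"
  unfolding left_comb_def
  by (rule tree_class_single_eqI)
    (use assms in \<open>simp_all add: vertex_relations.swap comb_tree_btrees p s2_moduleD(4)[OF V]\<close>)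

lemma bilinear_map_left_comb: "bilinear_map V V (arity (free_operad V) 3) (left_comb V a b c)"
proof (rule bilinear_mapI)
  note s = s2_moduleD(1)[OF V]
  show "is_space V" "is_space (arity (free_operad V) 3)" by (rule s, rule space_arity)
  note bt = comb_tree_btrees(1)[OF p]
  fix v w assume v: "v \<in> carrier V" and w: "w \<in> carrier V"
  show "left_comb V a b c v w \<in> carrier (arity (free_operad V) 3)" by (rule left_comb_closed[OF v w])
  show "left_comb V a b c (v \<oplus>\<^bsub>V\<^esub> v') w = left_comb V a b c v w \<oplus>\<^bsub>arity (free_operad V) 3\<^esub> left_comb V a b c v' w"
    if "v' \<in> carrier V" for v'
    unfolding left_comb_def using that v w
    by (intro tree_class_single_add vertex_relations.add bt) (simp_all add: vectorspace_closed[OF s])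
  show "left_comb V a b c (k \<odot>\<^bsub>V\<^esub> v) w = k \<odot>\<^bsub>arity (free_operad V) 3\<^esub> left_comb V a b c v w" for k
    unfolding left_comb_def using v w
    by (intro tree_class_single_smult vertex_relations.smult bt) (simp_all add: vectorspace_closed[OF s])
  show "left_comb V a b c v (w \<oplus>\<^bsub>V\<^esub> w') = left_comb V a b c v w \<oplus>\<^bsub>arity (free_operad V) 3\<^esub> left_comb V a b c v w'"
    if w': "w' \<in> carrier V" for w'
    unfolding left_comb_def
    by (rule tree_class_single_add)
      (use vertex_relations.left[OF vertex_relations.add[OF w w', of "Leaf a" "Leaf b"], of v "Leaf c"] v w w'
        in \<open>simp_all add: pushforward_diff bt vectorspace_closed[OF s]\<close>)
  show "left_comb V a b c v (k \<odot>\<^bsub>V\<^esub> w) = k \<odot>\<^bsub>arity (free_operad V) 3\<^esub> left_comb V a b c v w" for k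
    unfolding left_comb_def
    by (rule tree_class_single_smult)
      (use vertex_relations.left[OF vertex_relations.smult[OF w, of k "Leaf a" "Leaf b"], of v "Leaf c"] v w
        in \<open>simp_all add: pushforward_diff bt vectorspace_closed[OF s]\<close>)
qed (rule s2_moduleD(1)[OF V])

end

lemma bilinear_map_manin_circ: "bilinear_map V V (arity (free_operad V) 3) (manin_circ V u)"
  by (cases u) (simp_all only: manin_circ_left_comb bilinear_map_left_comb is_perm3_simps)

lemma manin_circ_closed:
  "\<omega> \<in> carrier V \<Longrightarrow> \<nu> \<in> carrier V \<Longrightarrow> manin_circ V u \<omega> \<nu> \<in> carrier (arity (free_operad V) 3)"
  using linear_mapD(3)[OF bilinear_mapD(2)[OF bilinear_map_manin_circ]] .

text \<open>Three of the six leaf orders are the Manin types. Each of the other three becomes one by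
  exchanging the inner leaves, at the cost of a \<open>swap\<close> on the inner label.\<close>

lemma left_comb_manin_circ:
  assumes "is_perm3 a b c" "\<omega> \<in> carrier V" "\<nu> \<in> carrier V"
  obtains u \<nu>' where "\<nu>' \<in> carrier V" "left_comb V a b c \<omega> \<nu> = manin_circ V u \<omega> \<nu>'"
proof -
  have sw: "left_comb V a b c \<omega> \<nu> = left_comb V b a c \<omega> (swap V \<nu>)" "swap V \<nu> \<in> carrier V"
    using left_comb_swap[OF assms] s2_moduleD(4)[OF V assms(3)] by auto
  show ?thesis
    using assms(1)
  proof (cases rule: is_perm3_cases)
    case 1
    show ?thesis by (rule that[of \<nu> Type_I]) (simp_all only: manin_circ_left_comb 1 assms)
  next
    case 2
    show ?thesis by (rule that[of "swap V \<nu>" Type_I]) (use sw in \<open>simp_all only: manin_circ_left_comb 2\<close>)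
  next
    case 3
    show ?thesis by (rule that[of \<nu> Type_II]) (simp_all only: manin_circ_left_comb 3 assms)
  next
    case 4
    show ?thesis by (rule that[of "swap V \<nu>" Type_II]) (use sw in \<open>simp_all only: manin_circ_left_comb 4\<close>)
  next
    case 5
    show ?thesis by (rule that[of \<nu> Type_III]) (simp_all only: manin_circ_left_comb 5 assms)
  next
    case 6
    show ?thesis by (rule that[of "swap V \<nu>" Type_III]) (use sw in \<open>simp_all only: manin_circ_left_comb 6\<close>)
  qed
qed

text \<open>Symmetry at the root turns a right comb into a left comb, after which the leaf order is
  normalised at the inner vertex.\<close>

lemma tree_class_manin_circ:
  assumes t: "t \<in> btrees (carrier V) 3"
  obtains u \<omega> \<nu> where "\<omega> \<in> carrier V" "\<nu> \<in> carrier V"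
    "tree_class V 3 (single t 1) = manin_circ V u \<omega> \<nu>"
  using t
proof (cases rule: btrees_3_cases)
  case (left \<omega> \<nu> a b c)
  then show ?thesis using that left_comb_manin_circ[OF left(3,1,2)] by (metis left_comb_def)
next
  case (right \<omega> \<nu> a b c)
  then show ?thesis
    using that left_comb_manin_circ[OF right(3) s2_moduleD(4)[OF V right(1)] right(2)]
      tree_class_right_comb[OF right(3,1,2)] s2_moduleD(4)[OF V right(1)] by metis
qed

text \<open>The spanning half of the decomposition of arity three into the
  \<open>V \<circ>\<^sub>u V\<close>; \<open>free_operad_3_universal\<close> is the other
  half.\<close>

lemma linear_map_eq_on_manin_circ:
  assumes f: "is_linear (arity (free_operad V) 3) U f" and g: "is_linear (arity (free_operad V) 3) U g"
    and eq: "\<And>u \<omega> \<nu>. \<omega> \<in> carrier V \<Longrightarrow> \<nu> \<in> carrier V \<Longrightarrow> f (manin_circ V u \<omega> \<nu>) = g (manin_circ V u \<omega> \<nu>)"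
    and T: "T \<in> carrier (arity (free_operad V) 3)"
  shows "f T = g T"
proof -
  from T obtain p where p: "keys p \<subseteq> btrees (carrier V) 3" "T = tree_class V 3 p"
    unfolding carrier_free_operad by blast
  show ?thesis unfolding p(2)
  proof (rule linear_map_eq_on_free_space[OF linear_map_comp[OF linear_map_tree_class f]
        linear_map_comp[OF linear_map_tree_class g] _ p(1)])
    fix t assume "t \<in> btrees (carrier V) 3"
    then show "f (tree_class V 3 (single t 1)) = g (tree_class V 3 (single t 1))"
      by (rule tree_class_manin_circ) (simp add: eq)
  qed
qed

end

text \<open>
  The recursion ends with functions that vanish on all trees with a vertex, which suffices for
  functions supported on trees of bounded height.
\<close>

inductive tree_multilinear ::
  "('k::field, 'v) s2module \<Rightarrow> ('k, 'u, 'l) module_scheme \<Rightarrow> ('v btree \<Rightarrow> 'u) \<Rightarrow> bool" for V U where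
  vanish: "(\<And>j. F (Leaf j) \<in> carrier U) \<Longrightarrow> (\<And>x s t. F (Node x s t) = \<zero>\<^bsub>U\<^esub>) \<Longrightarrow> tree_multilinear V U F"
| step: "(\<And>t. F t \<in> carrier U) \<Longrightarrow>
    (\<And>x y s t. x \<in> carrier V \<Longrightarrow> y \<in> carrier V \<Longrightarrow> F (Node (x \<oplus>\<^bsub>V\<^esub> y) s t) = F (Node x s t) \<oplus>\<^bsub>U\<^esub> F (Node y s t)) \<Longrightarrow>
    (\<And>c x s t. x \<in> carrier V \<Longrightarrow> F (Node (c \<odot>\<^bsub>V\<^esub> x) s t) = c \<odot>\<^bsub>U\<^esub> F (Node x s t)) \<Longrightarrow>
    (\<And>x s t. x \<in> carrier V \<Longrightarrow> F (Node x s t) = F (Node (swap V x) t s)) \<Longrightarrow>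
    (\<And>x t. tree_multilinear V U (\<lambda>s. F (Node x s t))) \<Longrightarrow>
    (\<And>x s. tree_multilinear V U (\<lambda>t. F (Node x s t))) \<Longrightarrow> tree_multilinear V U F"

lemma linear_extension_pushforward:
  fixes U :: "('k::field, 'u, 'm) module_scheme"
  assumes U: "is_space U" and F: "\<And>x. F x \<in> carrier U"
  shows "linear_extension U F (pushforward h p) = linear_extension U (\<lambda>x. F (h x)) p"
proof (rule linear_map_eq_on_free_space[of UNIV])
  show "is_linear (free_space UNIV) U (\<lambda>p. linear_extension U F (pushforward h p))"
    by (rule linear_map_comp[OF linear_map_pushforward[of UNIV h UNIV] linear_map_linear_extension[OF U F]]) simp
  show "is_linear (free_space UNIV) U (linear_extension U (\<lambda>x. F (h x)))"
    by (rule linear_map_linear_extension[OF U F])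
qed (simp_all add: linear_extension_single[OF U F, where X = UNIV] linear_extension_single[OF U F[of "h _"], where X = UNIV])

lemma tree_multilinearD:
  fixes U :: "('k::field, 'u, 'm) module_scheme"
  assumes U: "is_space U" and F: "tree_multilinear V U F"
  shows "F t \<in> carrier U"
    and "x \<in> carrier V \<Longrightarrow> y \<in> carrier V \<Longrightarrow> F (Node (x \<oplus>\<^bsub>V\<^esub> y) s t) = F (Node x s t) \<oplus>\<^bsub>U\<^esub> F (Node y s t)"
    and "x \<in> carrier V \<Longrightarrow> F (Node (c \<odot>\<^bsub>V\<^esub> x) s t) = c \<odot>\<^bsub>U\<^esub> F (Node x s t)"
    and "x \<in> carrier V \<Longrightarrow> F (Node x s t) = F (Node (swap V x) t s)"
    and "tree_multilinear V U (\<lambda>s. F (Node x s t))" "tree_multilinear V U (\<lambda>t. F (Node x s t))"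
proof -
  note [simp] = vectorspaceD(1)[OF U] vectorspaceD(8)[OF U vectorspaceD(1)[OF U]] vectorspaceD(13)[OF U]
  show "F t \<in> carrier U"
    using F by (cases; cases t) simp_all
  show "F (Node (x \<oplus>\<^bsub>V\<^esub> y) s t) = F (Node x s t) \<oplus>\<^bsub>U\<^esub> F (Node y s t)" if "x \<in> carrier V" "y \<in> carrier V"
    using F by cases (simp_all add: that)
  show "F (Node (c \<odot>\<^bsub>V\<^esub> x) s t) = c \<odot>\<^bsub>U\<^esub> F (Node x s t)" if "x \<in> carrier V"
    using F by cases (simp_all add: that)
  show "F (Node x s t) = F (Node (swap V x) t s)" if "x \<in> carrier V"
    using F
  proof cases
    case step
    then show ?thesis using that by blast
  qed simp
  show "tree_multilinear V U (\<lambda>s. F (Node x s t))" "tree_multilinear V U (\<lambda>t. F (Node x s t))"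
    using F by (cases; simp add: tree_multilinear.vanish)+
qed

text \<open>The rules \<open>left\<close> and \<open>right\<close> replace a function by its
  dependence on one subtree, which is again multilinear; hence the induction keeps \<open>F\<close>
  arbitrary.\<close>

lemma tree_multilinear_kills_vertex_relations:
  fixes U :: "('k::field, 'u, 'm) module_scheme"
  assumes U: "is_space U" and r: "r \<in> vertex_relations V" and F: "tree_multilinear V U F"
  shows "linear_extension U F r = \<zero>\<^bsub>U\<^esub>"
proof -
  note mD = tree_multilinearD[OF U]
  have lin: "is_linear (free_space UNIV) U (linear_extension U F)" if "tree_multilinear V U F" for F
    by (rule linear_map_linear_extension[OF U mD(1)[OF that]])
  have single: "linear_extension U F (single t c) = c \<odot>\<^bsub>U\<^esub> F t" if "tree_multilinear V U F" for F t c
    by (rule linear_extension_single[OF U mD(1)[OF that], where X = UNIV]) simp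
  have diff: "linear_extension U F (p - q) = linear_extension U F p \<ominus>\<^bsub>U\<^esub> linear_extension U F q"
    if "tree_multilinear V U F" for F p q
    using linear_mapD(6)[OF lin[OF that], of p q] by simp
  have sum: "linear_extension U F (p + q) = linear_extension U F p \<oplus>\<^bsub>U\<^esub> linear_extension U F q"
    if "tree_multilinear V U F" for F p q
    using linear_mapD(4)[OF lin[OF that], of p q] by simp
  note Us = vectorspace_simps[OF U]
  show ?thesis
    using r F
  proof (induction arbitrary: F rule: vertex_relations.induct)
    case (add x y s t)
    note F = add(3)
    have "linear_extension U F (single (Node (x \<oplus>\<^bsub>V\<^esub> y) s t) 1 -
        (single (Node x s t) 1 + single (Node y s t) 1)) = \<zero>\<^bsub>U\<^esub>"
      unfolding diff[OF F] sum[OF F] single[OF F] mD(2)[OF F add(1,2)] using mD(1)[OF F] by (simp add: Us)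
    then show ?case by (simp only: diff_diff_eq)
  next
    case (smult x c s t)
    note F = smult(2)
    show ?case
      unfolding diff[OF F] single[OF F] mD(3)[OF F smult(1)] using mD(1)[OF F] by (simp add: Us)
  next
    case (swap x s t)
    note F = swap(2)
    show ?case
      unfolding diff[OF F] single[OF F] mD(4)[OF F swap(1), of s t] using mD(1)[OF F] by (simp add: Us)
  next
    case (left r x t)
    show ?case
      unfolding linear_extension_pushforward[OF U mD(1)[OF left.prems]] by (rule left.IH[OF mD(5)[OF left.prems]])
  next
    case (right r x s)
    show ?case
      unfolding linear_extension_pushforward[OF U mD(1)[OF right.prems]] by (rule right.IH[OF mD(6)[OF right.prems]])
  qed
qed

text \<open>
  Trees that do not belong to arity three get the value zero, so that the extension to all trees
  respects every vertex relation, well-formed or not.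
\<close>

definition comb_value ::
  "('k::field, 'v) s2module \<Rightarrow> ('k, 'u, 'l) module_scheme \<Rightarrow> (manin_type \<Rightarrow> 'v \<Rightarrow> 'v \<Rightarrow> 'u)
    \<Rightarrow> nat \<Rightarrow> nat \<Rightarrow> nat \<Rightarrow> 'v \<Rightarrow> 'v \<Rightarrow> 'u" where
  "comb_value V U g a b c \<omega> \<nu> =
    (if (a, b, c) = (1, 2, 3) then g Type_I \<omega> \<nu> else if (a, b, c) = (2, 1, 3) then g Type_I \<omega> (swap V \<nu>)
     else if (a, b, c) = (2, 3, 1) then g Type_II \<omega> \<nu> else if (a, b, c) = (3, 2, 1) then g Type_II \<omega> (swap V \<nu>)
     else if (a, b, c) = (3, 1, 2) then g Type_III \<omega> \<nu> else if (a, b, c) = (1, 3, 2) then g Type_III \<omega> (swap V \<nu>)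
     else \<zero>\<^bsub>U\<^esub>)"

text \<open>Evaluates only left combs; \<open>tree_value\<close> adds the mirror image.\<close>

fun node_value ::
  "('k::field, 'v) s2module \<Rightarrow> ('k, 'u, 'l) module_scheme \<Rightarrow> (manin_type \<Rightarrow> 'v \<Rightarrow> 'v \<Rightarrow> 'u)
    \<Rightarrow> 'v \<Rightarrow> 'v btree \<Rightarrow> 'v btree \<Rightarrow> 'u" where
  "node_value V U g \<omega> (Node \<nu> (Leaf a) (Leaf b)) (Leaf c) =
    (if \<nu> \<in> carrier V then comb_value V U g a b c \<omega> \<nu> else \<zero>\<^bsub>U\<^esub>)"
| "node_value V U g \<omega> _ _ = \<zero>\<^bsub>U\<^esub>"

text \<open>Summing over both orientations of the root makes the symmetry relation there automatic.
  On a given tree at most one summand is nonzero, because \<open>node_value\<close> wants a vertex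
  on the left and a leaf on the right.\<close>

primrec tree_value ::
  "('k::field, 'v) s2module \<Rightarrow> ('k, 'u, 'l) module_scheme \<Rightarrow> (manin_type \<Rightarrow> 'v \<Rightarrow> 'v \<Rightarrow> 'u)
    \<Rightarrow> 'v btree \<Rightarrow> 'u" where
  "tree_value V U g (Leaf j) = \<zero>\<^bsub>U\<^esub>"
| "tree_value V U g (Node \<omega> s t) =
    (if \<omega> \<in> carrier V then node_value V U g \<omega> s t \<oplus>\<^bsub>U\<^esub> node_value V U g (swap V \<omega>) t s else \<zero>\<^bsub>U\<^esub>)"

context
  fixes V :: "('k::field, 'v) s2module" and U :: "('k, 'u, 'l) module_scheme"
    and g :: "manin_type \<Rightarrow> 'v \<Rightarrow> 'v \<Rightarrow> 'u"
  assumes V: "s2_module V" and g: "\<And>u. bilinear_map V V U (g u)"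
begin

private lemma U: "is_space U"
  using linear_mapD(2)[OF bilinear_mapD(1)[OF g vectorspaceD(1)[OF s2_moduleD(1)[OF V]]]] .

private lemma V_closed:
  "x \<in> carrier V \<Longrightarrow> y \<in> carrier V \<Longrightarrow> x \<oplus>\<^bsub>V\<^esub> y \<in> carrier V" "x \<in> carrier V \<Longrightarrow> k \<odot>\<^bsub>V\<^esub> x \<in> carrier V"
  "x \<in> carrier V \<Longrightarrow> swap V x \<in> carrier V" "x \<in> carrier V \<Longrightarrow> swap V (swap V x) = x"
  "x \<in> carrier V \<Longrightarrow> y \<in> carrier V \<Longrightarrow> swap V (x \<oplus>\<^bsub>V\<^esub> y) = swap V x \<oplus>\<^bsub>V\<^esub> swap V y"
  "x \<in> carrier V \<Longrightarrow> swap V (k \<odot>\<^bsub>V\<^esub> x) = k \<odot>\<^bsub>V\<^esub> swap V x"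
  using vectorspaceD(2,4)[OF s2_moduleD(1)[OF V]] s2_moduleD(3,4)[OF V] linear_mapD(4,5)[OF s2_moduleD(2)[OF V]]
  by auto

private lemma U_closed:
  "\<zero>\<^bsub>U\<^esub> \<in> carrier U" "\<zero>\<^bsub>U\<^esub> \<oplus>\<^bsub>U\<^esub> \<zero>\<^bsub>U\<^esub> = \<zero>\<^bsub>U\<^esub>" "k \<odot>\<^bsub>U\<^esub> \<zero>\<^bsub>U\<^esub> = \<zero>\<^bsub>U\<^esub>"
  "x \<in> carrier U \<Longrightarrow> y \<in> carrier U \<Longrightarrow> x \<oplus>\<^bsub>U\<^esub> y \<in> carrier U"
  using vectorspaceD[OF U] by auto

private lemma g_simps:
  assumes "x \<in> carrier V" "y \<in> carrier V"
  shows "g u x y \<in> carrier U"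
    and "x' \<in> carrier V \<Longrightarrow> g u (x \<oplus>\<^bsub>V\<^esub> x') y = g u x y \<oplus>\<^bsub>U\<^esub> g u x' y"
    and "y' \<in> carrier V \<Longrightarrow> g u x (y \<oplus>\<^bsub>V\<^esub> y') = g u x y \<oplus>\<^bsub>U\<^esub> g u x y'"
    and "g u (k \<odot>\<^bsub>V\<^esub> x) y = k \<odot>\<^bsub>U\<^esub> g u x y" "g u x (k \<odot>\<^bsub>V\<^esub> y) = k \<odot>\<^bsub>U\<^esub> g u x y"
  using linear_mapD(3,4,5)[OF bilinear_mapD(1)[OF g assms(2)]] linear_mapD(3,4,5)[OF bilinear_mapD(2)[OF g assms(1)]]
    assms by auto

private lemma comb_value_bilinear: "bilinear_map V V U (comb_value V U g a b c)"
  by (rule bilinear_mapI[OF s2_moduleD(1)[OF V] s2_moduleD(1)[OF V] U])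
    (simp_all add: comb_value_def g_simps V_closed U_closed)

private lemmas comb_value_simps =
  linear_mapD(3,4,5)[OF bilinear_mapD(1)[OF comb_value_bilinear]]
  linear_mapD(4,5)[OF bilinear_mapD(2)[OF comb_value_bilinear]]

private lemma comb_value_swap:
  "\<omega> \<in> carrier V \<Longrightarrow> \<nu> \<in> carrier V \<Longrightarrow> comb_value V U g b a c \<omega> (swap V \<nu>) = comb_value V U g a b c \<omega> \<nu>"
  by (auto simp: comb_value_def V_closed)

private lemma node_value_closed: "\<omega> \<in> carrier V \<Longrightarrow> node_value V U g \<omega> s t \<in> carrier U"
  by (cases "(V, U, g, \<omega>, s, t)" rule: node_value.cases) (simp_all add: comb_value_simps U_closed)

private lemma node_value_add: "\<omega> \<in> carrier V \<Longrightarrow> \<omega>' \<in> carrier V \<Longrightarrow>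
    node_value V U g (\<omega> \<oplus>\<^bsub>V\<^esub> \<omega>') s t = node_value V U g \<omega> s t \<oplus>\<^bsub>U\<^esub> node_value V U g \<omega>' s t"
  by (cases "(V, U, g, \<omega>, s, t)" rule: node_value.cases) (simp_all add: comb_value_simps U_closed)

private lemma node_value_smult: "\<omega> \<in> carrier V \<Longrightarrow>
    node_value V U g (k \<odot>\<^bsub>V\<^esub> \<omega>) s t = k \<odot>\<^bsub>U\<^esub> node_value V U g \<omega> s t"
  by (cases "(V, U, g, \<omega>, s, t)" rule: node_value.cases) (simp_all add: comb_value_simps U_closed)

private lemma node_value_Node: "node_value V U g \<omega> s (Node x t t') = \<zero>\<^bsub>U\<^esub>"
  by (cases "(V, U, g, \<omega>, s, Node x t t')" rule: node_value.cases) simp_all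

private lemma node_value_Node_Node:
  "node_value V U g \<omega> (Node x (Node y t t') s) u = \<zero>\<^bsub>U\<^esub>" "node_value V U g \<omega> (Node x s (Node y t t')) u = \<zero>\<^bsub>U\<^esub>"
  by (cases u; cases s; simp)+

text \<open>Beside a vertex everything is zero. Beside a leaf one inner vertex is evaluated and
  anything deeper gives zero, so the recursion of \<open>tree_multilinear\<close> stops with
  \<open>vanish\<close> after one step.\<close>

lemma inner_tree_multilinear:
  assumes \<omega>: "\<omega> \<in> carrier V"
  shows "tree_multilinear V U (\<lambda>s. node_value V U g \<omega> s t)"
proof (cases t)
  case (Node x t1 t2)
  then show ?thesis
    by (intro tree_multilinear.vanish) (simp_all add: node_value_Node U_closed)
next
  case (Leaf c)
  show ?thesis unfolding Leaf
  proof (rule tree_multilinear.step)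
    show "node_value V U g \<omega> s (Leaf c) \<in> carrier U" for s by (rule node_value_closed[OF \<omega>])
    show "tree_multilinear V U (\<lambda>s. node_value V U g \<omega> (Node x s t) (Leaf c))" for x t
      by (rule tree_multilinear.vanish) (simp_all add: node_value_closed[OF \<omega>] node_value_Node_Node)
    show "tree_multilinear V U (\<lambda>t. node_value V U g \<omega> (Node x s t) (Leaf c))" for x s
      by (rule tree_multilinear.vanish) (simp_all add: node_value_closed[OF \<omega>] node_value_Node_Node)
    fix x s t assume x: "x \<in> carrier V"
    show "node_value V U g \<omega> (Node x s t) (Leaf c) = node_value V U g \<omega> (Node (swap V x) t s) (Leaf c)"
      by (cases s; cases t) (simp_all add: x V_closed comb_value_swap \<omega>)
    show "node_value V U g \<omega> (Node (k \<odot>\<^bsub>V\<^esub> x) s t) (Leaf c) = k \<odot>\<^bsub>U\<^esub> node_value V U g \<omega> (Node x s t) (Leaf c)" for k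
      by (cases s; cases t) (simp_all add: x V_closed U_closed comb_value_simps \<omega>)
    show "node_value V U g \<omega> (Node (x \<oplus>\<^bsub>V\<^esub> y) s t) (Leaf c) =
        node_value V U g \<omega> (Node x s t) (Leaf c) \<oplus>\<^bsub>U\<^esub> node_value V U g \<omega> (Node y s t) (Leaf c)" if "y \<in> carrier V" for y
      by (cases s; cases t) (simp_all add: x that V_closed U_closed comb_value_simps \<omega>)
  qed
qed

lemma tree_multilinear_tree_value: "tree_multilinear V U (tree_value V U g)"
proof (rule tree_multilinear.step)
  note nv = node_value_closed node_value_add node_value_smult
  note comm = vectorspaceD(6)[OF U]
  show "tree_value V U g t \<in> carrier U" for t
    by (cases t) (simp_all add: nv V_closed U_closed)
  have zero: "tree_multilinear V U (\<lambda>t. \<zero>\<^bsub>U\<^esub>)" by (rule tree_multilinear.vanish) (simp_all add: U_closed)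
  \<comment> \<open>\<open>tree_multilinear\<close> constrains a function on leaves only by closure.
    On nodes one summand of \<open>tree_value\<close> vanishes and leaves the inner function, while
    on a leaf the other summand can survive.\<close>
  have cong: "tree_multilinear V U G" if "tree_multilinear V U F"
    "\<And>x s t. G (Node x s t) = F (Node x s t)" "\<And>j. G (Leaf j) \<in> carrier U" for F G
    using that(1)
  proof cases
    case vanish
    then show ?thesis using that(2,3) by (intro tree_multilinear.vanish) auto
  next
    case step
    have G: "G t \<in> carrier U" for t using step(1) that(2,3) by (cases t) simp_all
    show ?thesis
      by (rule tree_multilinear.step, unfold that(2)) (assumption | rule G step)+
  qed
  show "tree_multilinear V U (\<lambda>s. tree_value V U g (Node x s t))" for x t
  proof (cases "x \<in> carrier V")
    case True
    then show ?thesis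
      by (intro cong[OF inner_tree_multilinear[OF True]])
        (simp_all add: node_value_Node nv V_closed U_closed vectorspaceD(8)[OF U])
  qed (simp add: zero)
  show "tree_multilinear V U (\<lambda>t. tree_value V U g (Node x s t))" for x s
  proof (cases "x \<in> carrier V")
    case True
    then show ?thesis
      by (intro cong[OF inner_tree_multilinear[OF V_closed(3)[OF True]]])
        (simp_all add: node_value_Node nv V_closed U_closed vectorspaceD(9)[OF U])
  qed (simp add: zero)
  fix x s t assume x: "x \<in> carrier V"
  show "tree_value V U g (Node x s t) = tree_value V U g (Node (swap V x) t s)"
    using x by (simp add: V_closed nv comm)
  show "tree_value V U g (Node (k \<odot>\<^bsub>V\<^esub> x) s t) = k \<odot>\<^bsub>U\<^esub> tree_value V U g (Node x s t)" for k
    using x by (simp add: V_closed nv vectorspaceD(15)[OF U])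
  fix y assume y: "y \<in> carrier V"
  show "tree_value V U g (Node (x \<oplus>\<^bsub>V\<^esub> y) s t) = tree_value V U g (Node x s t) \<oplus>\<^bsub>U\<^esub> tree_value V U g (Node y s t)"
    using x y by (simp add: V_closed nv vectorspace_add_add[OF U])
qed

text \<open>Expresses that the three summands of arity three are independent and each a full copy of
  \<open>V \<otimes> V\<close>. The map is induced by the linear extension of
  \<open>tree_value\<close>, which kills the relations.\<close>

lemma free_operad_3_universal:
  "\<exists>L. is_linear (arity (free_operad V) 3) U L \<and>
    (\<forall>u. \<forall>\<omega>\<in>carrier V. \<forall>\<nu>\<in>carrier V. L (manin_circ V u \<omega> \<nu>) = g u \<omega> \<nu>)"
proof (intro exI conjI allI ballI)
  let ?F = "linear_extension U (tree_value V U g)"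
  have cl: "tree_value V U g t \<in> carrier U" for t
    by (rule tree_multilinearD(1)[OF U tree_multilinear_tree_value])
  have lin: "is_linear (free_space (btrees (carrier V) 3)) U ?F"
    by (rule linear_map_linear_extension[OF U cl])
  have kill: "?F r = \<zero>\<^bsub>U\<^esub>" if "r \<in> tree_relations V 3" for r
  proof -
    have "?F r \<in> {\<zero>\<^bsub>U\<^esub>}"
      by (rule tree_relations_image[OF lin submodule_zero[OF U] _ that])
        (simp add: tree_multilinear_kills_vertex_relations[OF U _ tree_multilinear_tree_value])
    then show ?thesis by simp
  qed
  show "is_linear (arity (free_operad V) 3) U (quotient_lift ?F)"
    unfolding arity_free_operad by (rule linear_map_quotient_lift[OF submodule_tree_relations lin kill])
  fix u \<omega> \<nu> assume \<omega>: "\<omega> \<in> carrier V" and \<nu>: "\<nu> \<in> carrier V"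
  have "quotient_lift ?F (manin_circ V u \<omega> \<nu>) = ?F (single (manin_tree u \<omega> \<nu>) 1)"
    unfolding manin_circ_def tree_class_def
    by (rule quotient_lift_coset[OF submodule_tree_relations lin kill]) (simp_all add: manin_tree_btrees \<omega> \<nu>)
  also have "\<dots> = tree_value V U g (manin_tree u \<omega> \<nu>)"
    using cl by (subst linear_extension_single[OF U cl, where X = UNIV]) (simp_all add: vectorspaceD(11)[OF U])
  also have "\<dots> = g u \<omega> \<nu>"
    using \<omega> \<nu> by (cases u) (simp_all add: comb_value_def vectorspaceD(8)[OF U] g_simps)
  finally show "quotient_lift ?F (manin_circ V u \<omega> \<nu>) = g u \<omega> \<nu>" .
qed

end

section \<open>The map \<open>\<Psi>\<close>\<close>

lemma linear_map_add:
  assumes f: "is_linear V U f" and g: "is_linear V U g"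
  shows "is_linear V U (\<lambda>x. f x \<oplus>\<^bsub>U\<^esub> g x)"
proof (rule linear_mapI)
  note U = linear_mapD(2)[OF f]
  note fD = linear_mapD[OF f] and gD = linear_mapD[OF g]
  show "is_space V" "is_space U" by (rule fD(1), rule U)
  fix x assume x: "x \<in> carrier V"
  show "f x \<oplus>\<^bsub>U\<^esub> g x \<in> carrier U" using x by (simp add: fD(3) gD(3) vectorspaceD(2)[OF U])
  show "f (c \<odot>\<^bsub>V\<^esub> x) \<oplus>\<^bsub>U\<^esub> g (c \<odot>\<^bsub>V\<^esub> x) = c \<odot>\<^bsub>U\<^esub> (f x \<oplus>\<^bsub>U\<^esub> g x)" for c
    using x by (simp add: fD(3,5) gD(3,5) vectorspaceD(15)[OF U])
  fix y assume y: "y \<in> carrier V"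
  show "f (x \<oplus>\<^bsub>V\<^esub> y) \<oplus>\<^bsub>U\<^esub> g (x \<oplus>\<^bsub>V\<^esub> y) = (f x \<oplus>\<^bsub>U\<^esub> g x) \<oplus>\<^bsub>U\<^esub> (f y \<oplus>\<^bsub>U\<^esub> g y)"
    using x y by (simp add: fD(3,4) gD(3,4) vectorspace_add_add[OF U])
qed

lemma linear_map_smult_comp:
  "is_linear V U f \<Longrightarrow> is_linear V U (\<lambda>x. c \<odot>\<^bsub>U\<^esub> f x)"
  by (rule linear_map_comp[OF _ linear_map_smult[OF linear_mapD(2)]])

lemma linear_map_zero: "is_space V \<Longrightarrow> is_space U \<Longrightarrow> is_linear V U (\<lambda>x. \<zero>\<^bsub>U\<^esub>)"
  by (rule linear_mapI) (simp_all add: vectorspaceD)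

lemma bilinear_map_comp:
  assumes "bilinear_map V W U \<beta>" "is_linear V' V f" "is_linear W' W g"
  shows "bilinear_map V' W' U (\<lambda>v w. \<beta> (f v) (g w))"
  unfolding bilinear_map_def
  using linear_map_comp[OF assms(2) bilinear_mapD(1)[OF assms(1) linear_mapD(3)[OF assms(3)]]]
    linear_map_comp[OF assms(3) bilinear_mapD(2)[OF assms(1) linear_mapD(3)[OF assms(2)]]] by blast

text \<open>The universal property of arity three is used once for \<open>W\<close>, with two labels
  from \<open>V\<close> and a type fixed, and once for \<open>V\<close>, with an element
  \<open>b\<close> of arity three over \<open>W\<close> fixed. The result is bilinear and hence
  factors through the tensor product.\<close>

lemma ex_manin_psi:
  fixes V :: "('k::field, 'v) s2module" and W :: "('k, 'w) s2module"
  assumes V: "s2_module V" and W: "s2_module W"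
  shows "\<exists>\<Psi>. is_manin_psi V W \<Psi>"
proof -
  let ?B = "black_gens V W"
  let ?TV = "arity (free_operad V) 3" and ?TW = "arity (free_operad W) 3" and ?U = "arity (free_operad ?B) 3"
  have sTV: "is_space ?TV" and sTW: "is_space ?TW" and sU: "is_space ?U"
    using linear_mapD(2)[OF linear_map_tree_class] by blast+
  note sV = s2_moduleD(1)[OF V] and sW = s2_moduleD(1)[OF W]
  have B: "s2_module ?B" by (rule s2_module_black_gens[OF V W])
  note bl = bilinear_map_black_tensor[OF V W] and circ = bilinear_map_manin_circ[OF B]
  let ?G = "\<lambda>u \<omega> \<nu> \<omega>' \<nu>'. manin_circ ?B u (black_tensor V W \<omega> \<omega>') (black_tensor V W \<nu> \<nu>')"
  let ?Q = "\<lambda>u \<omega> \<nu> M. is_linear ?TW ?U M \<and> (\<forall>v. \<forall>\<omega>'\<in>carrier W. \<forall>\<nu>'\<in>carrier W.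
      M (manin_circ W v \<omega>' \<nu>') = (if u = v then ?G u \<omega> \<nu> \<omega>' \<nu>' else \<zero>\<^bsub>?U\<^esub>))"
  have Q: "\<exists>M. ?Q u \<omega> \<nu> M" if "\<omega> \<in> carrier V" "\<nu> \<in> carrier V" for u \<omega> \<nu>
  proof -
    have "bilinear_map W W ?U (\<lambda>\<omega>' \<nu>'. if u = v then ?G u \<omega> \<nu> \<omega>' \<nu>' else \<zero>\<^bsub>?U\<^esub>)" for v
    proof (cases "u = v")
      case True
      then show ?thesis using bilinear_map_comp[OF circ bilinear_mapD(2)[OF bl that(1)] bilinear_mapD(2)[OF bl that(2)]] by simp
    next
      case False
      then show ?thesis by (simp add: bilinear_map_def linear_map_zero[OF sW sU])
    qed
    then show ?thesis
      by (rule free_operad_3_universal[OF W,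
          where g = "\<lambda>v \<omega>' \<nu>'. if u = v then ?G u \<omega> \<nu> \<omega>' \<nu>' else \<zero>\<^bsub>?U\<^esub>"])
  qed
  \<comment> \<open>The maps are only chosen, so their dependence on the labels is controlled by
    uniqueness: both sides of each bilinearity equation are linear and agree on every
    \<open>manin_circ\<close>.\<close>
  define M where "M u \<omega> \<nu> = (SOME M. ?Q u \<omega> \<nu> M)" for u \<omega> \<nu>
  have "?Q u \<omega> \<nu> (M u \<omega> \<nu>)" if "\<omega> \<in> carrier V" "\<nu> \<in> carrier V" for u \<omega> \<nu>
    unfolding M_def by (rule someI_ex[OF Q[OF that]])
  then have M: "\<And>u \<omega> \<nu>. \<omega> \<in> carrier V \<Longrightarrow> \<nu> \<in> carrier V \<Longrightarrow> is_linear ?TW ?U (M u \<omega> \<nu>)"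
    and Mc: "\<And>u \<omega> \<nu> v \<omega>' \<nu>'. \<omega> \<in> carrier V \<Longrightarrow> \<nu> \<in> carrier V \<Longrightarrow> \<omega>' \<in> carrier W \<Longrightarrow> \<nu>' \<in> carrier W \<Longrightarrow>
      M u \<omega> \<nu> (manin_circ W v \<omega>' \<nu>') = (if u = v then ?G u \<omega> \<nu> \<omega>' \<nu>' else \<zero>\<^bsub>?U\<^esub>)"
    by blast+
  note UD = vectorspaceD[OF sU]
  have bM: "bilinear_map V V ?U (\<lambda>\<omega> \<nu>. M u \<omega> \<nu> b)" if b: "b \<in> carrier ?TW" for u b
  proof (rule bilinear_mapI[OF sV sV sU])
    have G: "bilinear_map V V ?U (\<lambda>\<omega> \<nu>. ?G v \<omega> \<nu> \<omega>' \<nu>')" if "\<omega>' \<in> carrier W" "\<nu>' \<in> carrier W" for v \<omega>' \<nu>'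
      by (rule bilinear_map_comp[OF circ bilinear_mapD(1)[OF bl that(1)] bilinear_mapD(1)[OF bl that(2)]])
    note G1 = linear_mapD(4,5)[OF bilinear_mapD(1)[OF G]] and G2 = linear_mapD(4,5)[OF bilinear_mapD(2)[OF G]]
    fix x y assume x: "x \<in> carrier V" and y: "y \<in> carrier V"
    show "M u x y b \<in> carrier ?U" by (rule linear_mapD(3)[OF M[OF x y] b])
    show "M u (k \<odot>\<^bsub>V\<^esub> x) y b = k \<odot>\<^bsub>?U\<^esub> M u x y b" for k
      by (rule linear_map_eq_on_manin_circ[OF W M linear_map_smult_comp[OF M] _ b])
        (simp_all add: x y Mc G1 vectorspaceD(4)[OF sV] UD(13))
    show "M u x (k \<odot>\<^bsub>V\<^esub> y) b = k \<odot>\<^bsub>?U\<^esub> M u x y b" for k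
      by (rule linear_map_eq_on_manin_circ[OF W M linear_map_smult_comp[OF M] _ b])
        (simp_all add: x y Mc G2 vectorspaceD(4)[OF sV] UD(13))
    show "M u (x \<oplus>\<^bsub>V\<^esub> z) y b = M u x y b \<oplus>\<^bsub>?U\<^esub> M u z y b" if z: "z \<in> carrier V" for z
      by (rule linear_map_eq_on_manin_circ[OF W M linear_map_add[OF M M] _ b])
        (simp_all add: x y z Mc G1 vectorspaceD(2)[OF sV] UD(1,8))
    show "M u x (y \<oplus>\<^bsub>V\<^esub> z) b = M u x y b \<oplus>\<^bsub>?U\<^esub> M u x z b" if z: "z \<in> carrier V" for z
      by (rule linear_map_eq_on_manin_circ[OF W M linear_map_add[OF M M] _ b])
        (simp_all add: x y z Mc G2 vectorspaceD(2)[OF sV] UD(1,8))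
  qed
  let ?R = "\<lambda>b L. is_linear ?TV ?U L \<and> (\<forall>u. \<forall>\<omega>\<in>carrier V. \<forall>\<nu>\<in>carrier V. L (manin_circ V u \<omega> \<nu>) = M u \<omega> \<nu> b)"
  have R: "\<exists>L. ?R b L" if b: "b \<in> carrier ?TW" for b
    by (rule free_operad_3_universal[OF V, where g = "\<lambda>u \<omega> \<nu>. M u \<omega> \<nu> b", OF bM[OF b]])
  define L where "L b = (SOME L. ?R b L)" for b
  have "?R b (L b)" if "b \<in> carrier ?TW" for b
    unfolding L_def by (rule someI_ex[OF R[OF that]])
  then have L: "\<And>b. b \<in> carrier ?TW \<Longrightarrow> is_linear ?TV ?U (L b)"
    and Lc: "\<And>b u \<omega> \<nu>. b \<in> carrier ?TW \<Longrightarrow> \<omega> \<in> carrier V \<Longrightarrow> \<nu> \<in> carrier V \<Longrightarrow> L b (manin_circ V u \<omega> \<nu>) = M u \<omega> \<nu> b"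
    by blast+
  have bL: "bilinear_map ?TV ?TW ?U (\<lambda>a b. L b a)"
    unfolding bilinear_map_def
  proof (intro conjI ballI L linear_mapI sTW sU)
    fix a assume a: "a \<in> carrier ?TV"
    show "L b a \<in> carrier ?U" if "b \<in> carrier ?TW" for b by (rule linear_mapD(3)[OF L[OF that] a])
    show "L (k \<odot>\<^bsub>?TW\<^esub> b) a = k \<odot>\<^bsub>?U\<^esub> L b a" if b: "b \<in> carrier ?TW" for k b
      by (rule linear_map_eq_on_manin_circ[OF V L linear_map_smult_comp[OF L] _ a])
        (simp_all add: b Lc linear_mapD(5)[OF M] vectorspaceD(4)[OF sTW])
    show "L (b \<oplus>\<^bsub>?TW\<^esub> b') a = L b a \<oplus>\<^bsub>?U\<^esub> L b' a" if b: "b \<in> carrier ?TW" "b' \<in> carrier ?TW" for b b'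
      by (rule linear_map_eq_on_manin_circ[OF V L linear_map_add[OF L L] _ a])
        (simp_all add: b Lc linear_mapD(4)[OF M] vectorspaceD(2)[OF sTW])
  qed
  have "is_manin_psi V W (tensor_lift ?U (\<lambda>a b. L b a))"
    unfolding is_manin_psi_def
    using linear_map_tensor_lift[OF sTV sTW bL] tensor_lift_pure_tensor[OF sTV sTW bL]
    by (simp add: manin_circ_closed[OF V] manin_circ_closed[OF W] Lc Mc)
  then show ?thesis by blast
qed

lemma is_manin_psi_manin_psi: "s2_module V \<Longrightarrow> s2_module W \<Longrightarrow> is_manin_psi V W (manin_psi V W)"
  unfolding manin_psi_def by (rule someI_ex[OF ex_manin_psi])

section \<open>The bisuccessor\<close>

text \<open>Injectivity excludes cancellation. Thus every tree of a relation is still visible after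
  the relation is plugged into a larger tree, and distinctness of leaves passes down to it.\<close>

lemma keys_pushforward_inj:
  fixes p :: "'x \<Rightarrow>\<^sub>0 'k::field"
  assumes h: "inj h"
  shows "keys (pushforward h p) = h ` keys p"
proof -
  have l: "lookup (pushforward h p) (h x) = lookup p x" for x
    using subset_UNIV[of "keys p"]
    by (induction rule: free_space_induct)
      (simp_all add: lookup_single when_def inj_eq[OF h] pushforward_add lookup_add)
  have "h x \<in> keys (pushforward h p)" if "x \<in> keys p" for x
    using that l[of x] by (simp add: in_keys_iff)
  then show ?thesis using keys_pushforward[of h p] by blast
qed

text \<open>A vertex nearer the root than a relation sees it only through its leaves, so the
  bisuccessor gives that vertex the same label in every tree of the relation.\<close>

lemma vertex_relations_leaves:
  fixes V :: "('k::field, 'v) s2module"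
  shows "r \<in> vertex_relations V \<Longrightarrow> \<exists>S. \<forall>t\<in>keys r. set (leaves t) = S"
proof (induction rule: vertex_relations.induct)
  case (add x y s t)
  let ?T = "{Node (x \<oplus>\<^bsub>V\<^esub> y) s t, Node x s t, Node y s t}"
  have "keys (single (Node (x \<oplus>\<^bsub>V\<^esub> y) s t) 1 - single (Node x s t) 1
      - single (Node y s t) (1 :: 'k)) \<subseteq> ?T"
    by (simp add: keys_subsetI)
  moreover have "\<forall>u\<in>?T. set (leaves u) = set (leaves s) \<union> set (leaves t)" by (simp add: Un_commute)
  ultimately show ?case by (meson subsetD)
next
  case (smult x c s t)
  let ?T = "{Node (c \<odot>\<^bsub>V\<^esub> x) s t, Node x s t}"
  have "keys (single (Node (c \<odot>\<^bsub>V\<^esub> x) s t) 1 - single (Node x s t) c) \<subseteq> ?T"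
    by (simp add: keys_subsetI)
  moreover have "\<forall>u\<in>?T. set (leaves u) = set (leaves s) \<union> set (leaves t)" by (simp add: Un_commute)
  ultimately show ?case by (meson subsetD)
next
  case (swap x s t)
  let ?T = "{Node x s t, Node (swap V x) t s}"
  have "keys (single (Node x s t) 1 - single (Node (swap V x) t s) (1 :: 'k)) \<subseteq> ?T"
    by (simp add: keys_subsetI)
  moreover have "\<forall>u\<in>?T. set (leaves u) = set (leaves s) \<union> set (leaves t)" by (simp add: Un_commute)
  ultimately show ?case by (meson subsetD)
next
  case (left r x t)
  from this(2) obtain S where S: "\<forall>t\<in>keys r. set (leaves t) = S" by (rule exE)
  show ?case
  proof (intro exI[of _ "S \<union> set (leaves t)"] ballI)
    fix u assume "u \<in> keys (pushforward (\<lambda>s. Node x s t) r)"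
    then obtain s where "s \<in> keys r" "u = Node x s t"
      using subsetD[OF keys_pushforward[of "\<lambda>s. Node x s t" r]] by auto
    then show "set (leaves u) = S \<union> set (leaves t)" using S by simp
  qed
next
  case (right r x s)
  from this(2) obtain S where S: "\<forall>t\<in>keys r. set (leaves t) = S" by (rule exE)
  show ?case
  proof (intro exI[of _ "set (leaves s) \<union> S"] ballI)
    fix u assume "u \<in> keys (pushforward (\<lambda>t. Node x s t) r)"
    then obtain t where "t \<in> keys r" "u = Node x s t"
      using subsetD[OF keys_pushforward[of "\<lambda>t. Node x s t" r]] by auto
    then show "set (leaves u) = set (leaves s) \<union> S" using S by simp
  qed
qed

lemma zero_in_vertex_relations:
  assumes "is_space V"
  shows "0 \<in> vertex_relations (V :: ('k::field, 'v) s2module)"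
  \<comment> \<open>The zero vector times \<open>1\<close> is the zero vector, so the two terms of
    this relation cancel.\<close>
  using vertex_relations.smult[OF vectorspaceD(1)[OF assms], of 1 "Leaf 0" "Leaf 0"]
  by (simp add: vectorspaceD(13)[OF assms])

text \<open>Separates the dependence on the subtrees, which is only through their leaf sets, from
  the dependence on \<open>\<omega>\<close>, which is linear.\<close>

definition bsu_label ::
  "('k::field, 'v) s2module \<Rightarrow> nat \<Rightarrow> nat set \<Rightarrow> nat set \<Rightarrow> 'v \<Rightarrow> (('v \<times> (side \<Rightarrow>\<^sub>0 'k)) \<Rightarrow>\<^sub>0 'k) set" where
  "bsu_label V x A B \<omega> =
    (if x \<in> A then at_side V Prec \<omega> else if x \<in> B then at_side V Succ \<omega> else at_star V \<omega>)"

lemma bsu_tree_Node: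
  "bsu_tree V x (Node \<omega> s t) =
    Node (bsu_label V x (set (leaves s)) (set (leaves t)) \<omega>) (bsu_tree V x s) (bsu_tree V x t)"
  by (simp add: bsu_label_def)

lemma leaves_bsu_tree [simp]: "leaves (bsu_tree V x t) = leaves t"
  by (induction t) simp_all

text \<open>
  The leaf \<open>x\<close> determines the cyclic order \<open>(u, u', u'')\<close> of the three tree types: it is the left
  inner leaf in \<open>u\<close>, the outer leaf in \<open>u'\<close> and the right inner leaf in \<open>u''\<close>.
\<close>

definition leaf_types :: "nat \<Rightarrow> manin_type \<Rightarrow> manin_type \<Rightarrow> manin_type \<Rightarrow> bool" where
  "leaf_types x u u' u'' \<longleftrightarrow> (x, u, u', u'') \<in>
    {(1, Type_I, Type_II, Type_III), (2, Type_II, Type_III, Type_I), (3, Type_III, Type_I, Type_II)}"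

context
  fixes V :: "('k::field, 'v) s2module"
  assumes V: "s2_module V"
begin

private lemma bsu: "s2_module (bsu_gens V)"
  by (rule s2_module_bsu_gens[OF V])

lemma linear_map_at_side: "is_linear V (bsu_gens V) (at_side V e)"
  unfolding at_side_def bsu_gens_simps[OF V]
  by (rule pure_tensor_linear(1)[OF s2_moduleD(1)[OF V] s2_moduleD(1)[OF s2_module_side_rep]]) simp

lemma linear_map_bsu_label: "is_linear V (bsu_gens V) (bsu_label V x A B)"
proof -
  have "is_linear V (bsu_gens V) (at_star V)"
    unfolding at_star_def by (rule linear_map_add[OF linear_map_at_side linear_map_at_side])
  then show ?thesis
    unfolding bsu_label_def by (cases "x \<in> A"; cases "x \<in> B") (simp_all add: linear_map_at_side)
qed

lemma swap_at_side:
  assumes "\<omega> \<in> carrier V"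
  shows "swap (bsu_gens V) (at_side V e \<omega>) = at_side V (case_side Succ Prec e) (swap V \<omega>)"
proof -
  have "swap side_rep (single e (1 :: 'k)) = single (case_side Succ Prec e) 1"
    by (simp add: side_rep_def)
  then show ?thesis
    unfolding bsu_gens_def at_side_def
    using swap_pure_tensor[OF V s2_module_side_rep assms carrier_reps(2)[of "single e (1 :: 'k)"]] by simp
qed

text \<open>Disjointness matters: if \<open>x\<close> were on both sides, the left side would win
  both before and after the exchange.\<close>

lemma swap_bsu_label:
  assumes \<omega>: "\<omega> \<in> carrier V" and "A \<inter> B = {}"
  shows "swap (bsu_gens V) (bsu_label V x A B \<omega>) = bsu_label V x B A (swap V \<omega>)"
proof -
  note cl = linear_mapD(3)[OF linear_map_at_side]
  have "swap (bsu_gens V) (at_star V \<omega>) = at_star V (swap V \<omega>)"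
    unfolding at_star_def linear_mapD(4)[OF s2_moduleD(2)[OF bsu] cl[OF \<omega>] cl[OF \<omega>]] swap_at_side[OF \<omega>]
    using vectorspaceD(6)[OF s2_moduleD(1)[OF bsu] cl cl] s2_moduleD(4)[OF V \<omega>] by simp
  then show ?thesis using assms(2) by (auto simp: bsu_label_def swap_at_side[OF \<omega>])
qed

text \<open>Vertex relations also contain trees with repeated leaves, where the argument for the
  symmetry relation breaks down; hence the assumption on the support.\<close>

lemma vertex_relations_bsu_tree:
  assumes "r \<in> vertex_relations V" "\<And>t. t \<in> keys r \<Longrightarrow> distinct (leaves t)"
  shows "pushforward (bsu_tree V x) r \<in> vertex_relations (bsu_gens V)"
  using assms
proof (induction rule: vertex_relations.induct)
  note lab = linear_mapD[OF linear_map_bsu_label]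
  {
    case (add v w s t)
    show ?case
      unfolding pushforward_diff pushforward_single bsu_tree_Node lab(4)[OF add(1,2)]
      by (rule vertex_relations.add[OF lab(3)[OF add(1)] lab(3)[OF add(2)]])
  next
    case (smult v c s t)
    show ?case
      unfolding pushforward_diff pushforward_single bsu_tree_Node lab(5)[OF smult(1)]
      by (rule vertex_relations.smult[OF lab(3)[OF smult(1)]])
  next
    case (swap v s t)
    show ?case
    proof (cases "Node v s t = Node (swap V v) t s")
      \<comment> \<open>The two trees coincide, so the support is empty and the assumption on leaves
        says nothing; but then the relation is zero.\<close>
      case True
      show ?thesis
        unfolding True diff_self pushforward_zero by (rule zero_in_vertex_relations[OF s2_moduleD(1)[OF bsu]])
    next
      case False
      then have "Node v s t \<in> keys
          (single (Node v s t) 1 - single (Node (swap V v) t s) (1 :: 'k))"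
        by (simp only: in_keys_iff lookup_minus lookup_single when_def) auto
      from swap.prems[OF this] have disj: "set (leaves s) \<inter> set (leaves t) = {}" by simp
      show ?thesis
        unfolding pushforward_diff pushforward_single bsu_tree_Node swap_bsu_label[OF swap.hyps disj, symmetric]
        by (rule vertex_relations.swap[OF lab(3)[OF swap.hyps]])
    qed
  next
    case (left r v t)
    obtain S where S: "\<forall>s\<in>keys r. set (leaves s) = S"
      using vertex_relations_leaves[OF left.hyps] by blast
    have "inj (\<lambda>s. Node v s t)" by (rule injI) simp
    then have "distinct (leaves s)" if "s \<in> keys r" for s
      using left.prems[of "Node v s t"] that by (simp add: keys_pushforward_inj)
    then have "pushforward (\<lambda>s. Node (bsu_label V x S (set (leaves t)) v) s (bsu_tree V x t))
        (pushforward (bsu_tree V x) r) \<in> vertex_relations (bsu_gens V)"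
      by (intro vertex_relations.left left.IH)
    also have "pushforward (\<lambda>s. Node (bsu_label V x S (set (leaves t)) v) s (bsu_tree V x t))
        (pushforward (bsu_tree V x) r) = pushforward (bsu_tree V x) (pushforward (\<lambda>s. Node v s t) r)"
      unfolding pushforward_pushforward bsu_tree_Node by (rule pushforward_cong) (use S in simp)
    finally show ?case .
  next
    case (right r v s)
    obtain S where S: "\<forall>t\<in>keys r. set (leaves t) = S"
      using vertex_relations_leaves[OF right.hyps] by blast
    have "inj (\<lambda>t. Node v s t)" by (rule injI) simp
    then have "distinct (leaves t)" if "t \<in> keys r" for t
      using right.prems[of "Node v s t"] that by (simp add: keys_pushforward_inj)
    then have "pushforward (\<lambda>t. Node (bsu_label V x (set (leaves s)) S v) (bsu_tree V x s) t)
        (pushforward (bsu_tree V x) r) \<in> vertex_relations (bsu_gens V)"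
      by (intro vertex_relations.right right.IH)
    also have "pushforward (\<lambda>t. Node (bsu_label V x (set (leaves s)) S v) (bsu_tree V x s) t)
        (pushforward (bsu_tree V x) r) = pushforward (bsu_tree V x) (pushforward (\<lambda>t. Node v s t) r)"
      unfolding pushforward_pushforward bsu_tree_Node by (rule pushforward_cong) (use S in simp)
    finally show ?case .
  }
qed

lemma bsu_tree_btrees:
  assumes "t \<in> btrees (carrier V) n"
  shows "bsu_tree V x t \<in> btrees (carrier (bsu_gens V)) n"
proof -
  have "labels t \<subseteq> carrier V \<Longrightarrow> labels (bsu_tree V x t) \<subseteq> carrier (bsu_gens V)" for t
    by (induction t) (simp_all add: bsu_tree_Node linear_mapD(3)[OF linear_map_bsu_label] del: bsu_tree.simps(2))
  then show ?thesis using assms by (simp add: btrees_def)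
qed

lemma tree_relations_bsu_tree:
  assumes "r \<in> tree_relations V n"
  shows "pushforward (bsu_tree V x) r \<in> tree_relations (bsu_gens V) n"
proof (rule tree_relations_image[OF linear_map_pushforward[OF bsu_tree_btrees] submodule_tree_relations _ assms])
  fix r assume r: "r \<in> vertex_relations V" "keys r \<subseteq> btrees (carrier V) n"
  show "pushforward (bsu_tree V x) r \<in> tree_relations (bsu_gens V) n"
    by (intro vertex_relations_subset_tree_relations vertex_relations_bsu_tree r
        keys_pushforward_subset[OF r(2) bsu_tree_btrees])
      (use r(2) btreesD(2) in blast)
qed

lemma
  shows linear_map_bsu: "is_linear (arity (free_operad V) n) (arity (free_operad (bsu_gens V)) n) (bsu V n x)"
    and bsu_tree_class: "keys p \<subseteq> btrees (carrier V) n \<Longrightarrow>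
      bsu V n x (tree_class V n p) = tree_class (bsu_gens V) n (pushforward (bsu_tree V x) p)"
proof -
  note c = submodule_tree_relations submodule_tree_relations linear_map_pushforward[OF bsu_tree_btrees]
    tree_relations_bsu_tree
  show "is_linear (arity (free_operad V) n) (arity (free_operad (bsu_gens V)) n) (bsu V n x)"
    unfolding bsu_def arity_free_operad by (rule linear_map_coset_map[OF c])
  show "bsu V n x (tree_class V n p) = tree_class (bsu_gens V) n (pushforward (bsu_tree V x) p)"
    if "keys p \<subseteq> btrees (carrier V) n"
    unfolding bsu_def tree_class_def by (rule coset_map_coset[OF c]) (use that in simp_all)
qed

subsection \<open>The bisuccessor in arity three\<close>

abbreviation (input) "mu \<equiv> single id 1"
abbreviation (input) "mu_op \<equiv> single (Transposition.transpose 1 2) 1"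

private abbreviation "black \<equiv> black_gens (regular_rep :: ('k, _) s2module) V"
private abbreviation "black_arity \<equiv> arity (free_operad black) 3"

private lemma mu_closed: "mu \<in> carrier regular_rep" "mu_op \<in> carrier regular_rep"
  by simp_all

private lemma black: "s2_module black"
  by (rule s2_module_black_gens[OF s2_module_regular_rep V])

private lemma black_closed:
  "a \<in> carrier regular_rep \<Longrightarrow> \<omega> \<in> carrier V \<Longrightarrow> black_tensor regular_rep V a \<omega> \<in> carrier black"
  using linear_mapD(3)[OF bilinear_mapD(2)[OF bilinear_map_black_tensor[OF s2_module_regular_rep V]]] .

lemma bsu_to_black_at_side:
  assumes \<omega>: "\<omega> \<in> carrier V"
  shows "bsu_to_black V (at_side V Prec \<omega>) = black_tensor regular_rep V mu \<omega>"
    and "bsu_to_black V (at_side V Succ \<omega>) = - 1 \<odot>\<^bsub>black\<^esub> black_tensor regular_rep V mu_op \<omega>"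
    and "bsu_to_black V (at_star V \<omega>) =
      black_tensor regular_rep V mu \<omega> \<oplus>\<^bsub>black\<^esub> - 1 \<odot>\<^bsub>black\<^esub> black_tensor regular_rep V mu_op \<omega>"
proof -
  have 1: "side_to_regular (single Prec 1) = (mu :: _ \<Rightarrow>\<^sub>0 'k)"
    by (simp add: side_to_regular_def lookup_single)
  have 2: "side_to_regular (single Succ 1) = - 1 \<odot>\<^bsub>regular_rep\<^esub> (mu_op :: _ \<Rightarrow>\<^sub>0 'k)"
    by (simp add: side_to_regular_def lookup_single regular_rep_def free_space_def single_uminus)
  show P: "bsu_to_black V (at_side V Prec \<omega>) = black_tensor regular_rep V mu \<omega>"
    unfolding at_side_def bsu_to_black_pure_tensor[OF V \<omega>] 1 ..
  show S: "bsu_to_black V (at_side V Succ \<omega>) = - 1 \<odot>\<^bsub>black\<^esub> black_tensor regular_rep V mu_op \<omega>"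
    unfolding at_side_def bsu_to_black_pure_tensor[OF V \<omega>] 2
    by (rule linear_mapD(5)[OF bilinear_mapD(1)[OF bilinear_map_black_tensor[OF s2_module_regular_rep V] \<omega>] mu_closed(2)])
  show "bsu_to_black V (at_star V \<omega>) =
      black_tensor regular_rep V mu \<omega> \<oplus>\<^bsub>black\<^esub> - 1 \<odot>\<^bsub>black\<^esub> black_tensor regular_rep V mu_op \<omega>"
    unfolding at_star_def linear_mapD(4)[OF linear_map_bsu_to_black[OF V] linear_mapD(3)[OF linear_map_at_side \<omega>]
        linear_mapD(3)[OF linear_map_at_side \<omega>]] P S ..
qed

text \<open>The four leaf sets are parameters that only encode which case of
  \<open>bsu_label\<close> applies at each vertex; they are later set to \<open>{x}\<close> or
  \<open>{}\<close>.\<close>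

lemma free_map_bsu_manin_circ:
  assumes \<omega>: "\<omega> \<in> carrier V" and \<nu>: "\<nu> \<in> carrier V"
    and lab: "bsu_tree V x (manin_tree u \<omega> \<nu>) = manin_tree u (bsu_label V x A B \<omega>) (bsu_label V x A' B' \<nu>)"
  shows "free_map black (bsu_to_black V) 3 (bsu V 3 x (manin_circ V u \<omega> \<nu>)) =
    manin_circ black u (bsu_to_black V (bsu_label V x A B \<omega>)) (bsu_to_black V (bsu_label V x A' B' \<nu>))"
proof -
  have "bsu V 3 x (manin_circ V u \<omega> \<nu>) = manin_circ (bsu_gens V) u (bsu_label V x A B \<omega>) (bsu_label V x A' B' \<nu>)"
    unfolding manin_circ_def by (subst bsu_tree_class) (simp_all add: manin_tree_btrees \<omega> \<nu> lab)
  also have "free_map black (bsu_to_black V) 3 \<dots> =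
      manin_circ black u (bsu_to_black V (bsu_label V x A B \<omega>)) (bsu_to_black V (bsu_label V x A' B' \<nu>))"
    unfolding manin_circ_def
    using free_map_tree_class[OF linear_map_bsu_to_black[OF V] bsu_to_black_swap[OF V],
        of "single (manin_tree u (bsu_label V x A B \<omega>) (bsu_label V x A' B' \<nu>)) 1" 3]
    by (cases u) (simp_all add: comb_tree_btrees linear_mapD(3)[OF linear_map_bsu_label] \<omega> \<nu>)
  finally show ?thesis .
qed

private lemma circ_simps:
  assumes "a \<in> carrier black" "b \<in> carrier black"
  shows "manin_circ black u a b \<in> carrier black_arity"
    and "manin_circ black u (k \<odot>\<^bsub>black\<^esub> a) b = k \<odot>\<^bsub>black_arity\<^esub> manin_circ black u a b"
    and "manin_circ black u a (k \<odot>\<^bsub>black\<^esub> b) = k \<odot>\<^bsub>black_arity\<^esub> manin_circ black u a b"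
    and "b' \<in> carrier black \<Longrightarrow> manin_circ black u a (b \<oplus>\<^bsub>black\<^esub> b') =
      manin_circ black u a b \<oplus>\<^bsub>black_arity\<^esub> manin_circ black u a b'"
  using linear_mapD(3,5)[OF bilinear_mapD(1)[OF bilinear_map_manin_circ[OF black] assms(2)] assms(1)]
    linear_mapD(4,5)[OF bilinear_mapD(2)[OF bilinear_map_manin_circ[OF black] assms(1)] assms(2)]
  by auto

lemma free_map_bsu_value:
  assumes \<omega>: "\<omega> \<in> carrier V" and \<nu>: "\<nu> \<in> carrier V" and x: "leaf_types x u u' u''"
  defines "f \<equiv> \<lambda>v. free_map black (bsu_to_black V) 3 (bsu V 3 x (manin_circ V v \<omega> \<nu>))"
    and "c \<equiv> \<lambda>v a b. manin_circ black v (black_tensor regular_rep V a \<omega>) (black_tensor regular_rep V b \<nu>)"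
  shows "f u = c u mu mu"
    and "f u' = - 1 \<odot>\<^bsub>black_arity\<^esub> c u' mu_op mu \<oplus>\<^bsub>black_arity\<^esub> c u' mu_op mu_op"
    and "f u'' = - 1 \<odot>\<^bsub>black_arity\<^esub> c u'' mu mu_op"
proof -
  have cl: "black_tensor regular_rep V mu \<omega> \<in> carrier black" "black_tensor regular_rep V mu_op \<omega> \<in> carrier black"
    "black_tensor regular_rep V mu \<nu> \<in> carrier black" "black_tensor regular_rep V mu_op \<nu> \<in> carrier black"
    using black_closed mu_closed \<omega> \<nu> by blast+
  note sp = s2_moduleD(1)[OF black] linear_mapD(2)[OF linear_map_tree_class, of black 3]
  have 1: "f u = manin_circ black u (bsu_to_black V (at_side V Prec \<omega>)) (bsu_to_black V (at_side V Prec \<nu>))"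
    unfolding f_def
    using free_map_bsu_manin_circ[OF \<omega> \<nu>, of x u "{x}" "{}" "{x}" "{}"] x by (auto simp: leaf_types_def bsu_label_def)
  have 2: "f u' = manin_circ black u' (bsu_to_black V (at_side V Succ \<omega>)) (bsu_to_black V (at_star V \<nu>))"
    unfolding f_def
    using free_map_bsu_manin_circ[OF \<omega> \<nu>, of x u' "{}" "{x}" "{}" "{}"] x by (auto simp: leaf_types_def bsu_label_def)
  have 3: "f u'' = manin_circ black u'' (bsu_to_black V (at_side V Prec \<omega>)) (bsu_to_black V (at_side V Succ \<nu>))"
    unfolding f_def
    using free_map_bsu_manin_circ[OF \<omega> \<nu>, of x u'' "{x}" "{}" "{}" "{x}"] x by (auto simp: leaf_types_def bsu_label_def)
  note val = bsu_to_black_at_side[OF \<omega>] bsu_to_black_at_side[OF \<nu>]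
  show "f u = c u mu mu" unfolding 1 val c_def ..
  show "f u'' = - 1 \<odot>\<^bsub>black_arity\<^esub> c u'' mu mu_op" unfolding 3 val c_def by (rule circ_simps(3)[OF cl(1,4)])
  \<comment> \<open>The outer \<open>Succ\<close> and the second summand of the star label both
    carry a sign, so the signs cancel in the term with two copies of \<open>mu_op\<close>.\<close>
  have "manin_circ black u' (- 1 \<odot>\<^bsub>black\<^esub> a) (b \<oplus>\<^bsub>black\<^esub> - 1 \<odot>\<^bsub>black\<^esub> b') =
      - 1 \<odot>\<^bsub>black_arity\<^esub> manin_circ black u' a b \<oplus>\<^bsub>black_arity\<^esub> manin_circ black u' a b'"
    if a: "a \<in> carrier black" and b: "b \<in> carrier black" and b': "b' \<in> carrier black" for a b b'
  proof -
    have nb': "- 1 \<odot>\<^bsub>black\<^esub> b' \<in> carrier black" by (rule vectorspaceD(4)[OF sp(1) b'])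
    have "- 1 \<odot>\<^bsub>black_arity\<^esub> (- 1 \<odot>\<^bsub>black_arity\<^esub> manin_circ black u' a b') = manin_circ black u' a b'"
      using vectorspaceD(10)[OF sp(2) circ_simps(1)[OF a b'], of "- 1" "- 1"]
        vectorspaceD(11)[OF sp(2) circ_simps(1)[OF a b']] by simp
    then show ?thesis
      unfolding circ_simps(2)[OF a vectorspaceD(2)[OF sp(1) b nb']] circ_simps(4)[OF a b nb'] circ_simps(3)[OF a b']
        vectorspaceD(15)[OF sp(2) circ_simps(1)[OF a b] vectorspaceD(4)[OF sp(2) circ_simps(1)[OF a b']]] by simp
  qed
  from this[OF cl(2,3,4)]
  show "f u' = - 1 \<odot>\<^bsub>black_arity\<^esub> c u' mu_op mu \<oplus>\<^bsub>black_arity\<^esub> c u' mu_op mu_op"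
    unfolding 2 val c_def .
qed

end

section \<open>The relations of \<open>PreLie\<close>\<close>

text \<open>The relator with its distinguished input \<open>x\<close> as a parameter, so that the
  symmetric group acts by permuting the parameters.\<close>

definition prelie_tree :: "nat \<Rightarrow> nat \<Rightarrow> nat \<Rightarrow> ((nat \<Rightarrow> nat) \<Rightarrow>\<^sub>0 'k::field) btree \<Rightarrow>\<^sub>0 'k" where
  "prelie_tree x y z =
    single (comb_tree x y z mu mu) 1
    - single (Node mu (Leaf x) (Node mu (Leaf y) (Leaf z))) 1
    - (single (comb_tree x z y mu mu) 1
       - single (Node mu (Leaf x) (Node mu (Leaf z) (Leaf y))) 1)"

definition prelie_class :: "nat \<Rightarrow> nat \<Rightarrow> nat \<Rightarrow> (((nat \<Rightarrow> nat) \<Rightarrow>\<^sub>0 'k::field) btree \<Rightarrow>\<^sub>0 'k) set" where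
  "prelie_class x y z = tree_class regular_rep 3 (prelie_tree x y z)"

abbreviation (input) "prelie_free \<equiv> free_operad (regular_rep :: ('k::field, (nat \<Rightarrow> nat) \<Rightarrow>\<^sub>0 'k) s2module)"

lemma prelie_relator_tree: "prelie_relator = prelie_tree 1 2 3"
  by (simp add: prelie_relator_def prelie_tree_def Let_def)

lemma is_perm3_rotate: "is_perm3 x y z \<Longrightarrow> is_perm3 y z x" "is_perm3 x y z \<Longrightarrow> is_perm3 z x y"
  by (auto simp: is_perm3_def)

lemma is_perm3_permutes:
  assumes "\<pi> permutes {1..3}" "is_perm3 x y z"
  shows "is_perm3 (\<pi> x) (\<pi> y) (\<pi> z)"
  using assms permutes_image[OF assms(1)] inj_eq[OF permutes_inj[OF assms(1)]]
  unfolding is_perm3_def by (metis (no_types, lifting) distinct_length_2_or_more distinct_singleton image_empty image_insert)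

lemma mu_regular_rep: "mu \<in> carrier regular_rep" "mu_op \<in> carrier regular_rep"
  by simp_all

lemma swap_mu: "swap regular_rep mu = mu_op" "swap regular_rep mu_op = mu"
  by (simp_all add: regular_rep_def)

lemma keys_prelie_tree:
  assumes "is_perm3 x y z"
  shows "keys (prelie_tree x y z) \<subseteq> btrees (carrier regular_rep) 3"
proof -
  note p = assms is_perm3_rotate[OF assms] is_perm3_swap[OF is_perm3_rotate(2)[OF assms]]
    is_perm3_swap[OF is_perm3_rotate(1)[OF assms]]
  show ?thesis
    unfolding prelie_tree_def
    by (intro keys_minus_subset keys_single_subset comb_tree_btrees mu_regular_rep p)
qed

lemma prelie_class_closed: "is_perm3 x y z \<Longrightarrow> prelie_class x y z \<in> carrier (arity prelie_free 3)"
  unfolding prelie_class_def carrier_free_operad using keys_prelie_tree by blast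

lemma act_prelie_class:
  assumes "\<sigma> permutes {1..3}" "is_perm3 x y z"
  shows "act prelie_free 3 \<sigma> (prelie_class x y z) =
    prelie_class (inv_into UNIV \<sigma> x) (inv_into UNIV \<sigma> y) (inv_into UNIV \<sigma> z)"
  unfolding prelie_class_def act_tree_class[OF assms(1) keys_prelie_tree[OF assms(2)]]
  by (simp add: prelie_tree_def pushforward_diff)

text \<open>The relator is antisymmetric in its last two inputs. This leaves, up to sign, three
  classes out of six, one for each distinguished input.\<close>

lemma prelie_class_swap:
  assumes "is_perm3 x y z"
  shows "prelie_class x z y = - (1 :: 'k::field) \<odot>\<^bsub>arity prelie_free 3\<^esub> prelie_class x y z"
proof -
  let ?t = "prelie_tree x y z :: _ \<Rightarrow>\<^sub>0 'k"
  have "prelie_tree x z y = - 1 \<odot>\<^bsub>free_space (btrees (carrier regular_rep) 3)\<^esub> ?t"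
    by (simp add: prelie_tree_def)
  moreover have "?t \<in> carrier (free_space (btrees (carrier regular_rep) 3))"
    unfolding free_space_simps by (rule keys_prelie_tree[OF assms])
  ultimately show ?thesis
    unfolding prelie_class_def by (simp only: linear_mapD(5)[OF linear_map_tree_class])
qed

abbreviation (input) "prelie_basis \<equiv> {prelie_class 1 2 3, prelie_class 2 3 1, prelie_class 3 1 2}"

lemma prelie_basis_subset: "prelie_basis \<subseteq> carrier (arity prelie_free 3)"
  using prelie_class_closed[OF is_perm3_simps(1)] prelie_class_closed[OF is_perm3_simps(2)]
    prelie_class_closed[OF is_perm3_simps(3)] by simp

lemma prelie_class_in_span:
  assumes "is_perm3 x y z"
  shows "prelie_class x y z \<in> lin_span (arity (free_operad (regular_rep :: ('k::field, _) s2module)) 3) prelie_basis"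
proof -
  note sp = linear_mapD(2)[OF linear_map_tree_class, of "regular_rep :: ('k, _) s2module" 3]
  note sub = submodule_lin_span[OF sp prelie_basis_subset] and sup = lin_span_superset[OF sp prelie_basis_subset]
  have neg: "prelie_class x z y \<in> lin_span (arity (free_operad (regular_rep :: ('k, _) s2module)) 3) prelie_basis"
    if "is_perm3 x y z" "(prelie_class x y z :: (_ \<Rightarrow>\<^sub>0 'k) set) \<in> prelie_basis" for x y z
    unfolding prelie_class_swap[OF that(1)] by (rule submoduleD(6)[OF sub subsetD[OF sup that(2)]])
  show ?thesis
    using assms
  proof (cases rule: is_perm3_cases)
    case 2
    show ?thesis unfolding 2 by (rule neg) simp_all
  next
    case 4
    show ?thesis unfolding 4 by (rule neg) simp_all
  next
    case 6
    show ?thesis unfolding 6 by (rule neg) simp_all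
  qed (use sup in simp_all)
qed

lemma rels_PreLie:
  "rels PreLie 3 = \<Inter>{S. sym_submodule prelie_free 3 S \<and> prelie_class 1 2 3 \<in> S}"
  by (simp add: PreLie_def prelie_class_def prelie_relator_tree)

text \<open>The relations form the smallest symmetric submodule containing the relator. The span is
  such a submodule, because the action permutes the six classes.\<close>

lemma rels_PreLie_subset:
  "rels PreLie 3 \<subseteq> lin_span (arity (free_operad (regular_rep :: ('k::field, _) s2module)) 3) prelie_basis"
proof -
  note sp = linear_mapD(2)[OF linear_map_tree_class, of "regular_rep :: ('k, _) s2module" 3]
  note sub = submodule_lin_span[OF sp prelie_basis_subset]
  have "sym_submodule (free_operad (regular_rep :: ('k, _) s2module)) 3 (lin_span (arity prelie_free 3) prelie_basis)"
    unfolding sym_submodule_def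
  proof (intro conjI allI impI ballI sub)
    fix \<sigma> :: "nat \<Rightarrow> nat" and p :: "(((nat \<Rightarrow> nat) \<Rightarrow>\<^sub>0 'k) btree \<Rightarrow>\<^sub>0 'k) set" assume \<sigma>: "\<sigma> permutes {1..3}" and p: "p \<in> lin_span (arity prelie_free 3) prelie_basis"
    have "act (free_operad (regular_rep :: ('k, _) s2module)) 3 \<sigma> (prelie_class x y z) \<in> lin_span (arity prelie_free 3) prelie_basis"
      if "is_perm3 x y z" for x y z
      unfolding act_prelie_class[OF \<sigma> that]
      by (rule prelie_class_in_span[OF is_perm3_permutes[OF permutes_inv[OF \<sigma>] that]])
    then have "act (free_operad (regular_rep :: ('k, _) s2module)) 3 \<sigma> ` prelie_basis \<subseteq> lin_span (arity prelie_free 3) prelie_basis"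
      using is_perm3_simps(1-3) by blast
    then show "act prelie_free 3 \<sigma> p \<in> lin_span (arity prelie_free 3) prelie_basis"
      by (rule lin_span_image[OF operad.act_linear[OF operad_free_operad \<sigma>] sub prelie_basis_subset _ p])
  qed
  moreover have "prelie_class 1 2 3 \<in> lin_span (arity (free_operad (regular_rep :: ('k, _) s2module)) 3) prelie_basis"
    by (rule prelie_class_in_span) simp
  ultimately show ?thesis unfolding rels_PreLie by blast
qed

lemma prelie_basis_rels: "prelie_basis \<subseteq> rels PreLie 3"
proof -
  \<comment> \<open>A three-cycle, which moves the distinguished input through all three
    positions.\<close>
  define \<pi> where "\<pi> = Transposition.transpose 1 2 \<circ> Transposition.transpose 2 (3 :: nat)"
  have \<pi>: "\<pi> permutes {1..3}"
    unfolding \<pi>_def by (intro permutes_compose permutes_swap_id) auto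
  have val: "\<pi> 1 = 2" "\<pi> 2 = 3" "\<pi> 3 = 1"
    by (simp_all add: \<pi>_def Transposition.transpose_def)
  have inv: "inv_into UNIV (inv_into UNIV \<pi>) = \<pi>"
    by (rule inv_inv_eq[OF permutes_bij[OF \<pi>]])
  have "prelie_basis \<subseteq> S" if S: "sym_submodule prelie_free 3 S" "prelie_class 1 2 3 \<in> S" for S :: "(((nat \<Rightarrow> nat) \<Rightarrow>\<^sub>0 'a) btree \<Rightarrow>\<^sub>0 'a) set set"
  proof -
    \<comment> \<open>The right action relabels by inverses, so acting with the inverse of
      \<open>\<pi>\<close> relabels the leaves by \<open>\<pi>\<close>.\<close>
    have act: "prelie_class (\<pi> x) (\<pi> y) (\<pi> z) \<in> S" if "prelie_class x y z \<in> S" "is_perm3 x y z" for x y z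
      using S(1) act_prelie_class[OF permutes_inv[OF \<pi>] that(2)] permutes_inv[OF \<pi>] that(1)
      unfolding sym_submodule_def inv by metis
    have "prelie_class 2 3 1 \<in> S" using act[OF S(2)] val by simp
    moreover from act[OF this] have "prelie_class 3 1 2 \<in> S" using val by simp
    ultimately show ?thesis using S(2) by blast
  qed
  then show ?thesis unfolding rels_PreLie by blast
qed

text \<open>The four trees are brought into leaf orders that are rotations of
  \<open>x, y, z\<close>. An outer \<open>mu_op\<close> records an exchange at the root, an inner
  one an exchange at the inner vertex.\<close>

lemma prelie_class_left_comb:
  assumes p: "is_perm3 x y z"
  defines "T \<equiv> arity (free_operad (regular_rep :: ('k::field, _) s2module)) 3"
    and "c \<equiv> left_comb (regular_rep :: ('k::field, _) s2module)"
  shows "prelie_class x y z =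
    (c x y z mu mu \<ominus>\<^bsub>T\<^esub> c y z x mu_op mu) \<ominus>\<^bsub>T\<^esub> (c z x y mu mu_op \<ominus>\<^bsub>T\<^esub> c y z x mu_op mu_op)"
proof -
  note p2 = is_perm3_rotate(1)[OF p] and p3 = is_perm3_rotate(2)[OF p]
  note R = s2_module_regular_rep and m = mu_regular_rep
  note lin = linear_map_tree_class[of "regular_rep :: ('k, _) s2module" 3]
  have bt: "comb_tree x y z mu mu \<in> btrees (carrier regular_rep) 3"
    "Node mu (Leaf x) (Node mu (Leaf y) (Leaf z)) \<in> btrees (carrier regular_rep) 3"
    "comb_tree x z y mu mu \<in> btrees (carrier regular_rep) 3"
    "Node mu (Leaf x) (Node mu (Leaf z) (Leaf y)) \<in> btrees (carrier regular_rep) 3"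
    by (intro comb_tree_btrees m p p2 is_perm3_swap[OF p2] is_perm3_swap[OF p3])+
  have diff: "tree_class regular_rep 3 (p - q) = tree_class regular_rep 3 p \<ominus>\<^bsub>T\<^esub> tree_class regular_rep 3 q"
    if "keys p \<subseteq> btrees (carrier regular_rep) 3" "keys q \<subseteq> btrees (carrier regular_rep) 3"
    for p q :: "((nat \<Rightarrow> nat) \<Rightarrow>\<^sub>0 'k) btree \<Rightarrow>\<^sub>0 'k"
    using linear_mapD(6)[OF lin, of p q] that unfolding T_def by simp
  have "c x z y mu mu = c z x y mu mu_op"
    unfolding c_def left_comb_swap[OF R is_perm3_swap[OF p3] m(1,1)] swap_mu ..
  moreover have "tree_class regular_rep 3 (single (Node mu (Leaf x) (Node mu (Leaf y) (Leaf z))) 1) = c y z x mu_op mu"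
    unfolding c_def tree_class_right_comb[OF R p2 m(1,1)] swap_mu ..
  moreover have "tree_class regular_rep 3 (single (Node mu (Leaf x) (Node mu (Leaf z) (Leaf y))) 1) = c y z x mu_op mu_op"
    unfolding c_def tree_class_right_comb[OF R is_perm3_swap[OF p2] m(1,1)] swap_mu
      left_comb_swap[OF R is_perm3_swap[OF p2] m(2,1)] ..
  ultimately show ?thesis
    unfolding prelie_class_def prelie_tree_def
    by (simp only: diff keys_minus_subset keys_single_subset bt c_def left_comb_def)
qed

text \<open>For these triples the leaf orders in \<open>prelie_class_left_comb\<close> are those of
  the Manin types.\<close>

definition cyclic3 :: "(nat \<times> nat \<times> nat) set" where
  "cyclic3 = {(1, 2, 3), (2, 3, 1), (3, 1, 2)}"

lemma cyclic3_is_perm3: "(x, y, z) \<in> cyclic3 \<Longrightarrow> is_perm3 x y z"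
  by (auto simp: cyclic3_def)

lemma prelie_basis_cyclic3: "a \<in> prelie_basis \<longleftrightarrow> (\<exists>x y z. (x, y, z) \<in> cyclic3 \<and> a = prelie_class x y z)"
  unfolding cyclic3_def by blast

lemma prelie_class_manin_circ:
  assumes "(x, y, z) \<in> cyclic3"
  defines "T \<equiv> arity (free_operad (regular_rep :: ('k::field, _) s2module)) 3"
    and "c \<equiv> manin_circ (regular_rep :: ('k::field, _) s2module)"
  obtains u u' u'' where "leaf_types x u u' u''"
    "prelie_class x y z = (c u mu mu \<ominus>\<^bsub>T\<^esub> c u' mu_op mu) \<ominus>\<^bsub>T\<^esub> (c u'' mu mu_op \<ominus>\<^bsub>T\<^esub> c u' mu_op mu_op)"
proof -
  note eq = prelie_class_left_comb[OF cyclic3_is_perm3[OF assms(1)], where 'k = 'k, folded T_def]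
  consider "x = 1" "y = 2" "z = 3" | "x = 2" "y = 3" "z = 1" | "x = 3" "y = 1" "z = 2"
    using assms(1) unfolding cyclic3_def by blast
  then show ?thesis
  proof cases
    case 1
    show ?thesis
      by (rule that[of Type_I Type_II Type_III]) (use eq in \<open>simp_all only: 1 c_def manin_circ_left_comb leaf_types_def insert_iff simp_thms\<close>)
  next
    case 2
    show ?thesis
      by (rule that[of Type_II Type_III Type_I]) (use eq in \<open>simp_all only: 2 c_def manin_circ_left_comb leaf_types_def insert_iff simp_thms\<close>)
  next
    case 3
    show ?thesis
      by (rule that[of Type_III Type_I Type_II]) (use eq in \<open>simp_all only: 3 c_def manin_circ_left_comb leaf_types_def insert_iff simp_thms\<close>)
  qed
qed

section \<open>Comparison of the relations\<close>

context
  fixes V :: "('k::field, 'v) s2module"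
  assumes V: "s2_module V"
begin

private abbreviation "R \<equiv> regular_rep :: ('k, _) s2module"
private abbreviation "B \<equiv> black_gens R V"
private abbreviation "TR \<equiv> arity (free_operad R) 3"
private abbreviation "TV \<equiv> arity (free_operad V) 3"
private abbreviation "TB \<equiv> arity (free_operad B) 3"

private lemma spaces: "is_space TR" "is_space TV" "is_space TB"
  by (rule linear_mapD(2)[OF linear_map_tree_class])+

private lemma psi:
  shows psi_linear: "is_linear (tensor_space TR TV) TB (manin_psi R V)"
    and psi_manin_circ: "\<alpha> \<in> carrier R \<Longrightarrow> \<beta> \<in> carrier R \<Longrightarrow> \<omega> \<in> carrier V \<Longrightarrow> \<nu> \<in> carrier V \<Longrightarrow>
      manin_psi R V (pure_tensor TR TV (manin_circ R v \<alpha> \<beta>) (manin_circ V u \<omega> \<nu>)) =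
      (if v = u then manin_circ B v (black_tensor R V \<alpha> \<omega>) (black_tensor R V \<beta> \<nu>) else \<zero>\<^bsub>TB\<^esub>)"
  using is_manin_psi_manin_psi[OF s2_module_regular_rep V] unfolding is_manin_psi_def by blast+

private lemma psi_pure_linear:
  "b \<in> carrier TV \<Longrightarrow> is_linear TR TB (\<lambda>a. manin_psi R V (pure_tensor TR TV a b))"
  "a \<in> carrier TR \<Longrightarrow> is_linear TV TB (\<lambda>b. manin_psi R V (pure_tensor TR TV a b))"
  using linear_map_comp[OF pure_tensor_linear(1)[OF spaces(1,2)] psi_linear]
    linear_map_comp[OF pure_tensor_linear(2)[OF spaces(1,2)] psi_linear] by blast+

text \<open>\<open>\<Psi>\<close> kills the summands of the relator whose type differs from that of
  the second factor. These are the three patterns of zeros that remain, for the types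
  \<open>u\<close>, \<open>u'\<close> and \<open>u''\<close> in this order.\<close>

private lemma minus_simps:
  assumes "a \<in> carrier TB"
  shows "(a \<ominus>\<^bsub>TB\<^esub> \<zero>\<^bsub>TB\<^esub>) \<ominus>\<^bsub>TB\<^esub> (\<zero>\<^bsub>TB\<^esub> \<ominus>\<^bsub>TB\<^esub> \<zero>\<^bsub>TB\<^esub>) = a"
    and "b \<in> carrier TB \<Longrightarrow> (\<zero>\<^bsub>TB\<^esub> \<ominus>\<^bsub>TB\<^esub> a) \<ominus>\<^bsub>TB\<^esub> (\<zero>\<^bsub>TB\<^esub> \<ominus>\<^bsub>TB\<^esub> b) = - 1 \<odot>\<^bsub>TB\<^esub> a \<oplus>\<^bsub>TB\<^esub> b"
    and "(\<zero>\<^bsub>TB\<^esub> \<ominus>\<^bsub>TB\<^esub> \<zero>\<^bsub>TB\<^esub>) \<ominus>\<^bsub>TB\<^esub> (a \<ominus>\<^bsub>TB\<^esub> \<zero>\<^bsub>TB\<^esub>) = - 1 \<odot>\<^bsub>TB\<^esub> a"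
proof -
  note D = vectorspaceD[OF spaces(3)]
  have z: "\<zero>\<^bsub>TB\<^esub> \<ominus>\<^bsub>TB\<^esub> \<zero>\<^bsub>TB\<^esub> = \<zero>\<^bsub>TB\<^esub>" and r: "c \<ominus>\<^bsub>TB\<^esub> \<zero>\<^bsub>TB\<^esub> = c" and l: "\<zero>\<^bsub>TB\<^esub> \<ominus>\<^bsub>TB\<^esub> c = - 1 \<odot>\<^bsub>TB\<^esub> c"
    if "c \<in> carrier TB" for c
    using that by (simp_all add: D(1,4,8,9,13,16))
  show "(a \<ominus>\<^bsub>TB\<^esub> \<zero>\<^bsub>TB\<^esub>) \<ominus>\<^bsub>TB\<^esub> (\<zero>\<^bsub>TB\<^esub> \<ominus>\<^bsub>TB\<^esub> \<zero>\<^bsub>TB\<^esub>) = a"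
    "(\<zero>\<^bsub>TB\<^esub> \<ominus>\<^bsub>TB\<^esub> \<zero>\<^bsub>TB\<^esub>) \<ominus>\<^bsub>TB\<^esub> (a \<ominus>\<^bsub>TB\<^esub> \<zero>\<^bsub>TB\<^esub>) = - 1 \<odot>\<^bsub>TB\<^esub> a"
    using assms z[OF assms] r[OF assms] l[OF assms] by simp_all
  show "(\<zero>\<^bsub>TB\<^esub> \<ominus>\<^bsub>TB\<^esub> a) \<ominus>\<^bsub>TB\<^esub> (\<zero>\<^bsub>TB\<^esub> \<ominus>\<^bsub>TB\<^esub> b) = - 1 \<odot>\<^bsub>TB\<^esub> a \<oplus>\<^bsub>TB\<^esub> b" if b: "b \<in> carrier TB"
    unfolding l[OF assms] l[OF b] D(16)[OF D(4)[OF assms] D(4)[OF b]]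
    using D(10)[OF b, of "- 1" "- 1"] D(11)[OF b] by simp
qed

text \<open>Both sides are linear in \<open>b\<close>, so \<open>b\<close> may be taken as a
  \<open>manin_circ\<close> of some type. \<open>\<Psi>\<close> then keeps the summands of the
  relator of that type, and they are the values in \<open>free_map_bsu_value\<close>.\<close>

lemma psi_prelie_class:
  assumes xyz: "(x, y, z) \<in> cyclic3" and b: "b \<in> carrier TV"
  shows "manin_psi R V (pure_tensor TR TV (prelie_class x y z) b) = free_map B (bsu_to_black V) 3 (bsu V 3 x b)"
proof -
  obtain u u' u'' where x: "leaf_types x u u' u''" and r: "prelie_class x y z =
      (manin_circ R u mu mu \<ominus>\<^bsub>TR\<^esub> manin_circ R u' mu_op mu) \<ominus>\<^bsub>TR\<^esub>
      (manin_circ R u'' mu mu_op \<ominus>\<^bsub>TR\<^esub> manin_circ R u' mu_op mu_op)"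
    by (rule prelie_class_manin_circ[OF xyz])
  note circR = manin_circ_closed[OF s2_module_regular_rep]
  have types: "v = u \<or> v = u' \<or> v = u''" "u \<noteq> u'" "u \<noteq> u''" "u' \<noteq> u''" for v
    using x by (cases v; auto simp: leaf_types_def)+
  show ?thesis
    proof (rule linear_map_eq_on_manin_circ[OF V _ _ _ b])
      show "is_linear TV TB (\<lambda>b. manin_psi R V (pure_tensor TR TV (prelie_class x y z) b))"
        by (rule psi_pure_linear(2)[OF prelie_class_closed[OF cyclic3_is_perm3[OF xyz]]])
      show "is_linear TV TB (\<lambda>b. free_map B (bsu_to_black V) 3 (bsu V 3 x b))"
        by (rule linear_map_comp[OF linear_map_bsu[OF V] linear_map_free_map[OF linear_map_bsu_to_black[OF V] bsu_to_black_swap[OF V]]])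
      fix v \<omega> \<nu> assume \<omega>: "\<omega> \<in> carrier V" and \<nu>: "\<nu> \<in> carrier V"
      let ?P = "\<lambda>a. manin_psi R V (pure_tensor TR TV a (manin_circ V v \<omega> \<nu>))"
      have P: "is_linear TR TB ?P" by (rule psi_pure_linear(1)[OF manin_circ_closed[OF V \<omega> \<nu>]])
      note D = vectorspaceD(3)[OF spaces(1)] and m = mu_regular_rep
      have "?P (prelie_class x y z) =
          (?P (manin_circ R u mu mu) \<ominus>\<^bsub>TB\<^esub> ?P (manin_circ R u' mu_op mu)) \<ominus>\<^bsub>TB\<^esub>
          (?P (manin_circ R u'' mu mu_op) \<ominus>\<^bsub>TB\<^esub> ?P (manin_circ R u' mu_op mu_op))"
        unfolding r by (simp only: linear_mapD(6)[OF P] circR m D)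
      also have "\<dots> = free_map B (bsu_to_black V) 3 (bsu V 3 x (manin_circ V v \<omega> \<nu>))"
      proof -
        have cl: "manin_circ B w (black_tensor R V \<alpha> \<omega>) (black_tensor R V \<beta> \<nu>) \<in> carrier TB"
          if "\<alpha> \<in> carrier R" "\<beta> \<in> carrier R" for w \<alpha> \<beta>
          using manin_circ_closed[OF s2_module_black_gens[OF s2_module_regular_rep V]]
            linear_mapD(3)[OF bilinear_mapD(2)[OF bilinear_map_black_tensor[OF s2_module_regular_rep V]]] that \<omega> \<nu> by blast
        note val = free_map_bsu_value[OF V \<omega> \<nu> x]
        consider "v = u" | "v = u'" | "v = u''" using types(1) by blast
        then show ?thesis
        proof cases
          case 1
          then show ?thesis
            using types(2-4) by (simp only: psi_manin_circ m \<omega> \<nu> if_True if_False simp_thms minus_simps cl val not_sym)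
        next
          case 2
          then show ?thesis
            using types(2-4) not_sym[OF types(4)]
            by (simp only: psi_manin_circ m \<omega> \<nu> if_True if_False simp_thms minus_simps cl val not_sym)
        next
          case 3
          then show ?thesis
            using types(2-4) by (simp only: psi_manin_circ m \<omega> \<nu> if_True if_False simp_thms minus_simps cl val not_sym)
        qed
      qed
      finally show "?P (prelie_class x y z) = free_map B (bsu_to_black V) 3 (bsu V 3 x (manin_circ V v \<omega> \<nu>))" .
    qed
qed

end

lemma rels_black_product:
  "rels (PreLie \<bullet>\<^sub>M P) n = (if n = 3
    then manin_psi regular_rep (gens P) ` tensor_subspace (arity (free_operad regular_rep) 3)
      (arity (free_operad (gens P)) 3) (rels PreLie 3) (rels P 3) else {})"
  by (simp add: black_product_def PreLie_def)

theorem theorem3p2: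
  fixes P :: "('k::field, 'v) presentation"
  assumes "binary_quadratic P"
    and "vectorspace.fin_dim class_ring (gens P)"
  shows "operad_isomorphic (operad_of (bisuccessor P)) (operad_of (PreLie \<bullet>\<^sub>M P))"
proof -
  define V where "V = gens P"
  let ?R = "regular_rep :: ('k, _) s2module" and ?A = "bsu_gens V"
  let ?B = "black_gens ?R V"
  let ?TR = "arity (free_operad ?R) 3" and ?TV = "arity (free_operad V) 3" and ?TB = "arity (free_operad ?B) 3"
  let ?f = "free_map ?B (bsu_to_black V)"
  let ?rA = "rels (bisuccessor P)" and ?rB = "rels (PreLie \<bullet>\<^sub>M P)"
  let ?IA = "generated_ideal (free_operad ?A) ?rA" and ?IB = "generated_ideal (free_operad ?B) ?rB"
  have V: "s2_module V" and P3: "is_subspace (rels P 3) ?TV"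
    and P0: "\<And>n. n \<noteq> 3 \<Longrightarrow> rels P n \<subseteq> {\<zero>\<^bsub>arity (free_operad V) n\<^esub>}"
    using assms(1) by (auto simp: binary_quadratic_def sym_submodule_def V_def)
  have sp: "is_space (arity (free_operad W) n)" for W :: "('k, 'w) s2module" and n
    by (rule linear_mapD(2)[OF linear_map_tree_class])
  have gA: "gens (bisuccessor P) = ?A" and gB: "gens (PreLie \<bullet>\<^sub>M P) = ?B"
    by (simp_all add: bisuccessor_def black_product_def PreLie_def V_def)
  have rA: "?rA n = {bsu V n x r | x r. x \<in> {1..n} \<and> r \<in> rels P n}" for n
    by (simp add: bisuccessor_def V_def)
  have Pcl: "r \<in> carrier (arity (free_operad V) n)" if "r \<in> rels P n" for n r
    using that P0[of n] submoduleD(4)[OF P3] vectorspaceD(1)[OF sp[of V n]] by (cases "n = 3") auto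
  have A: "?rA n \<subseteq> carrier (arity (free_operad ?A) n)" for n
    unfolding rA using linear_mapD(3)[OF linear_map_bsu[OF V] Pcl] by blast
  have Rcl: "rels PreLie 3 \<subseteq> carrier ?TR"
    using rels_PreLie_subset lin_span_least[OF submodule_carrier[OF sp[of ?R 3]] prelie_basis_subset] by (rule order_trans)
  let ?psi = "manin_psi ?R V"
  have psi: "is_linear (tensor_space ?TR ?TV) ?TB ?psi"
    using is_manin_psi_manin_psi[OF s2_module_regular_rep V] unfolding is_manin_psi_def by blast
  let ?S = "{pure_tensor ?TR ?TV a b | a b. a \<in> rels PreLie 3 \<and> b \<in> rels P 3}"
  have S: "?S \<subseteq> carrier (tensor_space ?TR ?TV)"
    using pure_tensor_closed[OF sp[of ?R 3] sp[of V 3]] Rcl Pcl by blast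
  have rB: "?rB n = (if n = 3 then ?psi ` lin_span (tensor_space ?TR ?TV) ?S else {})" for n
    unfolding rels_black_product tensor_subspace_def V_def ..
  note tsp = vectorspace_tensor_space[OF sp[of ?R 3] sp[of V 3]]
  have Bcl: "?rB n \<subseteq> carrier (arity (free_operad ?B) n)" for n
    using lin_span_least[OF submodule_carrier[OF tsp] S] linear_mapD(3)[OF psi] unfolding rB by auto
  note opA = operad_free_operad[of ?A] and opB = operad_free_operad[of ?B]
  note iso = operad_iso_bsu_black[OF V]
  note idA = operad_ideal_generated_ideal[OF opA A] and idB = operad_ideal_generated_ideal[OF opB Bcl]
  have f: "is_linear (arity (free_operad ?A) n) (arity (free_operad ?B) n) (?f n)" for n
    by (rule operad_isoD(1)[OF iso])
  have AB: "?f n ` ?rA n \<subseteq> ?IB n" for n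
  proof
    fix y assume "y \<in> ?f n ` ?rA n"
    then obtain x r where x: "x \<in> {1..n}" and r: "r \<in> rels P n" and y: "y = ?f n (bsu V n x r)"
      unfolding rA by blast
    show "y \<in> ?IB n"
    proof (cases "n = 3")
      case True
      \<comment> \<open>Each input is the distinguished one of a cyclic relator, which is the first
        tensor factor needed for this relation.\<close>
      have "x = 1 \<or> x = 2 \<or> x = 3" using x True by auto
      then obtain a b where ab: "(x, a, b) \<in> cyclic3" unfolding cyclic3_def by blast
      then have "prelie_class x a b \<in> rels (PreLie :: ('k, _) presentation) 3"
        by (intro subsetD[OF prelie_basis_rels]) (auto simp only: prelie_basis_cyclic3)
      then have mem: "pure_tensor ?TR ?TV (prelie_class x a b) r \<in> ?S" using r unfolding True by blast
      have "?psi (pure_tensor ?TR ?TV (prelie_class x a b) r) = ?f 3 (bsu V 3 x r)"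
        by (rule psi_prelie_class[OF V ab]) (use Pcl[OF r] True in simp)
      then have "y \<in> ?psi ` lin_span (tensor_space ?TR ?TV) ?S"
        unfolding y True by (intro image_eqI[OF _ subsetD[OF lin_span_superset[OF tsp S] mem]]) (rule sym)
      then have "y \<in> ?rB n" unfolding rB using True by simp
      then show ?thesis using generated_ideal_superset[OF opB] by blast
    next
      case False
      \<comment> \<open>Outside arity three the only possible relation is zero, which the linear
        maps preserve.\<close>
      then have "r = \<zero>\<^bsub>arity (free_operad V) n\<^esub>" using P0 r by blast
      then have "y = \<zero>\<^bsub>arity (free_operad ?B) n\<^esub>"
        unfolding y using linear_mapD(7)[OF linear_map_bsu[OF V]] linear_mapD(7)[OF f] by simp
      then show ?thesis using submoduleD(3)[OF operad_idealD(1)[OF idB]] by simp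
    qed
  qed
  have BA: "?rB n \<subseteq> ?f n ` ?IA n" for n
  proof (cases "n = 3")
    case True
    have N: "is_subspace (?f 3 ` ?IA 3) ?TB"
      by (rule submodule_image[OF f operad_idealD(1)[OF idA]])
    \<comment> \<open>For fixed \<open>b\<close> the expression is linear in \<open>a\<close>, so it
      is enough to take \<open>a\<close> among the three relators, where
      \<open>psi_prelie_class\<close> applies.\<close>
    have "?psi (pure_tensor ?TR ?TV a b) \<in> ?f 3 ` ?IA 3" if a: "a \<in> rels PreLie 3" and b: "b \<in> rels P 3" for a b
    proof (rule lin_span_image[OF _ N prelie_basis_subset])
      show "is_linear ?TR ?TB (\<lambda>a. ?psi (pure_tensor ?TR ?TV a b))"
        by (rule linear_map_comp[OF pure_tensor_linear(1)[OF sp[of ?R 3] sp[of V 3] Pcl[OF b]] psi])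
      show "a \<in> lin_span ?TR prelie_basis" using a rels_PreLie_subset by blast
      show "(\<lambda>a. ?psi (pure_tensor ?TR ?TV a b)) ` prelie_basis \<subseteq> ?f 3 ` ?IA 3"
      proof
        fix t assume "t \<in> (\<lambda>a. ?psi (pure_tensor ?TR ?TV a b)) ` prelie_basis"
        then obtain a' where t': "t = ?psi (pure_tensor ?TR ?TV a' b)" and "a' \<in> prelie_basis" by (rule imageE)
        then obtain x y z where xyz: "(x, y, z) \<in> cyclic3" and "a' = prelie_class x y z"
          unfolding prelie_basis_cyclic3 by (elim exE conjE)
        with t' have t: "t = ?psi (pure_tensor ?TR ?TV (prelie_class x y z) b)" by simp
        have "t = ?f 3 (bsu V 3 x b)" unfolding t by (rule psi_prelie_class[OF V xyz Pcl[OF b]])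
        moreover have "x \<in> {1..3}" using xyz by (auto simp: cyclic3_def)
        then have "bsu V 3 x b \<in> ?rA 3" unfolding rA using b by blast
        ultimately show "t \<in> ?f 3 ` ?IA 3" using generated_ideal_superset[OF opA, of ?rA 3] by blast
      qed
    qed
    then have "?psi ` ?S \<subseteq> ?f 3 ` ?IA 3" by blast
    \<comment> \<open>The target is a subspace, as the image of an ideal, so the inclusion passes
      from pure tensors to their span.\<close>
    then have "?psi ` lin_span (tensor_space ?TR ?TV) ?S \<subseteq> ?f 3 ` ?IA 3"
      using lin_span_image[OF psi N S] by blast
    then show ?thesis unfolding rB True by (simp only: if_True simp_thms)
  next
    case False
    then show ?thesis unfolding rB by simp
  qed
  have "?f n ` ?IA n = ?IB n" for n
    by (rule generated_ideal_image[OF opA opB iso A Bcl AB BA])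
  then have "operad_iso (operad_of (bisuccessor P)) (operad_of (PreLie \<bullet>\<^sub>M P))
      (\<lambda>n. coset_map (arity (free_operad ?B) n) (?IB n) (?f n))"
    unfolding operad_of_def gA gB by (rule operad_iso_quotient_operad[OF opA opB iso idA idB])
  moreover have "operad (operad_of (bisuccessor P))" "operad (operad_of (PreLie \<bullet>\<^sub>M P))"
    by (intro operad_operad_of; simp only: gA gB A Bcl)+
  ultimately show ?thesis unfolding operad_isomorphic_def by blast
qed

end
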